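(* Fix $K>k\ge1$. Restricted to even times, the non-backtracking random walk on the family of all finite $(K+1,k+1)$-biregular Ramanujan bigraphs exhibits total-variation cutoff at time $\log_{\sqrt{Kk}}N$ with window size bounded by $3\log_{\sqrt{Kk}}\log N$; that is, for every $\varepsilon\in(0,1)$ there is $N_0$ such that every such bigraph $X$ with $N=N_X\ge N_0$ satisfies $|t_{mix}(\varepsilon,X)-\log_{\sqrt{Kk}}N|\le3\log_{\sqrt{Kk}}\log N$ (the inner logarithm in any fixed base).
   Context: A $(K+1,k+1)$-bigraph is a finite connected bipartite graph $X=(L\sqcup R,E)$ with left vertices of degree $K+1$ and right vertices of degree $k+1$; $E$ is the set of directed edges, $\overrightarrow{LR}$ the edges directed from $L$ to $R$, and $N_X=|\overrightarrow{LR}|$. Ramanujan: let $\mathcal{T}$ be the universal covering tree of $X$ (the $(K+1,k+1)$-biregular tree) and $\Gamma=\mathrm{Aut}(\mathcal{T})$. An operator on functions on (some or all) cells (vertices, directed edges) of $\mathcal{T}$ is geometric if it commutes with $\Gamma$; it then descends to an operator on $X$. An eigenvalue of a geometric operator acting on $X$ is trivial if its eigenfunction, lifted to $\mathcal{T}$, is constant on each orbit of the commutator subgroup $[\Gamma,\Gamma]$. $X$ is Ramanujan if, for every geometric operator $T$, every nontrivial eigenvalue of $T$ on $X$ lies in the $L^2$-spectrum of $T$ on $\mathcal{T}$. The non-backtracking random walk moves from a directed edge $v\to w$ to a uniformly random edge $w\to u$ with $u\ne v$. For $e_0\in E$, let $\mathbf{p}^{2t}_{e_0}$ be its distribution after $2t$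 steps started at $e_0$, and $\mathbf{u}_{e_0}$ the uniform distribution on $\overrightarrow{LR}$ if $e_0\in\overrightarrow{LR}$ (resp.\ on the edges directed from $R$ to $L$ otherwise). $t_{mix}(\varepsilon,X)=\min\{2t\in2\mathbb{N}:\ \forall e_0\in E,\ \|\mathbf{p}^{2t}_{e_0}-\mathbf{u}_{e_0}\|_{TV}<\varepsilon\}$, where $\|\mu-\nu\|_{TV}=\frac12\|\mu-\nu\|_1$.
   Formalization: For k=1 and ε≤1/2 the formal theorem excludes bigraphs that are subdivisions of a bipartite (K+1)-regular graph: these can be Ramanujan in the stated sense, yet the even-time walk alternates between two halves of L, stays at TV distance ≥1/2, and has no mixing time, so the claim fails there. *)

theory Defs
  imports
    "HOL-Probability.Probability"
    "HOL-Algebra.Bij"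
    "HOL-Algebra.Generated_Groups"
    "Graph_Theory.Digraph_Component"
    "Graph_Theory.Pair_Digraph"
begin

section \<open>Bigraphs\<close>

text \<open>
  A simple graph is a symmetric loopfree digraph without parallel arcs (\<^locale>\<open>pair_graph\<close>);
  its arcs are the directed edges, each undirected edge giving two of them.
\<close>

definition bigraph :: "nat \<Rightarrow> nat \<Rightarrow> 'a set \<Rightarrow> 'a set \<Rightarrow> 'a pair_pre_digraph \<Rightarrow> bool" where
  "bigraph K k L R X \<longleftrightarrow>
     pair_graph X \<and> Digraph_Component.connected X \<and>
     pverts X = L \<union> R \<and> L \<inter> R = {} \<and>
     parcs X \<subseteq> L \<times> R \<union> R \<times> L \<and>
     (\<forall>v\<in>L. out_degree X v = K + 1) \<and>
     (\<forall>w\<in>R. out_degree X w = k + 1)"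

definition arcs_between :: "'a set \<Rightarrow> 'a set \<Rightarrow> 'a pair_pre_digraph \<Rightarrow> ('a \<times> 'a) set" where
  "arcs_between A B X = parcs X \<inter> A \<times> B"


section \<open>The universal covering tree\<close>

text \<open>
  The universal cover based at \<open>x\<^sub>0\<close> is realised on the non-backtracking walks starting at \<open>x\<^sub>0\<close>.
  A walk is stored as the reversed list of its vertices, so that its endpoint is the head of the
  list, the covering map is \<^const>\<open>hd\<close>, and a walk is adjacent to its one-step extensions.
\<close>

inductive_set nb_walks :: "'a pair_pre_digraph \<Rightarrow> 'a \<Rightarrow> 'a list set"
  for X :: "'a pair_pre_digraph" and x\<^sub>0 :: 'a where
  start: "x\<^sub>0 \<in> pverts X \<Longrightarrow> [x\<^sub>0] \<in> nb_walks X x\<^sub>0"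
| extend: "v # p \<in> nb_walks X x\<^sub>0 \<Longrightarrow> (v, u) \<in> parcs X \<Longrightarrow> p = [] \<or> u \<noteq> hd p
    \<Longrightarrow> u # v # p \<in> nb_walks X x\<^sub>0"

definition covering_tree :: "'a pair_pre_digraph \<Rightarrow> 'a \<Rightarrow> 'a list pair_pre_digraph" where
  "covering_tree X x\<^sub>0 =
     \<lparr> pverts = nb_walks X x\<^sub>0,
       parcs = {(p, q). p \<in> nb_walks X x\<^sub>0 \<and> q \<in> nb_walks X x\<^sub>0 \<and>
                        ((\<exists>u. q = u # p) \<or> (\<exists>u. p = u # q))} \<rparr>"


section \<open>Cells and automorphisms\<close>

datatype 'v cell = Vertex 'v | Arc "'v \<times> 'v"

definition cells :: "'v pair_pre_digraph \<Rightarrow> 'v cell set" where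
  "cells G = Vertex ` pverts G \<union> Arc ` parcs G"

definition Aut :: "'v pair_pre_digraph \<Rightarrow> ('v \<Rightarrow> 'v) set" where
  "Aut G = {\<gamma> \<in> Bij (pverts G).
     \<forall>u\<in>pverts G. \<forall>v\<in>pverts G. (\<gamma> u, \<gamma> v) \<in> parcs G \<longleftrightarrow> (u, v) \<in> parcs G}"

definition commutator_Aut :: "'v pair_pre_digraph \<Rightarrow> ('v \<Rightarrow> 'v) set" where
  "commutator_Aut G = derived (BijGroup (pverts G)) (Aut G)"


section \<open>Geometric operators\<close>

text \<open>
  Operators are given by kernels with finitely many nonzero entries in every row.  This is what
  makes them act on arbitrary functions, in particular on the periodic lifts of functions on a
  quotient, which are not square summable.  A kernel operator reads only the values on \<open>C\<close>
  of its argument and returns a function vanishing outside \<open>C\<close>.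
\<close>

definition kernel_op ::
    "'c set \<Rightarrow> ('c \<Rightarrow> 'c \<Rightarrow> complex) \<Rightarrow> ('c \<Rightarrow> complex) \<Rightarrow> 'c \<Rightarrow> complex" where
  "kernel_op C a f = (\<lambda>x. if x \<in> C then \<Sum>y\<in>{y \<in> C. a x y \<noteq> 0}. a x y * f y else 0)"

definition geometric_operator ::
    "'v pair_pre_digraph \<Rightarrow> 'v cell set \<Rightarrow> (('v cell \<Rightarrow> complex) \<Rightarrow> 'v cell \<Rightarrow> complex) \<Rightarrow> bool" where
  "geometric_operator G C T \<longleftrightarrow>
     C \<subseteq> cells G \<and> (\<forall>\<gamma>\<in>Aut G. map_cell \<gamma> ` C \<subseteq> C) \<and>
     (\<exists>a. (\<forall>x\<in>C. finite {y \<in> C. a x y \<noteq> 0}) \<and> T = kernel_op C a) \<and>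
     (\<forall>\<gamma>\<in>Aut G. \<forall>f. \<forall>x\<in>C. T (f \<circ> map_cell \<gamma>) x = T f (map_cell \<gamma> x))"

text \<open>
  Functions on \<open>C\<close> are represented by functions vanishing outside \<open>C\<close>.
\<close>

definition l2 :: "'c set \<Rightarrow> ('c \<Rightarrow> complex) set" where
  "l2 C = {f. (\<forall>x. x \<notin> C \<longrightarrow> f x = 0) \<and> (\<lambda>x. (cmod (f x))\<^sup>2) summable_on C}"

definition l2_norm :: "'c set \<Rightarrow> ('c \<Rightarrow> complex) \<Rightarrow> real" where
  "l2_norm C f = sqrt (\<Sum>\<^sub>\<infinity>x\<in>C. (cmod (f x))\<^sup>2)"

text \<open>
  The complement of the spectrum consists of the \<open>\<mu>\<close> for which \<open>T - \<mu>\<close> maps \<open>l\<^sup>2(C)\<close>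
  bijectively onto itself with bounded inverse.
\<close>

definition l2_spectrum :: "'c set \<Rightarrow> (('c \<Rightarrow> complex) \<Rightarrow> 'c \<Rightarrow> complex) \<Rightarrow> complex set" where
  "l2_spectrum C T = {\<mu>. \<not> (bij_betw (\<lambda>f x. T f x - \<mu> * f x) (l2 C) (l2 C) \<and>
     (\<exists>M. \<forall>f\<in>l2 C. l2_norm C f \<le> M * l2_norm C (\<lambda>x. T f x - \<mu> * f x)))}"


section \<open>Ramanujan bigraphs\<close>

abbreviation cover_map :: "'a list cell \<Rightarrow> 'a cell" where
  "cover_map \<equiv> map_cell hd"

text \<open>
  The operator on the image of \<open>C\<close> in \<open>X\<close> induced by \<open>T\<close>.  If \<open>T\<close> is geometric, \<open>T\<close> applied to a
  lifted function is invariant under the deck transformations, so the chosen preimage is immaterial.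
\<close>

definition descent ::
    "'a list cell set \<Rightarrow> (('a list cell \<Rightarrow> complex) \<Rightarrow> 'a list cell \<Rightarrow> complex)
     \<Rightarrow> ('a cell \<Rightarrow> complex) \<Rightarrow> 'a cell \<Rightarrow> complex" where
  "descent C T g = (\<lambda>y. T (g \<circ> cover_map) (inv_into C cover_map y))"

definition eigenfunction ::
    "'a list cell set \<Rightarrow> (('a list cell \<Rightarrow> complex) \<Rightarrow> 'a list cell \<Rightarrow> complex)
     \<Rightarrow> complex \<Rightarrow> ('a cell \<Rightarrow> complex) \<Rightarrow> bool" where
  "eigenfunction C T \<mu> g \<longleftrightarrow>
     (\<exists>y\<in>cover_map ` C. g y \<noteq> 0) \<and> (\<forall>y\<in>cover_map ` C. descent C T g y = \<mu> * g y)"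

definition trivial_eigenfunction ::
    "'a pair_pre_digraph \<Rightarrow> 'a \<Rightarrow> 'a list cell set \<Rightarrow> ('a cell \<Rightarrow> complex) \<Rightarrow> bool" where
  "trivial_eigenfunction X x\<^sub>0 C g \<longleftrightarrow>
     (\<forall>\<gamma>\<in>commutator_Aut (covering_tree X x\<^sub>0). \<forall>x\<in>C.
        g (cover_map (map_cell \<gamma> x)) = g (cover_map x))"

text \<open>
  Eigenvalues are taken together with their eigenfunctions: a value is required to lie in the
  spectrum as soon as one of its eigenfunctions is nontrivial.  The universal covers with
  different base points are isomorphic over \<open>X\<close>.
\<close>

definition ramanujan :: "'a pair_pre_digraph \<Rightarrow> bool" where
  "ramanujan X \<longleftrightarrow>
     (\<forall>x\<^sub>0\<in>pverts X. \<forall>C T. geometric_operator (covering_tree X x\<^sub>0) C T \<longrightarrow>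
        (\<forall>\<mu> g. eigenfunction C T \<mu> g \<and> \<not> trivial_eigenfunction X x\<^sub>0 C g
           \<longrightarrow> \<mu> \<in> l2_spectrum C T))"

text \<open>
  Some set \<open>A\<close> of left vertices contains exactly one neighbour of each right vertex.  When the
  right vertices have degree 2, \<open>X\<close> is the subdivision of a \<open>(K+1)\<close>-regular graph on \<open>L\<close>, and the
  condition says that this graph is bipartite, with sides \<open>A\<close> and \<open>L - A\<close>.  The function that is
  \<open>1\<close> on \<open>A\<close> and \<open>-1\<close> on \<open>L - A\<close> then lifts to a function constant on the orbits of the commutator
  subgroup (each automorphism preserves or swaps the two colour classes), so that such an \<open>X\<close> may
  be Ramanujan although its walk at even times, which alternates between \<open>A\<close> and \<open>L - A\<close>,
  stays at total variation distance at least 1/2 from the uniform distribution.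
\<close>

definition has_left_transversal ::
    "'a set \<Rightarrow> 'a set \<Rightarrow> 'a pair_pre_digraph \<Rightarrow> bool" where
  "has_left_transversal L R X \<longleftrightarrow> (\<exists>A\<subseteq>L. \<forall>w\<in>R. \<exists>!v. v \<in> A \<and> (w, v) \<in> parcs X)"


section \<open>The non-backtracking random walk\<close>

definition nb_successors :: "'a pair_pre_digraph \<Rightarrow> 'a \<times> 'a \<Rightarrow> ('a \<times> 'a) set" where
  "nb_successors X e = {(snd e, u) |u. (snd e, u) \<in> parcs X \<and> u \<noteq> fst e}"

primrec nb_walk_pmf :: "'a pair_pre_digraph \<Rightarrow> 'a \<times> 'a \<Rightarrow> nat \<Rightarrow> ('a \<times> 'a) pmf" where
  "nb_walk_pmf X e\<^sub>0 0 = return_pmf e\<^sub>0"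
| "nb_walk_pmf X e\<^sub>0 (Suc n) =
     bind_pmf (nb_walk_pmf X e\<^sub>0 n) (\<lambda>e. pmf_of_set (nb_successors X e))"

definition uniform_pmf :: "'a set \<Rightarrow> 'a set \<Rightarrow> 'a pair_pre_digraph \<Rightarrow> 'a \<times> 'a \<Rightarrow> ('a \<times> 'a) pmf" where
  "uniform_pmf L R X e\<^sub>0 =
     pmf_of_set (if e\<^sub>0 \<in> arcs_between L R X then arcs_between L R X else arcs_between R L X)"

definition tv_dist :: "'b pmf \<Rightarrow> 'b pmf \<Rightarrow> real" where
  "tv_dist p q = (1/2) * (\<Sum>\<^sub>\<infinity>x. \<bar>pmf p x - pmf q x\<bar>)"

text \<open>The value is \<open>\<infinity>\<close> if no even time has the required property.\<close>

definition t_mix :: "real \<Rightarrow> 'a set \<Rightarrow> 'a set \<Rightarrow> 'a pair_pre_digraph \<Rightarrow> ereal" where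
  "t_mix \<epsilon> L R X =
     (INF n\<in>{n. even n \<and>
                (\<forall>e\<^sub>0\<in>parcs X. tv_dist (nb_walk_pmf X e\<^sub>0 n) (uniform_pmf L R X e\<^sub>0) < \<epsilon>)}.
        ereal (real n))"

end

theory Submission
  imports Defs "HOL-Real_Asymp.Real_Asymp"
begin

text \<open>Let \<open>B\<close> be the operator summing a function on arcs over the non-backtracking successors of an
  arc, and \<open>J\<close> the reversal of arcs. The operator \<open>B\<^sup>n J\<close> is geometric, and on \<open>X\<close> it is symmetric, so
  the Ramanujan property bounds its norm off the trivial functions by its norm on the tree,
  without any analysis of the non-normal operator \<open>B\<close>. On the tree, a walk first climbs towards the
  root and then descends; summing over the turning time gives a norm of order
  \<open>n q\<^sup>n\<close> with \<open>q\<^sup>4 = K k\<close>. With \<open>n = 2 t\<close>, the distance of the walk from its limit is then of order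
  \<open>t \<surd>(N / (K k)\<^sup>t)\<close>, hence small at time \<open>log N + 3 log log N\<close>. The lower bound counts
  the arcs reachable in \<open>2 t\<close> steps.

  A trivial eigenfunction lifts to a function that is constant on the orbits of commutators
  of automorphisms fixing the root. Such commutators act as 3-cycles on the neighbours of the root,
  and varying the base point forces the function to be constant on each of the two directions of
  arcs, up to the exceptional bipartite case with \<open>k = 1\<close>.\<close>

section \<open>Bounded operators on square-summable functions\<close>

text \<open>Since \<open>B\<close> is not normal, its eigenvalues on X do not control the norms of
  its powers. For a symmetric operator on a finite set the norm is the largest modulus of an
  eigenvalue, which is why the Ramanujan property is applied to \<open>B\<^sup>n J\<close>, for each
  n separately. An eigenvalue larger than the operator norm on the tree lies outside the spectrum
  there by a Neumann series, so an upper bound for that norm replaces the computation of any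
  spectrum.

  The constant 3: with s = sqrt (K k), the distance at time 2 t is of order t sqrt(N) / s^t. At 2 t
  = log_s N + 3 log_s log N one has s^t = sqrt(N) (log N)^(3/2), which beats the factor t, of order
  log N, that comes from the turning time.

  For k = 1 and X with a left transversal the walk equidistributes over one half of the arcs of its
  direction, at distance 1/2 from uniform. A threshold \<epsilon> > 1/2 is still reached, and the
  same estimate gives cutoff with \<epsilon> - 1/2 as the admissible error.\<close>

definition l2_bound :: "'c set \<Rightarrow> ('c \<Rightarrow> complex) \<Rightarrow> real \<Rightarrow> bool" where
  "l2_bound A f M \<longleftrightarrow> (\<forall>F. finite F \<and> F \<subseteq> A \<longrightarrow> L2_set (\<lambda>x. cmod (f x)) F \<le> M)"

lemma l2_bound_nonneg: "l2_bound A f M \<Longrightarrow> 0 \<le> M"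
  unfolding l2_bound_def by (metis empty_subsetI finite.emptyI L2_set_empty)

lemma l2_bound_cmod: "l2_bound A f M \<Longrightarrow> x \<in> A \<Longrightarrow> cmod (f x) \<le> M"
  unfolding l2_bound_def by (drule spec[of _ "{x}"]) (simp add: L2_set_def)

lemma l2_bound_sum:
  assumes "l2_bound A f M" "finite F" "F \<subseteq> A"
  shows "(\<Sum>x\<in>F. (cmod (f x))\<^sup>2) \<le> M\<^sup>2"
proof -
  have "sqrt (\<Sum>x\<in>F. (cmod (f x))\<^sup>2) \<le> M"
    using assms unfolding l2_bound_def L2_set_def by blast
  then show ?thesis
    by (metis real_sqrt_le_iff real_sqrt_pow2 power_mono real_sqrt_ge_zero sum_nonneg zero_le_power2)
qed

lemma l2_boundI:
  assumes "0 \<le> M" "\<And>F. finite F \<Longrightarrow> F \<subseteq> A \<Longrightarrow> (\<Sum>x\<in>F. (cmod (f x))\<^sup>2) \<le> M\<^sup>2"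
  shows "l2_bound A f M"
  unfolding l2_bound_def L2_set_def using assms by (auto intro!: real_le_lsqrt sum_nonneg)

text \<open>The bound over finite subsets is the working notion: it carries summability with it and
  survives pointwise limits. This equivalence translates it to the norm used in the definition of
  the spectrum.\<close>

lemma l2_bound_iff:
  "l2_bound A f M \<longleftrightarrow> 0 \<le> M \<and> (\<lambda>x. (cmod (f x))\<^sup>2) summable_on A \<and> l2_norm A f \<le> M"
proof
  assume b: "l2_bound A f M"
  have s: "(\<lambda>x. (cmod (f x))\<^sup>2) summable_on A"
    by (rule nonneg_bdd_above_summable_on) (auto intro!: bdd_aboveI[of _ "M\<^sup>2"] l2_bound_sum[OF b])
  have "(\<Sum>\<^sub>\<infinity>x\<in>A. (cmod (f x))\<^sup>2) \<le> M\<^sup>2"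
    by (rule infsum_le_finite_sums[OF s]) (rule l2_bound_sum[OF b])
  then have "l2_norm A f \<le> M"
    unfolding l2_norm_def using l2_bound_nonneg[OF b] by (rule_tac real_le_lsqrt) auto
  with s l2_bound_nonneg[OF b] show "0 \<le> M \<and> (\<lambda>x. (cmod (f x))\<^sup>2) summable_on A \<and> l2_norm A f \<le> M"
    by blast
next
  assume a: "0 \<le> M \<and> (\<lambda>x. (cmod (f x))\<^sup>2) summable_on A \<and> l2_norm A f \<le> M"
  then have m: "(\<Sum>\<^sub>\<infinity>x\<in>A. (cmod (f x))\<^sup>2) \<le> M\<^sup>2"
    unfolding l2_norm_def using sqrt_le_D by blast
  show "l2_bound A f M"
  proof (rule l2_boundI)
    fix F assume "finite F" "F \<subseteq> A"
    then have "(\<Sum>x\<in>F. (cmod (f x))\<^sup>2) \<le> (\<Sum>\<^sub>\<infinity>x\<in>A. (cmod (f x))\<^sup>2)"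
      using a by (intro finite_sum_le_infsum) auto
    with m show "(\<Sum>x\<in>F. (cmod (f x))\<^sup>2) \<le> M\<^sup>2" by simp
  qed (use a in auto)
qed

lemma l2_bound_mono:
  assumes "l2_bound A f M" "M \<le> M'" "B \<subseteq> A" "\<And>x. x \<in> B \<Longrightarrow> cmod (g x) \<le> cmod (f x)"
  shows "l2_bound B g M'"
  unfolding l2_bound_def
proof (intro allI impI)
  fix F assume F: "finite F \<and> F \<subseteq> B"
  have "L2_set (\<lambda>x. cmod (g x)) F \<le> L2_set (\<lambda>x. cmod (f x)) F"
    by (rule L2_set_mono) (use F assms in auto)
  also have "\<dots> \<le> M" using assms(1,3) F unfolding l2_bound_def by blast
  finally show "L2_set (\<lambda>x. cmod (g x)) F \<le> M'" using assms(2) by simp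
qed

lemma l2_bound_add:
  assumes "l2_bound A f a" "l2_bound A g b" "\<And>x. x \<in> A \<Longrightarrow> cmod (h x) \<le> cmod (f x) + cmod (g x)"
  shows "l2_bound A h (a + b)"
  unfolding l2_bound_def
proof (intro allI impI)
  fix F assume F: "finite F \<and> F \<subseteq> A"
  have "L2_set (\<lambda>x. cmod (h x)) F \<le> L2_set (\<lambda>x. cmod (f x) + cmod (g x)) F"
    by (rule L2_set_mono) (use F assms in auto)
  also have "\<dots> \<le> L2_set (\<lambda>x. cmod (f x)) F + L2_set (\<lambda>x. cmod (g x)) F"
    by (rule L2_set_triangle_ineq)
  also have "\<dots> \<le> a + b" using assms(1,2) F unfolding l2_bound_def by (meson add_mono)
  finally show "L2_set (\<lambda>x. cmod (h x)) F \<le> a + b" .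
qed

lemma l2_bound_scale:
  assumes "l2_bound A f a"
  shows "l2_bound A (\<lambda>x. c * f x) (cmod c * a)"
  unfolding l2_bound_def
proof (intro allI impI)
  fix F assume F: "finite F \<and> F \<subseteq> A"
  have "L2_set (\<lambda>x. cmod (c * f x)) F = cmod c * L2_set (\<lambda>x. cmod (f x)) F"
    by (simp add: norm_mult L2_set_right_distrib)
  also have "\<dots> \<le> cmod c * a"
    using assms F unfolding l2_bound_def by (intro mult_left_mono) auto
  finally show "L2_set (\<lambda>x. cmod (c * f x)) F \<le> cmod c * a" .
qed

lemma l2_bound_Un:
  assumes "l2_bound A f a" "l2_bound B f b"
  shows "l2_bound (A \<union> B) f (a + b)"
proof (rule l2_boundI)
  show "0 \<le> a + b" using assms by (meson add_nonneg_nonneg l2_bound_nonneg)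
  fix F assume F: "finite F" "F \<subseteq> A \<union> B"
  have "(\<Sum>x\<in>F. (cmod (f x))\<^sup>2) = (\<Sum>x\<in>F \<inter> A. (cmod (f x))\<^sup>2) + (\<Sum>x\<in>F - A. (cmod (f x))\<^sup>2)"
    using F(1) by (rule sum.Int_Diff)
  also have "\<dots> \<le> a\<^sup>2 + b\<^sup>2"
    by (intro add_mono l2_bound_sum[OF assms(1)] l2_bound_sum[OF assms(2)]) (use F in auto)
  also have "\<dots> \<le> (a + b)\<^sup>2"
    using l2_bound_nonneg[OF assms(1)] l2_bound_nonneg[OF assms(2)] by (simp add: power2_sum)
  finally show "(\<Sum>x\<in>F. (cmod (f x))\<^sup>2) \<le> (a + b)\<^sup>2" .
qed

text \<open>A weighted Schur test: the Cauchy--Schwarz inequality along the rows has already been spent on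
  the first hypothesis, and only the column sums of the weights remain.\<close>

lemma l2_bound_transfer:
  fixes h :: "'d \<Rightarrow> 'c \<Rightarrow> real"
  assumes f: "l2_bound B f M" and "0 \<le> \<beta>"
    and S: "\<And>x. x \<in> A \<Longrightarrow> finite (S x) \<and> S x \<subseteq> B"
    and h0: "\<And>x y. x \<in> A \<Longrightarrow> y \<in> S x \<Longrightarrow> 0 \<le> h x y"
    and g: "\<And>x. x \<in> A \<Longrightarrow> (cmod (g x))\<^sup>2 \<le> (\<Sum>y\<in>S x. h x y * (cmod (f y))\<^sup>2)"
    and col: "\<And>F y. finite F \<Longrightarrow> F \<subseteq> A \<Longrightarrow> y \<in> B \<Longrightarrow> (\<Sum>x\<in>{x\<in>F. y \<in> S x}. h x y) \<le> \<beta>\<^sup>2"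
  shows "l2_bound A g (\<beta> * M)"
proof (rule l2_boundI)
  show "0 \<le> \<beta> * M" using assms(2) l2_bound_nonneg[OF f] by simp
  fix F assume F: "finite F" "F \<subseteq> A"
  define G where "G = (\<Union>x\<in>F. S x)"
  have G: "finite G" "G \<subseteq> B" using F S unfolding G_def by blast+
  have "(\<Sum>x\<in>F. (cmod (g x))\<^sup>2) \<le> (\<Sum>x\<in>F. \<Sum>y\<in>S x. h x y * (cmod (f y))\<^sup>2)"
    by (rule sum_mono) (use F g in auto)
  also have "\<dots> = (\<Sum>x\<in>F. \<Sum>y\<in>{y\<in>G. y \<in> S x}. h x y * (cmod (f y))\<^sup>2)"
    by (intro sum.cong refl) (auto simp: G_def)
  also have "\<dots> = (\<Sum>y\<in>G. \<Sum>x\<in>{x\<in>F. y \<in> S x}. h x y * (cmod (f y))\<^sup>2)"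
    by (rule sum.swap_restrict) (use F G in auto)
  also have "\<dots> = (\<Sum>y\<in>G. (\<Sum>x\<in>{x\<in>F. y \<in> S x}. h x y) * (cmod (f y))\<^sup>2)"
    by (simp add: sum_distrib_right)
  also have "\<dots> \<le> (\<Sum>y\<in>G. \<beta>\<^sup>2 * (cmod (f y))\<^sup>2)"
    by (intro sum_mono mult_right_mono col) (use F G in auto)
  also have "\<dots> = \<beta>\<^sup>2 * (\<Sum>y\<in>G. (cmod (f y))\<^sup>2)" by (simp add: sum_distrib_left)
  also have "\<dots> \<le> \<beta>\<^sup>2 * M\<^sup>2" by (intro mult_left_mono l2_bound_sum[OF f] G) auto
  finally show "(\<Sum>x\<in>F. (cmod (g x))\<^sup>2) \<le> (\<beta> * M)\<^sup>2" by (simp add: power_mult_distrib)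
qed

lemma l2_iff_bound: "f \<in> l2 A \<longleftrightarrow> (\<forall>x. x \<notin> A \<longrightarrow> f x = 0) \<and> l2_bound A f (l2_norm A f)"
  unfolding l2_def l2_bound_iff by (auto simp: l2_norm_def infsum_nonneg)

lemma l2I: "(\<And>x. x \<notin> A \<Longrightarrow> f x = 0) \<Longrightarrow> l2_bound A f M \<Longrightarrow> f \<in> l2 A"
  unfolding l2_def l2_bound_iff by auto

text \<open>Neumann series. The solution of T f - \<mu> f = h is the pointwise limit of the
  iteration v := (T v - h) / \<mu>, which contracts with ratio \<open>\<rho> / cmod \<mu>\<close>.
  Rows of finite support make \<open>T\<close> commute with pointwise limits, and the
  \<open>l2_bound\<close> of the iterates passes to the limit.\<close>

lemma not_in_l2_spectrumI:
  fixes T :: "('c \<Rightarrow> complex) \<Rightarrow> 'c \<Rightarrow> complex"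
  assumes T: "T = kernel_op C a" and fin: "\<And>x. x \<in> C \<Longrightarrow> finite {y \<in> C. a x y \<noteq> 0}"
    and bd: "\<And>f M. l2_bound C f M \<Longrightarrow> l2_bound C (T f) (\<rho> * M)"
    and \<rho>: "0 \<le> \<rho>" "\<rho> < cmod \<mu>"
  shows "\<mu> \<notin> l2_spectrum C T"
proof -
  have \<mu>0: "cmod \<mu> > 0" using \<rho> by linarith
  have Tout: "T f x = 0" if "x \<notin> C" for f x using that by (simp add: T kernel_op_def)
  have Tdiff: "T (\<lambda>x. f x - g x) = (\<lambda>x. T f x - T g x)" for f g
    by (rule ext) (simp add: T kernel_op_def sum_subtractf right_diff_distrib)
  have Tdiv: "T (\<lambda>x. f x / c) = (\<lambda>x. T f x / c)" for f c
    by (rule ext) (simp add: T kernel_op_def sum_divide_distrib)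
  have maps: "(\<lambda>x. T f x - \<mu> * f x) \<in> l2 C" if "f \<in> l2 C" for f
  proof (rule l2I)
    show "l2_bound C (\<lambda>x. T f x - \<mu> * f x) (\<rho> * l2_norm C f + cmod \<mu> * l2_norm C f)"
      using that unfolding l2_iff_bound
      by (intro l2_bound_add[OF bd l2_bound_scale]) (auto intro: norm_triangle_ineq4)
    show "\<And>x. x \<notin> C \<Longrightarrow> T f x - \<mu> * f x = 0" using that Tout by (auto simp: l2_def)
  qed
  \<comment> \<open>|\<mu>| times the norm of f is at most \<rho> times that norm plus the norm of T
    f - \<mu> f; the gap |\<mu>| - \<rho> therefore bounds the inverse.\<close>
  define M where "M = 1 / (cmod \<mu> - \<rho>)"
  have low: "l2_norm C f \<le> M * l2_norm C (\<lambda>x. T f x - \<mu> * f x)" if f: "f \<in> l2 C" for f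
  proof -
    let ?h = "\<lambda>x. T f x - \<mu> * f x"
    have fb: "l2_bound C f (l2_norm C f)" and hb: "l2_bound C ?h (l2_norm C ?h)"
      using f maps[OF f] by (simp_all add: l2_iff_bound)
    have "l2_bound C (\<lambda>x. \<mu> * f x) (\<rho> * l2_norm C f + l2_norm C ?h)"
    proof (rule l2_bound_add[OF bd[OF fb] hb])
      show "cmod (\<mu> * f x) \<le> cmod (T f x) + cmod (?h x)" for x
        using norm_triangle_ineq4[of "T f x" "?h x"] by simp
    qed
    from l2_bound_scale[OF this, of "1 / \<mu>"]
    have "l2_bound C f ((\<rho> * l2_norm C f + l2_norm C ?h) / cmod \<mu>)"
      using \<mu>0 by (simp add: norm_divide)
    then have "l2_norm C f \<le> (\<rho> * l2_norm C f + l2_norm C ?h) / cmod \<mu>"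
      by (simp add: l2_bound_iff)
    then have "(cmod \<mu> - \<rho>) * l2_norm C f \<le> l2_norm C ?h"
      using \<mu>0 by (simp add: field_simps)
    then show ?thesis unfolding M_def using \<rho> by (simp add: field_simps)
  qed
  have inj: "inj_on (\<lambda>f x. T f x - \<mu> * f x) (l2 C)"
  proof (rule inj_onI)
    fix f g assume f: "f \<in> l2 C" and g: "g \<in> l2 C"
      and eq: "(\<lambda>x. T f x - \<mu> * f x) = (\<lambda>x. T g x - \<mu> * g x)"
    let ?d = "\<lambda>x. f x - g x"
    have d: "?d \<in> l2 C"
    proof (rule l2I)
      show "l2_bound C ?d (l2_norm C f + l2_norm C g)"
        by (rule l2_bound_add[of _ f _ g]) (use f g in \<open>auto simp: l2_iff_bound intro: norm_triangle_ineq4\<close>)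
    qed (use f g in \<open>auto simp: l2_def\<close>)
    have "(\<lambda>x. T ?d x - \<mu> * ?d x) = (\<lambda>x. 0)"
      using eq unfolding Tdiff fun_eq_iff by (auto simp: algebra_simps)
    with low[OF d] have "l2_norm C ?d \<le> 0" by (simp add: l2_norm_def)
    then have *: "l2_bound C ?d 0" using d by (simp add: l2_bound_iff l2_def)
    have "?d x = 0" for x
      using l2_bound_cmod[OF *, of x] d by (cases "x \<in> C") (auto simp: l2_def)
    then show "f = g" by auto
  qed
  have surj: "\<exists>f\<in>l2 C. (\<lambda>x. T f x - \<mu> * f x) = h" if h: "h \<in> l2 C" for h
  proof -
    define u where "u = rec_nat (\<lambda>x. 0) (\<lambda>_ v x. (T v x - h x) / \<mu>)"
    have u0: "u 0 = (\<lambda>x. 0)" and uS: "u (Suc n) = (\<lambda>x. (T (u n) x - h x) / \<mu>)" for n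
      by (simp_all add: u_def)
    define r where "r = \<rho> / cmod \<mu>"
    define D where "D = l2_norm C h / cmod \<mu>"
    have r: "0 \<le> r" "r < 1" using \<rho> \<mu>0 by (simp_all add: r_def)
    have T0: "T (\<lambda>x. 0) = (\<lambda>x. 0)" by (rule ext) (simp add: T kernel_op_def)
    have hb: "l2_bound C h (l2_norm C h)" using h by (simp add: l2_iff_bound)
    \<comment> \<open>Successive differences satisfy d (n + 1) = T (d n) / \<mu>, hence decay
      geometrically with ratio \<open>r\<close>.\<close>
    define d where "d n = (\<lambda>x. u (Suc n) x - u n x)" for n
    have db: "l2_bound C (d n) (r ^ n * D)" for n
    proof (induction n)
      case 0
      have "d 0 = (\<lambda>x. (- 1 / \<mu>) * h x)" by (simp add: d_def u0 uS T0)
      then show ?case using l2_bound_scale[OF hb, of "- 1 / \<mu>"] by (simp add: D_def norm_divide)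
    next
      case (Suc n)
      have "d (Suc n) = (\<lambda>x. (1 / \<mu>) * T (d n) x)"
        unfolding d_def Tdiff uS[of "Suc n"] uS[of n] by (simp add: diff_divide_distrib)
      then show ?case using l2_bound_scale[OF bd[OF Suc], of "1 / \<mu>"]
        by (simp add: norm_divide r_def field_simps)
    qed
    have D0: "0 \<le> D" using l2_bound_nonneg[OF db[of 0]] by simp
    have uout: "u n x = 0" if "x \<notin> C" for n x
      using that h by (induction n) (auto simp: u0 uS Tout l2_def)
    have usum: "u n x = (\<Sum>i<n. d i x)" for n x
      by (induction n) (auto simp: u0 d_def)
    have conv: "\<exists>l. (\<lambda>n. u n x) \<longlonglongrightarrow> l" for x
    proof (cases "x \<in> C")
      case True
      have "summable (\<lambda>i. d i x)"
      proof (rule summable_comparison_test')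
        show "summable (\<lambda>i. r ^ i * D)" using r by (intro summable_mult2 summable_geometric) auto
        show "cmod (d n x) \<le> r ^ n * D" for n by (rule l2_bound_cmod[OF db True])
      qed
      then show ?thesis unfolding usum by (intro exI) (rule summable_LIMSEQ)
    qed (auto simp: uout)
    then obtain v where v: "(\<lambda>n. u n x) \<longlonglongrightarrow> v x" for x by metis
    have ub: "l2_bound C (u n) (D / (1 - r))" for n
    proof -
      have "l2_bound C (u n) (\<Sum>i<n. r ^ i * D)" for n
      proof (induction n)
        case 0 then show ?case by (simp add: u0 l2_bound_def L2_set_def)
      next
        case (Suc n)
        show ?case unfolding sum.lessThan_Suc
        proof (rule l2_bound_add[OF Suc db[of n]])
          show "cmod (u (Suc n) x) \<le> cmod (u n x) + cmod (d n x)" for x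
            using norm_triangle_ineq[of "u n x" "d n x"] by (simp add: d_def)
        qed
      qed
      moreover have "(\<Sum>i<n. r ^ i * D) \<le> D / (1 - r)"
      proof -
        have "(\<Sum>i<n. r ^ i) \<le> 1 / (1 - r)"
          using r sum_le_suminf[of "\<lambda>i. r ^ i" "{..<n}"] by (simp add: summable_geometric suminf_geometric)
        then have "(\<Sum>i<n. r ^ i) * D \<le> 1 / (1 - r) * D" using D0 by (rule mult_right_mono)
        then show ?thesis by (simp add: sum_distrib_right)
      qed
      ultimately show ?thesis by (rule_tac l2_bound_mono) auto
    qed
    have vb: "l2_bound C v (D / (1 - r))"
      unfolding l2_bound_def
    proof (intro allI impI)
      fix F assume F: "finite F \<and> F \<subseteq> C"
      have "(\<lambda>n. L2_set (\<lambda>x. cmod (u n x)) F) \<longlonglongrightarrow> L2_set (\<lambda>x. cmod (v x)) F"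
        unfolding L2_set_def by (intro tendsto_intros v)
      then show "L2_set (\<lambda>x. cmod (v x)) F \<le> D / (1 - r)"
        by (rule LIMSEQ_le_const2) (use ub F in \<open>auto simp: l2_bound_def\<close>)
    qed
    have vout: "v x = 0" if "x \<notin> C" for x
      using v[of x] uout[OF that] by (simp add: LIMSEQ_const_iff)
    have vl: "v \<in> l2 C" by (rule l2I[OF vout vb])
    have "(T v x - h x) / \<mu> = v x" for x
    proof -
      have "(\<lambda>n. T (u n) x) \<longlonglongrightarrow> T v x"
        unfolding T kernel_op_def by (auto intro!: tendsto_intros v)
      then have "(\<lambda>n. u (Suc n) x) \<longlonglongrightarrow> (T v x - h x) / \<mu>"
        unfolding uS using \<mu>0 by (auto intro!: tendsto_intros)
      moreover have "(\<lambda>n. u (Suc n) x) \<longlonglongrightarrow> v x" by (rule LIMSEQ_Suc[OF v])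
      ultimately show ?thesis by (rule LIMSEQ_unique)
    qed
    then have "T v x - h x = \<mu> * v x" for x using \<mu>0 by (metis nonzero_divide_eq_eq mult.commute norm_eq_zero less_irrefl)
    then have "(\<lambda>x. T v x - \<mu> * v x) = h" by (auto simp: algebra_simps fun_eq_iff)
    with vl show ?thesis by blast
  qed
  have "bij_betw (\<lambda>f x. T f x - \<mu> * f x) (l2 C) (l2 C)"
    unfolding bij_betw_def using inj maps surj by (force simp: image_iff)
  with low show ?thesis unfolding l2_spectrum_def by blast
qed

section \<open>The non-backtracking operator\<close>

text \<open>Shared by the finite graph X and its infinite covering tree; hence local finiteness in
  place of finiteness.\<close>

locale sym_graph =
  fixes G :: "'v pair_pre_digraph"
  assumes arc_sym: "(u, v) \<in> parcs G \<Longrightarrow> (v, u) \<in> parcs G"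
    and arc_verts: "(u, v) \<in> parcs G \<Longrightarrow> u \<in> pverts G"
    and finite_nbrs: "finite {w. (v, w) \<in> parcs G}"

definition nbrs :: "'v pair_pre_digraph \<Rightarrow> 'v \<Rightarrow> 'v set" where
  "nbrs G v = {w. (v, w) \<in> parcs G}"

lemma (in sym_graph) arc_verts2: "(u, v) \<in> parcs G \<Longrightarrow> v \<in> pverts G"
  using arc_sym arc_verts by blast

lemma nbrs_iff: "w \<in> nbrs G v \<longleftrightarrow> (v, w) \<in> parcs G"
  by (simp add: nbrs_def)

lemma nb_successors_eq: "nb_successors G e = Pair (snd e) ` (nbrs G (snd e) - {fst e})"
  by (auto simp: nb_successors_def nbrs_def)

lemma nb_successors_subset: "nb_successors G e \<subseteq> parcs G"
  by (auto simp: nb_successors_def)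

lemma (in sym_graph) finite_nb_successors: "finite (nb_successors G e)"
  using finite_nbrs by (simp add: nb_successors_eq nbrs_def)

text \<open>Polymorphic in the values: geometric operators act on complex functions, while the
  eigenvector argument on X runs over the reals; \<open>of_real_nb_rev\<close> connects the
  two.\<close>

definition nb_sum :: "'v pair_pre_digraph \<Rightarrow> ('v \<times> 'v \<Rightarrow> 'b::comm_monoid_add) \<Rightarrow> 'v \<times> 'v \<Rightarrow> 'b" where
  "nb_sum G f e = (\<Sum>e'\<in>nb_successors G e. f e')"

text \<open>Composing the walk with the reversal of arcs makes it symmetric on a finite graph.\<close>

definition nb_rev :: "'v pair_pre_digraph \<Rightarrow> nat \<Rightarrow> ('v \<times> 'v \<Rightarrow> 'b::comm_monoid_add) \<Rightarrow> 'v \<times> 'v \<Rightarrow> 'b" where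
  "nb_rev G n f = (nb_sum G ^^ n) (f \<circ> prod.swap)"

lemma nb_sum_cong:
  assumes "\<And>e. e \<in> parcs G \<Longrightarrow> f e = g e"
  shows "nb_sum G f e = nb_sum G g e"
  unfolding nb_sum_def using assms nb_successors_subset[of G e] by (intro sum.cong) auto

lemma nb_pow_cong:
  assumes "\<And>e. e \<in> parcs G \<Longrightarrow> f e = g e" "e \<in> parcs G"
  shows "(nb_sum G ^^ n) f e = (nb_sum G ^^ n) g e"
  using assms(2) by (induction n arbitrary: e) (auto intro!: nb_sum_cong assms(1))

lemma nb_pow_linear:
  "(nb_sum G ^^ n) (\<lambda>e. a * f e + g e :: real) = (\<lambda>e. a * (nb_sum G ^^ n) f e + (nb_sum G ^^ n) g e)"
  by (induction n) (simp_all add: nb_sum_def[abs_def] sum.distrib sum_distrib_left)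

lemma of_real_nb_rev: "nb_rev G n (\<lambda>e. of_real (f e) :: complex) e = of_real (nb_rev G n f e)"
proof -
  have "(nb_sum G ^^ n) (\<lambda>e. of_real (h e) :: complex) e = of_real ((nb_sum G ^^ n) h e)" for h e
    by (induction n arbitrary: e) (simp_all add: nb_sum_def)
  from this[of "f \<circ> prod.swap"] show ?thesis by (simp add: nb_rev_def comp_def)
qed

text \<open>Captures both the automorphisms of the tree and the covering map \<open>hd\<close>, so
  that one computation yields the equivariance of the operator and its descent to X.\<close>

definition local_iso :: "'v pair_pre_digraph \<Rightarrow> 'w pair_pre_digraph \<Rightarrow> ('v \<Rightarrow> 'w) \<Rightarrow> bool" where
  "local_iso G H \<phi> \<longleftrightarrow> (\<forall>v\<in>pverts G. bij_betw \<phi> (nbrs G v) (nbrs H (\<phi> v)))"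

lemma local_iso_arc:
  assumes "sym_graph G" "local_iso G H \<phi>" "e \<in> parcs G"
  shows "map_prod \<phi> \<phi> e \<in> parcs H"
proof -
  obtain u v where e: "e = (u, v)" by force
  then have "u \<in> pverts G" "v \<in> nbrs G u"
    using assms(3) sym_graph.arc_verts[OF assms(1)] by (auto simp: nbrs_iff)
  then have "\<phi> v \<in> nbrs H (\<phi> u)" using assms(2) unfolding local_iso_def bij_betw_def by blast
  then show ?thesis by (simp add: e nbrs_iff)
qed

text \<open>A bijection of neighbour sets takes the backtracking neighbour to the backtracking
  neighbour, so it restricts to the remaining ones.\<close>

lemma nb_sum_local_iso:
  assumes G: "sym_graph G" and \<phi>: "local_iso G H \<phi>" and e: "e \<in> parcs G"
  shows "nb_sum G (f \<circ> map_prod \<phi> \<phi>) e = nb_sum H f (map_prod \<phi> \<phi> e)"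
proof -
  interpret sym_graph G by fact
  obtain u v where uv: "e = (u, v)" by force
  have v: "v \<in> pverts G" "u \<in> nbrs G v"
    using e by (auto simp: uv nbrs_iff intro: arc_sym arc_verts2)
  then have b: "bij_betw \<phi> (nbrs G v) (nbrs H (\<phi> v))" using \<phi> by (simp add: local_iso_def)
  have b': "bij_betw \<phi> (nbrs G v - {u}) (nbrs H (\<phi> v) - {\<phi> u})"
    using b v by (auto simp: bij_betw_def inj_on_def)
  have "nb_sum H f (map_prod \<phi> \<phi> e) = (\<Sum>w\<in>nbrs H (\<phi> v) - {\<phi> u}. f (\<phi> v, w))"
    unfolding nb_sum_def nb_successors_eq by (subst sum.reindex) (auto simp: uv inj_on_def)
  also have "\<dots> = (\<Sum>w\<in>nbrs G v - {u}. f (\<phi> v, \<phi> w))"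
    by (rule sum.reindex_bij_betw[OF b', symmetric])
  also have "\<dots> = nb_sum G (f \<circ> map_prod \<phi> \<phi>) e"
    unfolding nb_sum_def nb_successors_eq by (subst sum.reindex) (auto simp: uv inj_on_def)
  finally show ?thesis ..
qed

lemma nb_rev_local_iso:
  assumes G: "sym_graph G" and \<phi>: "local_iso G H \<phi>" and e: "e \<in> parcs G"
  shows "nb_rev G n (f \<circ> map_prod \<phi> \<phi>) e = nb_rev H n f (map_prod \<phi> \<phi> e)"
proof -
  have "(nb_sum G ^^ n) (g \<circ> map_prod \<phi> \<phi>) e = (nb_sum H ^^ n) g (map_prod \<phi> \<phi> e)"
    if "e \<in> parcs G" for g e
    using that
  proof (induction n arbitrary: e)
    case (Suc n)
    have "(nb_sum G ^^ Suc n) (g \<circ> map_prod \<phi> \<phi>) e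
        = nb_sum G ((nb_sum H ^^ n) g \<circ> map_prod \<phi> \<phi>) e"
      by (simp, rule nb_sum_cong) (simp add: Suc.IH)
    also have "\<dots> = nb_sum H ((nb_sum H ^^ n) g) (map_prod \<phi> \<phi> e)"
      by (rule nb_sum_local_iso[OF G \<phi> Suc.prems])
    finally show ?case unfolding funpow.simps comp_apply .
  qed simp
  from this[OF e, of "f \<circ> prod.swap"] show ?thesis
    unfolding nb_rev_def by (simp add: comp_def map_prod_def case_prod_beta prod.swap_def)
qed

text \<open>A functional reading finitely many coordinates with fixed coefficients, that is, one row
  of a kernel as in \<open>kernel_op\<close>. Evaluations have this form and finite sums preserve
  it, so the rows of the iterated operator are obtained without describing their
  coefficients.\<close>

definition finite_row :: "'e set \<Rightarrow> (('e \<Rightarrow> complex) \<Rightarrow> complex) \<Rightarrow> bool" where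
  "finite_row A \<Lambda> \<longleftrightarrow>
     (\<exists>c. finite {y \<in> A. c y \<noteq> 0} \<and> (\<forall>f. \<Lambda> f = (\<Sum>y\<in>{y \<in> A. c y \<noteq> 0}. c y * f y)))"

lemma finite_row_eval:
  assumes "e \<in> A"
  shows "finite_row A (\<lambda>f. f e)"
proof -
  let ?c = "\<lambda>y. if y = e then 1 else 0 :: complex"
  have "{y \<in> A. ?c y \<noteq> 0} = {e}" using assms by auto
  then show ?thesis unfolding finite_row_def by (intro exI[of _ ?c]) simp
qed

lemma finite_row_add:
  assumes "finite_row A \<Lambda>" "finite_row A \<Lambda>'"
  shows "finite_row A (\<lambda>f. \<Lambda> f + \<Lambda>' f)"
proof -
  from assms(1)[unfolded finite_row_def] obtain c where c': "finite {y \<in> A. c y \<noteq> 0} \<and>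
      (\<forall>f. \<Lambda> f = (\<Sum>y\<in>{y \<in> A. c y \<noteq> 0}. c y * f y))" ..
  note c = conjunct1[OF c'] spec[OF conjunct2[OF c']]
  from assms(2)[unfolded finite_row_def] obtain d where d': "finite {y \<in> A. d y \<noteq> 0} \<and>
      (\<forall>f. \<Lambda>' f = (\<Sum>y\<in>{y \<in> A. d y \<noteq> 0}. d y * f y))" ..
  note d = conjunct1[OF d'] spec[OF conjunct2[OF d']]
  let ?S = "{y \<in> A. c y \<noteq> 0} \<union> {y \<in> A. d y \<noteq> 0}"
  have sub: "{y \<in> A. c y + d y \<noteq> 0} \<subseteq> ?S" by auto
  have "\<Lambda> f + \<Lambda>' f = (\<Sum>y\<in>{y \<in> A. c y + d y \<noteq> 0}. (c y + d y) * f y)" for f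
  proof -
    have "\<Lambda> f = (\<Sum>y\<in>?S. c y * f y)"
      unfolding c(2) by (rule sum.mono_neutral_left) (use c d in auto)
    moreover have "\<Lambda>' f = (\<Sum>y\<in>?S. d y * f y)"
      unfolding d(2) by (rule sum.mono_neutral_left) (use c d in auto)
    moreover have "(\<Sum>y\<in>{y \<in> A. c y + d y \<noteq> 0}. (c y + d y) * f y) = (\<Sum>y\<in>?S. (c y + d y) * f y)"
      by (rule sum.mono_neutral_left) (use c d in auto)
    ultimately show ?thesis by (simp add: sum.distrib distrib_right)
  qed
  moreover have "finite {y \<in> A. c y + d y \<noteq> 0}" using finite_subset[OF sub] c d by blast
  ultimately show ?thesis unfolding finite_row_def by (intro exI[of _ "\<lambda>y. c y + d y"]) blast
qed

lemma finite_row_sum: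
  assumes "finite I" "\<And>i. i \<in> I \<Longrightarrow> finite_row A (\<Lambda> i)"
  shows "finite_row A (\<lambda>f. \<Sum>i\<in>I. \<Lambda> i f)"
  using assms
proof (induction I rule: finite_induct)
  case empty
  show ?case unfolding finite_row_def by (intro exI[of _ "\<lambda>_. 0"]) simp
qed (simp add: finite_row_add)

lemma (in sym_graph) nb_rev_row:
  assumes "e \<in> parcs G"
  shows "finite_row (parcs G) (\<lambda>f. nb_rev G n f e)"
  using assms
proof (induction n arbitrary: e)
  case 0
  then have "prod.swap e \<in> parcs G" by (cases e) (auto intro: arc_sym)
  then show ?case by (simp add: nb_rev_def finite_row_eval)
next
  case (Suc n)
  have "nb_rev G (Suc n) f e = (\<Sum>x\<in>nb_successors G e. nb_rev G n f x)" for f :: "_ \<Rightarrow> complex"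
    by (simp add: nb_rev_def nb_sum_def)
  moreover have "finite_row (parcs G) (\<lambda>f. nb_rev G n f x)" if "x \<in> nb_successors G e" for x
    by (rule Suc.IH) (use that nb_successors_subset in blast)
  ultimately show ?case
    using finite_row_sum[OF finite_nb_successors[of e], of "parcs G" "\<lambda>x f. nb_rev G n f x"] by simp
qed

text \<open>The value is 0 off the arcs because \<open>kernel_op\<close> returns functions that
  vanish outside its set of cells.\<close>

definition nb_rev_op :: "'v pair_pre_digraph \<Rightarrow> nat \<Rightarrow> ('v cell \<Rightarrow> complex) \<Rightarrow> 'v cell \<Rightarrow> complex" where
  "nb_rev_op G n f = (\<lambda>x. case x of Vertex _ \<Rightarrow> 0
     | Arc e \<Rightarrow> if e \<in> parcs G then nb_rev G n (\<lambda>e. f (Arc e)) e else 0)"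

lemma (in sym_graph) nb_rev_op_kernel:
  "\<exists>a. (\<forall>x\<in>Arc ` parcs G. finite {y \<in> Arc ` parcs G. a x y \<noteq> 0}) \<and>
       nb_rev_op G n = kernel_op (Arc ` parcs G) a"
proof -
  have "\<forall>e\<in>parcs G. \<exists>c. finite {y \<in> parcs G. c y \<noteq> 0} \<and>
      (\<forall>f :: _ \<Rightarrow> complex. nb_rev G n f e = (\<Sum>y\<in>{y \<in> parcs G. c y \<noteq> 0}. c y * f y))"
    by (intro ballI nb_rev_row[unfolded finite_row_def])
  from bchoice[OF this] obtain c where c: "\<forall>e\<in>parcs G. finite {y \<in> parcs G. c e y \<noteq> 0} \<and>
      (\<forall>f :: _ \<Rightarrow> complex. nb_rev G n f e = (\<Sum>y\<in>{y \<in> parcs G. c e y \<noteq> 0}. c e y * f y))" ..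
  define a where "a x y = (case (x, y) of (Arc e, Arc e') \<Rightarrow> c e e' | _ \<Rightarrow> 0)" for x y :: "'v cell"
  have supp: "{y \<in> Arc ` parcs G. a (Arc e) y \<noteq> 0} = Arc ` {y \<in> parcs G. c e y \<noteq> 0}" for e
    by (auto simp: a_def)
  have fin: "finite {y \<in> Arc ` parcs G. a (Arc e) y \<noteq> 0}" if "e \<in> parcs G" for e
    unfolding supp using c that by blast
  have "nb_rev_op G n f x = kernel_op (Arc ` parcs G) a f x" for f x
  proof (cases "x \<in> Arc ` parcs G")
    case True
    then obtain e where e: "x = Arc e" "e \<in> parcs G" by blast
    have "nb_rev_op G n f x = (\<Sum>y\<in>{y \<in> parcs G. c e y \<noteq> 0}. c e y * f (Arc y))"
      using c e by (simp add: nb_rev_op_def)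
    also have "\<dots> = (\<Sum>y\<in>Arc ` {y \<in> parcs G. c e y \<noteq> 0}. a (Arc e) y * f y)"
      by (subst sum.reindex) (auto simp: inj_on_def a_def)
    also have "\<dots> = kernel_op (Arc ` parcs G) a f x" using e by (simp add: kernel_op_def supp)
    finally show ?thesis .
  next
    case False
    then show ?thesis by (cases x) (auto simp: nb_rev_op_def kernel_op_def)
  qed
  with fin show ?thesis by (intro exI[of _ a]) (auto simp: fun_eq_iff)
qed

lemma Aut_local_iso:
  assumes G: "sym_graph G" and \<gamma>: "\<gamma> \<in> Aut G"
  shows "local_iso G G \<gamma>"
  unfolding local_iso_def
proof
  interpret sym_graph G by fact
  fix v assume v: "v \<in> pverts G"
  have b: "bij_betw \<gamma> (pverts G) (pverts G)" and
    ar: "\<And>u v. u \<in> pverts G \<Longrightarrow> v \<in> pverts G \<Longrightarrow> (\<gamma> u, \<gamma> v) \<in> parcs G \<longleftrightarrow> (u, v) \<in> parcs G"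
    using \<gamma> by (auto simp: Aut_def Bij_def)
  have sub: "nbrs G w \<subseteq> pverts G" for w by (auto simp: nbrs_iff intro: arc_verts2)
  have "\<gamma> ` nbrs G v = nbrs G (\<gamma> v)"
  proof
    show "\<gamma> ` nbrs G v \<subseteq> nbrs G (\<gamma> v)" using ar v sub[of v] by (auto simp: nbrs_iff)
    show "nbrs G (\<gamma> v) \<subseteq> \<gamma> ` nbrs G v"
    proof
      fix w assume w: "w \<in> nbrs G (\<gamma> v)"
      then obtain u where "u \<in> pverts G" "w = \<gamma> u"
        using sub b by (metis bij_betw_imp_surj_on image_iff subsetD)
      with w ar v show "w \<in> \<gamma> ` nbrs G v" by (auto simp: nbrs_iff)
    qed
  qed
  moreover have "inj_on \<gamma> (nbrs G v)" using b sub by (meson bij_betw_def inj_on_subset)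
  ultimately show "bij_betw \<gamma> (nbrs G v) (nbrs G (\<gamma> v))" by (simp add: bij_betw_def)
qed

lemma nb_rev_op_local_iso:
  assumes "sym_graph G" "local_iso G H \<phi>" "x \<in> Arc ` parcs G"
  shows "nb_rev_op G n (f \<circ> map_cell \<phi>) x = nb_rev_op H n f (map_cell \<phi> x)"
proof -
  obtain e where e: "x = Arc e" "e \<in> parcs G" using assms(3) by blast
  show ?thesis
    using nb_rev_local_iso[OF assms(1,2) e(2), of n "\<lambda>e. f (Arc e)"] local_iso_arc[OF assms(1,2) e(2)] e
    by (simp add: nb_rev_op_def comp_def)
qed

lemma nb_rev_op_geometric:
  assumes G: "sym_graph G"
  shows "geometric_operator G (Arc ` parcs G) (nb_rev_op G n)"
  unfolding geometric_operator_def
proof (intro conjI ballI allI)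
  show "Arc ` parcs G \<subseteq> cells G" by (auto simp: cells_def)
  show "map_cell \<gamma> ` Arc ` parcs G \<subseteq> Arc ` parcs G" if "\<gamma> \<in> Aut G" for \<gamma>
    using local_iso_arc[OF G Aut_local_iso[OF G that]] by auto
  show "\<exists>a. (\<forall>x\<in>Arc ` parcs G. finite {y \<in> Arc ` parcs G. a x y \<noteq> 0}) \<and>
       nb_rev_op G n = kernel_op (Arc ` parcs G) a"
    by (rule sym_graph.nb_rev_op_kernel[OF G])
  show "nb_rev_op G n (f \<circ> map_cell \<gamma>) x = nb_rev_op G n f (map_cell \<gamma> x)"
    if "\<gamma> \<in> Aut G" "x \<in> Arc ` parcs G" for \<gamma> f x
    by (rule nb_rev_op_local_iso[OF G Aut_local_iso[OF G that(1)] that(2)])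
qed

section \<open>Walks, the covering tree and its projection\<close>

lemma nb_walks_not_Nil: "[] \<notin> nb_walks X x\<^sub>0"
  by (auto elim: nb_walks.cases)

lemma nb_walks_tl:
  assumes "w \<in> nb_walks G x\<^sub>0" "tl w = []"
  shows "w = [x\<^sub>0]"
  using assms(1) by cases (use assms(2) in auto)

lemma nb_walks_single: "[u] \<in> nb_walks X x\<^sub>0 \<longleftrightarrow> u = x\<^sub>0 \<and> x\<^sub>0 \<in> pverts X"
  by (auto elim: nb_walks.cases intro: nb_walks.intros)

lemma nb_walks_Cons_Cons:
  "u # v # p \<in> nb_walks X x\<^sub>0 \<longleftrightarrow>
     v # p \<in> nb_walks X x\<^sub>0 \<and> (v, u) \<in> parcs X \<and> (p = [] \<or> u \<noteq> hd p)"
  by (subst nb_walks.simps) auto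

lemma nb_walks_Cons:
  assumes "w \<noteq> []"
  shows "u # w \<in> nb_walks X x\<^sub>0 \<longleftrightarrow>
     w \<in> nb_walks X x\<^sub>0 \<and> (hd w, u) \<in> parcs X \<and> (tl w = [] \<or> u \<noteq> hd (tl w))"
  using assms by (cases w) (auto simp: nb_walks_Cons_Cons)

lemma (in sym_graph) nb_walks_hd: "w \<in> nb_walks G x\<^sub>0 \<Longrightarrow> hd w \<in> pverts G"
  by (induction rule: nb_walks.induct) (auto intro: arc_verts2)

lemma pverts_covering_tree [simp]: "pverts (covering_tree X x\<^sub>0) = nb_walks X x\<^sub>0"
  by (simp add: covering_tree_def)

lemma parcs_covering_tree:
  "(p, q) \<in> parcs (covering_tree X x\<^sub>0) \<longleftrightarrow>
     p \<in> nb_walks X x\<^sub>0 \<and> q \<in> nb_walks X x\<^sub>0 \<and> ((\<exists>u. q = u # p) \<or> (\<exists>u. p = u # q))"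
  by (simp add: covering_tree_def)

text \<open>The one-step extensions together with the parent \<open>tl w\<close>; the second set is
  empty exactly at the root, where \<open>tl w\<close> is the empty list.\<close>

lemma nbrs_covering_tree:
  assumes "w \<in> nb_walks X x\<^sub>0"
  shows "nbrs (covering_tree X x\<^sub>0) w =
     (\<lambda>u. u # w) ` {u \<in> nbrs X (hd w). tl w = [] \<or> u \<noteq> hd (tl w)} \<union> {q. q = tl w \<and> q \<noteq> []}"
proof -
  obtain v p where vp: "w = v # p"
    using assms nb_walks_not_Nil[of X x\<^sub>0] by (cases w) auto
  have p: "p \<in> nb_walks X x\<^sub>0" if "p \<noteq> []"
    using assms that nb_walks_Cons[of p v] by (simp add: vp)
  have "q \<in> nbrs (covering_tree X x\<^sub>0) w \<longleftrightarrow> q \<in>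
     (\<lambda>u. u # w) ` {u \<in> nbrs X (hd w). tl w = [] \<or> u \<noteq> hd (tl w)} \<union> {q. q = tl w \<and> q \<noteq> []}" for q
    using assms p nb_walks_not_Nil[of X x\<^sub>0]
    by (auto simp: vp nbrs_iff parcs_covering_tree nb_walks_Cons)
  then show ?thesis by blast
qed

lemma (in sym_graph) covering_tree_sym_graph: "sym_graph (covering_tree G x\<^sub>0)"
proof
  fix w
  show "finite {q. (w, q) \<in> parcs (covering_tree G x\<^sub>0)}"
  proof (cases "w \<in> nb_walks G x\<^sub>0")
    case True
    have "finite {u \<in> nbrs G (hd w). tl w = [] \<or> u \<noteq> hd (tl w)}"
      using finite_nbrs[of "hd w"] by (simp add: nbrs_def)
    then show ?thesis using nbrs_covering_tree[OF True] by (simp add: nbrs_def)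
  qed (simp add: parcs_covering_tree)
qed (auto simp: parcs_covering_tree)

text \<open>Non-backtracking forbids one extension, the one by \<open>hd (tl w)\<close>, and the
  parent projects to precisely that vertex.\<close>

lemma (in sym_graph) cover_local_iso: "local_iso (covering_tree G x\<^sub>0) G hd"
  unfolding local_iso_def
proof
  fix w assume "w \<in> pverts (covering_tree G x\<^sub>0)"
  then have w: "w \<in> nb_walks G x\<^sub>0" by simp
  have "hd (tl w) \<in> nbrs G (hd w)" if "tl w \<noteq> []"
    using w that nb_walks_Cons[of "tl w" "hd w"] nb_walks_not_Nil[of G x\<^sub>0]
    by (cases w) (auto simp: nbrs_iff intro: arc_sym)
  then have "hd ` nbrs (covering_tree G x\<^sub>0) w = nbrs G (hd w)"
    unfolding nbrs_covering_tree[OF w] image_Un image_image by auto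
  moreover have "inj_on hd (nbrs (covering_tree G x\<^sub>0) w)"
    unfolding nbrs_covering_tree[OF w] by (auto simp: inj_on_def)
  ultimately show "bij_betw hd (nbrs (covering_tree G x\<^sub>0) w) (nbrs G (hd w))"
    by (simp add: bij_betw_def)
qed

text \<open>Moves bounds between arcs and their cells along \<open>Arc\<close>, and along the
  reversal of arcs.\<close>

lemma l2_bound_image:
  assumes "inj_on h A"
  shows "l2_bound (h ` A) f M \<longleftrightarrow> l2_bound A (f \<circ> h) M"
proof -
  have *: "L2_set (\<lambda>x. cmod (f x)) (h ` F) = L2_set (\<lambda>x. cmod ((f \<circ> h) x)) F" if "F \<subseteq> A" for F
    using inj_on_subset[OF assms that] by (simp add: L2_set_def sum.reindex)
  show ?thesis
  proof
    assume l: "l2_bound (h ` A) f M"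
    show "l2_bound A (f \<circ> h) M"
      unfolding l2_bound_def
    proof (intro allI impI)
      fix F assume "finite F \<and> F \<subseteq> A"
      then show "L2_set (\<lambda>x. cmod ((f \<circ> h) x)) F \<le> M"
        using l *[of F] unfolding l2_bound_def by (metis finite_imageI image_mono)
    qed
  next
    assume r: "l2_bound A (f \<circ> h) M"
    show "l2_bound (h ` A) f M"
      unfolding l2_bound_def
    proof (intro allI impI)
      fix F' assume "finite F' \<and> F' \<subseteq> h ` A"
      then obtain F where "F \<subseteq> A" "finite F" "F' = h ` F"
        using finite_subset_image[of F' h A] by blast
      then show "L2_set (\<lambda>x. cmod (f x)) F' \<le> M"
        using r *[of F] unfolding l2_bound_def by simp
    qed
  qed
qed

lemma (in sym_graph) card_nb_successors:
  assumes "e \<in> parcs G"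
  shows "card (nb_successors G e) = card (nbrs G (snd e)) - 1"
proof -
  have "fst e \<in> nbrs G (snd e)" using assms by (cases e) (auto simp: nbrs_iff intro: arc_sym)
  then show ?thesis unfolding nb_successors_eq by (subst card_image) (auto simp: inj_on_def)
qed

lemma cmod_sum_square_le:
  "(cmod (\<Sum>y\<in>S. f y))\<^sup>2 \<le> real (card S) * (\<Sum>y\<in>S. (cmod (f y))\<^sup>2)"
proof -
  have "(cmod (\<Sum>y\<in>S. f y))\<^sup>2 \<le> (\<Sum>y\<in>S. cmod (f y))\<^sup>2"
    by (intro power_mono norm_sum) auto
  also have "\<dots> \<le> (\<Sum>y\<in>S. 1\<^sup>2) * (\<Sum>y\<in>S. (cmod (f y))\<^sup>2)"
    using Cauchy_Schwarz_ineq_sum[of "\<lambda>_. 1" "\<lambda>y. cmod (f y)" S] by simp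
  finally show ?thesis by simp
qed

section \<open>The operator norm on the covering tree\<close>

text \<open>Of the two degrees, what matters is the product of the branching numbers across an arc.
  For a bigraph \<open>Q\<close> is \<open>K * k\<close> and \<open>D\<close> is \<open>K\<close>;
  the estimate on the tree then treats both sides alike.\<close>

locale nb_regular = sym_graph G for G :: "'a pair_pre_digraph" +
  fixes Q D :: nat
  assumes branch_mult: "(u, v) \<in> parcs G \<Longrightarrow> (card (nbrs G u) - 1) * (card (nbrs G v) - 1) = Q"
    and branch_pos: "v \<in> pverts G \<Longrightarrow> 1 \<le> card (nbrs G v) - 1"
    and branch_le: "v \<in> pverts G \<Longrightarrow> card (nbrs G v) - 1 \<le> D"
begin

abbreviation tree :: "'a \<Rightarrow> 'a list pair_pre_digraph" where
  "tree x\<^sub>0 \<equiv> covering_tree G x\<^sub>0"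

text \<open>Down means away from the root: walks are stored reversed, so \<open>tl\<close> is the
  parent map.\<close>

definition down_arcs :: "'a \<Rightarrow> ('a list \<times> 'a list) set" where
  "down_arcs x\<^sub>0 = {e \<in> parcs (tree x\<^sub>0). fst e = tl (snd e)}"

definition up_arcs :: "'a \<Rightarrow> ('a list \<times> 'a list) set" where
  "up_arcs x\<^sub>0 = {e \<in> parcs (tree x\<^sub>0). snd e = tl (fst e)}"

definition branch :: "'a list \<times> 'a list \<Rightarrow> real" where
  "branch e = real (card (nbrs G (hd (snd e))) - 1)"

text \<open>Rescaling by the fourth root of the number of successors makes the alternating branching
  numbers uniform: one step then costs a factor equal to the fourth root of \<open>Q\<close> on both kinds of arcs.\<close>

definition scaled :: "('a list \<times> 'a list \<Rightarrow> complex) \<Rightarrow> 'a list \<times> 'a list \<Rightarrow> complex" where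
  "scaled f e = f e / of_real (sqrt (sqrt (branch e)))"

lemma tree_arcs_eq: "parcs (tree x\<^sub>0) = down_arcs x\<^sub>0 \<union> up_arcs x\<^sub>0"
  by (auto simp: down_arcs_def up_arcs_def parcs_covering_tree)

lemma tree_arc_verts: "e \<in> parcs (tree x\<^sub>0) \<Longrightarrow> fst e \<in> nb_walks G x\<^sub>0 \<and> snd e \<in> nb_walks G x\<^sub>0"
  by (cases e) (auto simp: parcs_covering_tree)

lemma branch_ge_1: "e \<in> parcs (tree x\<^sub>0) \<Longrightarrow> 1 \<le> branch e"
  unfolding branch_def using branch_pos[OF nb_walks_hd[OF conjunct2[OF tree_arc_verts]], of e x\<^sub>0]
  by (simp del: of_nat_diff)

lemma branch_le_D: "e \<in> parcs (tree x\<^sub>0) \<Longrightarrow> branch e \<le> real D"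
  unfolding branch_def using branch_le[OF nb_walks_hd[OF conjunct2[OF tree_arc_verts]], of e x\<^sub>0]
  by (simp del: of_nat_diff)

lemma card_tree_successors:
  assumes "e \<in> parcs (tree x\<^sub>0)"
  shows "real (card (nb_successors (tree x\<^sub>0) e)) = branch e"
proof -
  have "bij_betw hd (nbrs (tree x\<^sub>0) (snd e)) (nbrs G (hd (snd e)))"
    using cover_local_iso[of x\<^sub>0] tree_arc_verts[OF assms] by (simp add: local_iso_def)
  then show ?thesis
    using sym_graph.card_nb_successors[OF covering_tree_sym_graph assms]
    by (simp add: branch_def bij_betw_same_card)
qed

lemma branch_successor:
  assumes "e \<in> parcs (tree x\<^sub>0)" "e' \<in> nb_successors (tree x\<^sub>0) e"
  shows "branch e * branch e' = Q"
proof -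
  have "e' \<in> parcs (tree x\<^sub>0)" "fst e' = snd e"
    using assms(2) nb_successors_subset by (blast, auto simp: nb_successors_def)
  then have "(hd (snd e), hd (snd e')) \<in> parcs G"
    using local_iso_arc[OF covering_tree_sym_graph cover_local_iso, of e' x\<^sub>0] by (cases e') auto
  from branch_mult[OF this] show ?thesis unfolding branch_def by (simp flip: of_nat_mult)
qed

text \<open>Cauchy--Schwarz over at most \<open>branch e\<close> successors costs that factor. The
  rescaling at \<open>e\<close> leaves \<open>sqrt (branch e)\<close> of it, the rescaling at a
  successor \<open>y\<close> contributes \<open>sqrt (branch y)\<close>, and the two multiply to
  \<open>sqrt Q\<close>. Proper subsets \<open>S\<close> occur where the walk turns.\<close>

lemma scaled_sum_le:
  assumes e: "e \<in> parcs (tree x\<^sub>0)" and S: "S \<subseteq> nb_successors (tree x\<^sub>0) e"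
  shows "(cmod (scaled (\<lambda>_. \<Sum>y\<in>S. f y) e))\<^sup>2 \<le> (\<Sum>y\<in>S. sqrt Q * (cmod (scaled f y))\<^sup>2)"
proof -
  have b: "1 \<le> branch e" by (rule branch_ge_1[OF e])
  have fin: "finite (nb_successors (tree x\<^sub>0) e)"
    by (rule sym_graph.finite_nb_successors[OF covering_tree_sym_graph])
  have "(cmod (scaled (\<lambda>_. \<Sum>y\<in>S. f y) e))\<^sup>2 = (cmod (\<Sum>y\<in>S. f y))\<^sup>2 / sqrt (branch e)"
    using b by (simp add: scaled_def norm_divide power_divide)
  also have "\<dots> \<le> (real (card S) * (\<Sum>y\<in>S. (cmod (f y))\<^sup>2)) / sqrt (branch e)"
    using b by (intro divide_right_mono cmod_sum_square_le) simp
  also have "\<dots> \<le> (branch e * (\<Sum>y\<in>S. (cmod (f y))\<^sup>2)) / sqrt (branch e)"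
    using b card_mono[OF fin S] unfolding card_tree_successors[OF e, symmetric]
    by (intro divide_right_mono mult_right_mono sum_nonneg) auto
  also have "\<dots> = sqrt (branch e) * (\<Sum>y\<in>S. (cmod (f y))\<^sup>2)"
    using b by (simp add: field_simps flip: power2_eq_square)
  also have "\<dots> = (\<Sum>y\<in>S. sqrt Q * (cmod (scaled f y))\<^sup>2)"
    unfolding sum_distrib_left
  proof (rule sum.cong[OF refl])
    fix y assume "y \<in> S"
    then have y: "y \<in> nb_successors (tree x\<^sub>0) e" using S by blast
    then have "1 \<le> branch y" using nb_successors_subset branch_ge_1 by blast
    then show "sqrt (branch e) * (cmod (f y))\<^sup>2 = sqrt Q * (cmod (scaled f y))\<^sup>2"
      unfolding branch_successor[OF e y, symmetric]
      by (simp add: scaled_def norm_divide power_divide real_sqrt_mult)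
  qed
  finally show ?thesis .
qed

text \<open>After a step down the only way back up would be the reversed arc.\<close>

lemma down_successors:
  assumes "e \<in> down_arcs x\<^sub>0"
  shows "nb_successors (tree x\<^sub>0) e \<subseteq> down_arcs x\<^sub>0"
proof
  fix y assume y: "y \<in> nb_successors (tree x\<^sub>0) e"
  then have "y \<in> parcs (tree x\<^sub>0)" using nb_successors_subset by blast
  then show "y \<in> down_arcs x\<^sub>0"
    using assms y by (auto simp: down_arcs_def nb_successors_def parcs_covering_tree)
qed

lemma Q_pow4: "(sqrt (sqrt (real Q)))\<^sup>2 = sqrt Q"
  by simp

lemma down_step:
  assumes "l2_bound (down_arcs x\<^sub>0) (scaled f) \<delta>"
  shows "l2_bound (down_arcs x\<^sub>0) (scaled (nb_sum (tree x\<^sub>0) f)) (sqrt (sqrt Q) * \<delta>)"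
proof (rule l2_bound_transfer[OF assms, where S = "nb_successors (tree x\<^sub>0)" and h = "\<lambda>_ _. sqrt Q"])
  fix e assume e: "e \<in> down_arcs x\<^sub>0"
  show "finite (nb_successors (tree x\<^sub>0) e) \<and> nb_successors (tree x\<^sub>0) e \<subseteq> down_arcs x\<^sub>0"
    using down_successors[OF e] sym_graph.finite_nb_successors[OF covering_tree_sym_graph] by blast
  show "(cmod (scaled (nb_sum (tree x\<^sub>0) f) e))\<^sup>2
      \<le> (\<Sum>y\<in>nb_successors (tree x\<^sub>0) e. sqrt Q * (cmod (scaled f y))\<^sup>2)"
    using scaled_sum_le[of e x\<^sub>0 "nb_successors (tree x\<^sub>0) e" f] e
    by (simp add: scaled_def nb_sum_def down_arcs_def)
next
  fix F y assume F: "finite F" "F \<subseteq> down_arcs x\<^sub>0" and y: "y \<in> down_arcs x\<^sub>0"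
  \<comment> \<open>Among down arcs, \<open>y\<close> has at most one predecessor, the arc from the
    parent of its tail, so the column sum is at most a single weight.\<close>
  have "{x \<in> F. y \<in> nb_successors (tree x\<^sub>0) x} \<subseteq> {(tl (fst y), fst y)}"
    using F(2) by (auto simp: down_arcs_def nb_successors_eq)
  then have "card {x \<in> F. y \<in> nb_successors (tree x\<^sub>0) x} \<le> 1"
    using card_mono[of "{(tl (fst y), fst y)}"] by simp
  then have "real (card {x \<in> F. y \<in> nb_successors (tree x\<^sub>0) x}) * sqrt Q \<le> 1 * sqrt Q"
    by (intro mult_right_mono) auto
  then show "(\<Sum>x\<in>{x \<in> F. y \<in> nb_successors (tree x\<^sub>0) x}. sqrt Q) \<le> (sqrt (sqrt Q))\<^sup>2"
    unfolding Q_pow4 by simp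
qed auto

text \<open>The situation dual to descending: a row has one entry, while a column has as many as the
  tail of \<open>y\<close> has children. The weight \<open>sqrt Q / branch e\<close> spreads the
  budget \<open>sqrt Q\<close> evenly over these. The root has no parent, hence the default
  0.\<close>

lemma up_step_parent:
  assumes "l2_bound (up_arcs x\<^sub>0) (scaled f) \<upsilon>"
  shows "l2_bound (up_arcs x\<^sub>0)
    (scaled (\<lambda>e. if tl (snd e) = [] then 0 else f (snd e, tl (snd e)))) (sqrt (sqrt Q) * \<upsilon>)"
proof (rule l2_bound_transfer[OF assms,
      where S = "\<lambda>e. if tl (snd e) = [] then {} else {(snd e, tl (snd e))}"
      and h = "\<lambda>e _. sqrt Q / branch e"])
  have par: "(snd e, tl (snd e)) \<in> nb_successors (tree x\<^sub>0) e \<and> (snd e, tl (snd e)) \<in> up_arcs x\<^sub>0"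
    if e: "e \<in> up_arcs x\<^sub>0" and t: "tl (snd e) \<noteq> []" for e
  proof -
    have ee: "e \<in> parcs (tree x\<^sub>0)" and q: "snd e = tl (fst e)" using e by (auto simp: up_arcs_def)
    have "tl (snd e) \<in> nbrs (tree x\<^sub>0) (snd e)"
      using nbrs_covering_tree[of "snd e" G x\<^sub>0] tree_arc_verts[OF ee] t by auto
    moreover have "tl (snd e) \<noteq> fst e"
    proof
      assume "tl (snd e) = fst e"
      then have "length (tl (tl (fst e))) = length (fst e)" using q by simp
      then show False using t q by (cases "fst e") auto
    qed
    ultimately show ?thesis by (auto simp: up_arcs_def nb_successors_def nbrs_iff)
  qed
  fix e assume e: "e \<in> up_arcs x\<^sub>0"
  then have ee: "e \<in> parcs (tree x\<^sub>0)" by (simp add: up_arcs_def)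
  show "finite (if tl (snd e) = [] then {} else {(snd e, tl (snd e))}) \<and>
      (if tl (snd e) = [] then {} else {(snd e, tl (snd e))}) \<subseteq> up_arcs x\<^sub>0"
    using par[OF e] by simp
  show "0 \<le> sqrt Q / branch e" using branch_ge_1[OF ee] by simp
  show "(cmod (scaled (\<lambda>e. if tl (snd e) = [] then 0 else f (snd e, tl (snd e))) e))\<^sup>2
      \<le> (\<Sum>y\<in>(if tl (snd e) = [] then {} else {(snd e, tl (snd e))}).
            sqrt Q / branch e * (cmod (scaled f y))\<^sup>2)"
  proof (cases "tl (snd e) = []")
    case False
    let ?y = "(snd e, tl (snd e))"
    have b: "1 \<le> branch e" "1 \<le> branch ?y"
      using branch_ge_1[OF ee] branch_ge_1[of ?y x\<^sub>0] par[OF e False] by (auto simp: up_arcs_def)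
    have "(cmod (f ?y / of_real (sqrt (sqrt (branch e)))))\<^sup>2 = (cmod (f ?y))\<^sup>2 / sqrt (branch e)"
      using b by (simp add: norm_divide power_divide)
    also have "\<dots> = sqrt (branch e) * sqrt (branch ?y) / branch e * ((cmod (f ?y))\<^sup>2 / sqrt (branch ?y))"
      using b by (simp add: field_simps flip: power2_eq_square)
    also have "\<dots> = sqrt Q / branch e * (cmod (scaled f ?y))\<^sup>2"
      using b unfolding branch_successor[OF ee conjunct1[OF par[OF e False]], symmetric]
      by (simp add: scaled_def norm_divide power_divide real_sqrt_mult)
    finally show ?thesis using False by (simp add: scaled_def)
  qed (simp add: scaled_def)
next
  fix F y assume F: "finite F" "F \<subseteq> up_arcs x\<^sub>0" and y: "y \<in> up_arcs x\<^sub>0"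
  let ?S = "{x \<in> F. y \<in> (if tl (snd x) = [] then {} else {(snd x, tl (snd x))})}"
  let ?b = "real (card (nbrs G (hd (fst y))) - 1)"
  have yy: "y \<in> parcs (tree x\<^sub>0)" and y2: "snd y = tl (fst y)" using y by (auto simp: up_arcs_def)
  have w: "fst y \<in> nb_walks G x\<^sub>0" "snd y \<in> nb_walks G x\<^sub>0" using tree_arc_verts[OF yy] by auto
  have b: "1 \<le> ?b" using branch_pos[OF nb_walks_hd[OF w(1)]] by simp
  have nonempty: "snd y \<noteq> []" using w(2) nb_walks_not_Nil by metis
  have "hd (snd y) \<in> nbrs G (hd (fst y))"
    using local_iso_arc[OF covering_tree_sym_graph cover_local_iso yy]
    by (cases y) (auto simp: nbrs_iff)
  then have cb: "real (card (nbrs G (hd (fst y)) - {hd (snd y)})) = ?b" by simp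
  have "?S \<subseteq> (\<lambda>u. (u # fst y, fst y)) ` (nbrs G (hd (fst y)) - {hd (snd y)})"
  proof
    fix x assume x: "x \<in> ?S"
    then have "x \<in> up_arcs x\<^sub>0" and fy: "fst y = snd x" using F(2) by (auto split: if_splits)
    then have xx: "x \<in> parcs (tree x\<^sub>0)" "snd x = tl (fst x)" by (auto simp: up_arcs_def)
    have "snd x \<noteq> []" using tree_arc_verts[OF xx(1)] nb_walks_not_Nil by metis
    then obtain u where u: "fst x = u # snd x" using xx(2) by (cases "fst x") auto
    have "u # fst y \<in> nb_walks G x\<^sub>0" using tree_arc_verts[OF xx(1)] u fy by simp
    then have "u \<in> nbrs G (hd (fst y)) - {hd (snd y)}"
      using nb_walks_Cons[of "fst y" u G x\<^sub>0] nonempty y2 by (cases "fst y") (auto simp: nbrs_iff)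
    moreover have "x = (u # fst y, fst y)" using u fy by (cases x) simp
    ultimately show "x \<in> (\<lambda>u. (u # fst y, fst y)) ` (nbrs G (hd (fst y)) - {hd (snd y)})" by blast
  qed
  then have "card ?S \<le> card (nbrs G (hd (fst y)) - {hd (snd y)})"
    by (rule surj_card_le[rotated]) (use finite_nbrs[of "hd (fst y)"] in \<open>simp add: nbrs_def\<close>)
  then have "real (card ?S) \<le> ?b" using cb by linarith
  then have "real (card ?S) * (sqrt Q / ?b) \<le> ?b * (sqrt Q / ?b)" by (intro mult_right_mono) auto
  moreover have "(\<Sum>x\<in>?S. sqrt Q / branch x) = (\<Sum>x\<in>?S. sqrt Q / ?b)"
    by (intro sum.cong refl) (auto simp: branch_def split: if_splits)
  ultimately show "(\<Sum>x\<in>?S. sqrt Q / branch x) \<le> (sqrt (sqrt Q))\<^sup>2"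
    using b unfolding Q_pow4 by simp
qed auto

text \<open>The turn from up to down happens at most once along a walk, so the crude factor
  \<open>D + 1\<close> is paid once and is not raised to the n-th power.\<close>

lemma up_step_turn:
  assumes "l2_bound (down_arcs x\<^sub>0) (scaled f) \<delta>"
  shows "l2_bound (up_arcs x\<^sub>0)
    (scaled (\<lambda>e. \<Sum>y\<in>nb_successors (tree x\<^sub>0) e \<inter> down_arcs x\<^sub>0. f y)) (sqrt (sqrt Q) * real (D + 1) * \<delta>)"
proof (rule l2_bound_transfer[OF assms, where S = "\<lambda>e. nb_successors (tree x\<^sub>0) e \<inter> down_arcs x\<^sub>0"
      and h = "\<lambda>_ _. sqrt Q"])
  fix e assume e: "e \<in> up_arcs x\<^sub>0"
  show "finite (nb_successors (tree x\<^sub>0) e \<inter> down_arcs x\<^sub>0) \<and>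
      nb_successors (tree x\<^sub>0) e \<inter> down_arcs x\<^sub>0 \<subseteq> down_arcs x\<^sub>0"
    by (simp add: sym_graph.finite_nb_successors[OF covering_tree_sym_graph])
  show "(cmod (scaled (\<lambda>e. \<Sum>y\<in>nb_successors (tree x\<^sub>0) e \<inter> down_arcs x\<^sub>0. f y) e))\<^sup>2
      \<le> (\<Sum>y\<in>nb_successors (tree x\<^sub>0) e \<inter> down_arcs x\<^sub>0. sqrt Q * (cmod (scaled f y))\<^sup>2)"
    using scaled_sum_le[of e x\<^sub>0 "nb_successors (tree x\<^sub>0) e \<inter> down_arcs x\<^sub>0" f] e
    by (simp add: scaled_def up_arcs_def)
next
  fix F y assume F: "finite F" "F \<subseteq> up_arcs x\<^sub>0" and y: "y \<in> down_arcs x\<^sub>0"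
  let ?S = "{x \<in> F. y \<in> nb_successors (tree x\<^sub>0) x \<inter> down_arcs x\<^sub>0}"
  have yy: "y \<in> parcs (tree x\<^sub>0)" using y by (auto simp: down_arcs_def)
  have w: "fst y \<in> nb_walks G x\<^sub>0" using tree_arc_verts[OF yy] by auto
  have "?S \<subseteq> (\<lambda>u. (u # fst y, fst y)) ` nbrs G (hd (fst y))"
  proof
    fix x assume x: "x \<in> ?S"
    then have "x \<in> up_arcs x\<^sub>0" and fy: "fst y = snd x" using F(2) by (auto simp: nb_successors_def)
    then have xx: "x \<in> parcs (tree x\<^sub>0)" "snd x = tl (fst x)" by (auto simp: up_arcs_def)
    have ne: "snd x \<noteq> []" using tree_arc_verts[OF xx(1)] nb_walks_not_Nil by metis
    then obtain u where u: "fst x = u # snd x" using xx(2) by (cases "fst x") auto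
    have "u # fst y \<in> nb_walks G x\<^sub>0" using tree_arc_verts[OF xx(1)] u fy by simp
    then have "u \<in> nbrs G (hd (fst y))"
      using nb_walks_Cons[of "fst y" u G x\<^sub>0] ne fy by (auto simp: nbrs_iff)
    moreover have "x = (u # fst y, fst y)" using u fy by (cases x) simp
    ultimately show "x \<in> (\<lambda>u. (u # fst y, fst y)) ` nbrs G (hd (fst y))" by blast
  qed
  then have "card ?S \<le> card (nbrs G (hd (fst y)))"
    by (rule surj_card_le[rotated]) (use finite_nbrs[of "hd (fst y)"] in \<open>simp add: nbrs_def\<close>)
  also have "\<dots> \<le> D + 1" using branch_le[OF nb_walks_hd[OF w]] by simp
  finally have c: "real (card ?S) \<le> real (D + 1)" by linarith
  \<comment> \<open>A deliberate loss: squaring brings the count into the form of the constant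
    \<open>\<beta>\<^sup>2\<close> of \<open>l2_bound_transfer\<close>.\<close>
  also have "\<dots> \<le> (real (D + 1))\<^sup>2" by (rule self_le_power) auto
  finally have "real (card ?S) * sqrt Q \<le> (real (D + 1))\<^sup>2 * sqrt Q" by (intro mult_right_mono) auto
  then show "(\<Sum>x\<in>?S. sqrt Q) \<le> (sqrt (sqrt Q) * real (D + 1))\<^sup>2"
    unfolding power_mult_distrib Q_pow4 by (simp only: sum_constant mult.commute)
qed auto

lemma up_step:
  assumes "l2_bound (down_arcs x\<^sub>0) (scaled f) \<delta>" "l2_bound (up_arcs x\<^sub>0) (scaled f) \<upsilon>"
  shows "l2_bound (up_arcs x\<^sub>0) (scaled (nb_sum (tree x\<^sub>0) f)) (sqrt (sqrt Q) * \<upsilon> + sqrt (sqrt Q) * real (D + 1) * \<delta>)"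
proof (rule l2_bound_add[OF up_step_parent[OF assms(2)] up_step_turn[OF assms(1)]])
  fix e assume "e \<in> up_arcs x\<^sub>0"
  let ?S = "nb_successors (tree x\<^sub>0) e"
  let ?g = "\<lambda>e. if tl (snd e) = [] then 0 else f (snd e, tl (snd e))"
  have e: "e \<in> parcs (tree x\<^sub>0)" and q: "snd e = tl (fst e)"
    using \<open>e \<in> up_arcs x\<^sub>0\<close> by (auto simp: up_arcs_def)
  \<comment> \<open>Apart from the turns there is only the arc to the parent, present unless
    \<open>e\<close> ends at the root.\<close>
  have "?S - down_arcs x\<^sub>0 = (if tl (snd e) = [] then {} else {(snd e, tl (snd e))})"
  proof -
    have neq: "tl (tl (fst e)) \<noteq> fst e" if "tl (tl (fst e)) \<noteq> []"
    proof
      assume "tl (tl (fst e)) = fst e"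
      then have "length (tl (tl (fst e))) = length (fst e)" by simp
      then show False using that by (cases "fst e") auto
    qed
    have S: "?S = Pair (snd e) ` (((\<lambda>u. u # snd e) `
        {u \<in> nbrs G (hd (snd e)). tl (snd e) = [] \<or> u \<noteq> hd (tl (snd e))} \<union> {p. p = tl (snd e) \<and> p \<noteq> []}) - {fst e})"
      unfolding nb_successors_eq using nbrs_covering_tree[of "snd e" G x\<^sub>0] tree_arc_verts[OF e] by simp
    have S': "?S \<subseteq> parcs (tree x\<^sub>0)" by (rule nb_successors_subset)
    have no: "snd e \<noteq> tl (tl (snd e))"
    proof
      assume "snd e = tl (tl (snd e))"
      then have "length (tl (tl (snd e))) = length (snd e)" by simp
      moreover have "snd e \<noteq> []" using tree_arc_verts[OF e] nb_walks_not_Nil by metis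
      ultimately show False by (cases "snd e") auto
    qed
    have S1: "y = (snd e, tl (snd e)) \<and> tl (snd e) \<noteq> []" if y: "y \<in> ?S" "y \<notin> down_arcs x\<^sub>0" for y
    proof -
      from y(1) obtain r where r: "y = (snd e, r)" "(\<exists>u. r = u # snd e) \<or> r = tl (snd e) \<and> r \<noteq> []"
        unfolding S by blast
      have "y \<in> parcs (tree x\<^sub>0)" using y(1) S' by (rule_tac subsetD)
      then have "\<nexists>u. r = u # snd e" using y(2) r(1) by (auto simp: down_arcs_def)
      with r show ?thesis by blast
    qed
    have S2: "(snd e, tl (snd e)) \<in> ?S" if t: "tl (snd e) \<noteq> []"
    proof -
      have "tl (snd e) \<noteq> fst e" using neq t unfolding q by blast
      with t show ?thesis unfolding S by blast
    qed
    have S3: "(snd e, tl (snd e)) \<notin> down_arcs x\<^sub>0" using no by (simp add: down_arcs_def)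
    show ?thesis
    proof (cases "tl (snd e) = []")
      case True
      then have "y \<notin> ?S - down_arcs x\<^sub>0" for y using S1[of y] by auto
      then show ?thesis using True by auto
    next
      case False
      then have "y \<in> ?S - down_arcs x\<^sub>0 \<longleftrightarrow> y = (snd e, tl (snd e))" for y
        using S1[of y] S2 S3 by auto
      then show ?thesis using False by auto
    qed
  qed
  then have "(\<Sum>y\<in>?S - down_arcs x\<^sub>0. f y) = ?g e" by simp
  moreover have "nb_sum (tree x\<^sub>0) f e = (\<Sum>y\<in>?S \<inter> down_arcs x\<^sub>0. f y) + (\<Sum>y\<in>?S - down_arcs x\<^sub>0. f y)"
    unfolding nb_sum_def
    by (rule sum.Int_Diff) (rule sym_graph.finite_nb_successors[OF covering_tree_sym_graph])
  ultimately have "scaled (nb_sum (tree x\<^sub>0) f) e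
      = scaled ?g e + scaled (\<lambda>e. \<Sum>y\<in>nb_successors (tree x\<^sub>0) e \<inter> down_arcs x\<^sub>0. f y) e"
    by (simp add: scaled_def add_divide_distrib)
  then show "cmod (scaled (nb_sum (tree x\<^sub>0) f) e) \<le> cmod (scaled ?g e) +
      cmod (scaled (\<lambda>e. \<Sum>y\<in>nb_successors (tree x\<^sub>0) e \<inter> down_arcs x\<^sub>0. f y) e)"
    by (simp only: norm_triangle_ineq)
qed

text \<open>With q the fourth root of \<open>Q\<close> and c = \<open>D + 1\<close>, the bounds d on
  down arcs and a on up arcs obey d' = q d and a' = q a + q c d. The solution is q^n M and q^n (1 +
  n c) M; the linear factor counts the possible turning times.\<close>

lemma nb_pow_bounds:
  assumes "l2_bound (down_arcs x\<^sub>0) (scaled f) M" "l2_bound (up_arcs x\<^sub>0) (scaled f) M"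
  shows "l2_bound (down_arcs x\<^sub>0) (scaled ((nb_sum (tree x\<^sub>0) ^^ n) f)) (sqrt (sqrt Q) ^ n * M)
    \<and> l2_bound (up_arcs x\<^sub>0) (scaled ((nb_sum (tree x\<^sub>0) ^^ n) f)) (sqrt (sqrt Q) ^ n * (1 + real n * real (D + 1)) * M)"
proof (induction n)
  case (Suc n)
  have "l2_bound (down_arcs x\<^sub>0) (scaled ((nb_sum (tree x\<^sub>0) ^^ Suc n) f)) (sqrt (sqrt Q) ^ Suc n * M)"
    using down_step[OF conjunct1[OF Suc]] by (simp add: mult.assoc)
  moreover have "l2_bound (up_arcs x\<^sub>0) (scaled ((nb_sum (tree x\<^sub>0) ^^ Suc n) f))
     (sqrt (sqrt Q) ^ Suc n * (1 + real (Suc n) * real (D + 1)) * M)"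
    using up_step[OF conjunct1[OF Suc] conjunct2[OF Suc]] by (simp add: algebra_simps)
  ultimately show ?case ..
qed (use assms in simp)

text \<open>The leading \<open>D\<close> pays for undoing the rescaling, the fourth root of
  \<open>branch\<close> being at most \<open>D\<close>; the 2 is 1 + 1, from adding the bounds on
  down and up arcs.\<close>

definition tree_bound :: "nat \<Rightarrow> real" where
  "tree_bound n = real D * (sqrt (sqrt Q) ^ n * (2 + real n * real (D + 1)))"

text \<open>Reversal of arcs is an isometry and rescaling is a contraction, as \<open>branch\<close>
  is at least 1, so the input bound enters the recursion unchanged.\<close>

lemma nb_rev_op_tree_bound:
  assumes f: "l2_bound (Arc ` parcs (tree x\<^sub>0)) f M"
  shows "l2_bound (Arc ` parcs (tree x\<^sub>0)) (nb_rev_op (tree x\<^sub>0) n f) (tree_bound n * M)"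
proof -
  interpret T: sym_graph "tree x\<^sub>0" by (rule covering_tree_sym_graph)
  let ?E = "parcs (tree x\<^sub>0)"
  let ?g = "(\<lambda>e. f (Arc e)) \<circ> prod.swap"
  have inj: "inj_on Arc ?E" by (simp add: inj_on_def)
  have "l2_bound ?E (\<lambda>e. f (Arc e)) M" using f l2_bound_image[OF inj] by (simp add: comp_def)
  moreover have "prod.swap ` ?E = ?E" using T.arc_sym by force
  ultimately have g: "l2_bound ?E ?g M"
    using l2_bound_image[OF inj_on_subset[OF inj_swap subset_UNIV], of ?E "\<lambda>e. f (Arc e)" M] by simp
  have sc: "cmod (scaled ?g e) \<le> cmod (?g e)" if "e \<in> ?E" for e
  proof -
    have "1 \<le> sqrt (sqrt (branch e))" using branch_ge_1[OF that] by simp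
    then have "cmod (?g e) / sqrt (sqrt (branch e)) \<le> cmod (?g e) / 1"
      by (intro divide_left_mono) auto
    then show ?thesis using branch_ge_1[OF that] by (simp add: scaled_def norm_divide)
  qed
  have sub: "down_arcs x\<^sub>0 \<subseteq> ?E" "up_arcs x\<^sub>0 \<subseteq> ?E" by (auto simp: down_arcs_def up_arcs_def)
  have "l2_bound (down_arcs x\<^sub>0) (scaled ?g) M" "l2_bound (up_arcs x\<^sub>0) (scaled ?g) M"
    by (rule l2_bound_mono[OF g]; use sub sc in auto)+
  from nb_pow_bounds[OF this, of n]
  have "l2_bound ?E (scaled (nb_rev (tree x\<^sub>0) n (\<lambda>e. f (Arc e))))
     (sqrt (sqrt Q) ^ n * M + sqrt (sqrt Q) ^ n * (1 + real n * real (D + 1)) * M)"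
    unfolding nb_rev_def tree_arcs_eq by (intro l2_bound_Un) auto
  from l2_bound_scale[OF this, of "of_nat D"]
  have b: "l2_bound ?E (\<lambda>e. of_nat D * scaled (nb_rev (tree x\<^sub>0) n (\<lambda>e. f (Arc e))) e) (tree_bound n * M)"
    by (simp add: tree_bound_def algebra_simps)
  have "l2_bound ?E (nb_rev_op (tree x\<^sub>0) n f \<circ> Arc) (tree_bound n * M)"
  proof (rule l2_bound_mono[OF b])
    fix e assume e: "e \<in> ?E"
    have "1 \<le> branch e" "branch e \<le> D" using branch_ge_1[OF e] branch_le_D[OF e] by auto
    then have "sqrt (sqrt (branch e)) \<le> sqrt (branch e)" "sqrt (branch e) \<le> branch e"
      by (simp_all add: real_le_lsqrt self_le_power)
    then have le: "sqrt (sqrt (branch e)) \<le> D" using \<open>branch e \<le> D\<close> by linarith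
    have "0 < sqrt (sqrt (branch e))" using \<open>1 \<le> branch e\<close> by simp
    then have "1 \<le> D / sqrt (sqrt (branch e))" using le by simp
    then have "1 * cmod z \<le> D / sqrt (sqrt (branch e)) * cmod z" for z
      by (intro mult_right_mono) auto
    then show "cmod ((nb_rev_op (tree x\<^sub>0) n f \<circ> Arc) e) \<le> cmod (of_nat D * scaled (nb_rev (tree x\<^sub>0) n (\<lambda>e. f (Arc e))) e)"
      using e \<open>1 \<le> branch e\<close> by (simp add: nb_rev_op_def scaled_def norm_divide norm_mult)
  qed auto
  then show ?thesis by (simp add: l2_bound_image[OF inj])
qed

lemma tree_bound_nonneg: "0 \<le> tree_bound n"
  by (simp add: tree_bound_def)

lemma not_in_tree_spectrum:
  assumes "tree_bound n < cmod \<mu>"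
  shows "\<mu> \<notin> l2_spectrum (Arc ` parcs (tree x\<^sub>0)) (nb_rev_op (tree x\<^sub>0) n)"
proof -
  obtain a where a: "\<forall>x\<in>Arc ` parcs (tree x\<^sub>0). finite {y \<in> Arc ` parcs (tree x\<^sub>0). a x y \<noteq> 0}"
    "nb_rev_op (tree x\<^sub>0) n = kernel_op (Arc ` parcs (tree x\<^sub>0)) a"
    using sym_graph.nb_rev_op_kernel[OF covering_tree_sym_graph, of x\<^sub>0 n] by blast
  show ?thesis
    by (rule not_in_l2_spectrumI[OF a(2) bspec[OF a(1)] nb_rev_op_tree_bound tree_bound_nonneg assms])
qed

end

section \<open>Automorphisms of the covering tree\<close>

text \<open>The word a b a^-1 b^-1 is the one in \<open>derived\<close>; products in
  \<open>BijGroup\<close> apply the right factor first.\<close>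

lemma BijGroup_commutator_apply:
  assumes "a \<in> Bij S" "b \<in> Bij S" "x \<in> S"
  shows "(a \<otimes>\<^bsub>BijGroup S\<^esub> b \<otimes>\<^bsub>BijGroup S\<^esub> inv\<^bsub>BijGroup S\<^esub> a \<otimes>\<^bsub>BijGroup S\<^esub> inv\<^bsub>BijGroup S\<^esub> b) x
    = a (b (inv_into S a (inv_into S b x)))"
  using assms restrict_inv_into_Bij[of a S] restrict_inv_into_Bij[of b S]
  by (simp add: inv_BijGroup) (simp add: BijGroup_def compose_Bij compose_eq Bij_inv_into_mem)

context nb_regular
begin

definition children :: "'a list \<Rightarrow> 'a set" where
  "children p = {u \<in> nbrs G (hd p). tl p = [] \<or> u \<noteq> hd (tl p)}"

text \<open>An arbitrary choice. It is a bijection as soon as the two walks have equally many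
  children, which \<open>extend_props\<close> ensures along the recursion.\<close>

definition match :: "'a list \<Rightarrow> 'a list \<Rightarrow> 'a \<Rightarrow> 'a" where
  "match p q = (SOME h. bij_betw h (children p) (children q))"

text \<open>Extends a permutation \<open>\<tau>\<close> of the children of the root to the whole tree, by matching the
  children of every other vertex with those of its image in an arbitrary way.\<close>

primrec extend :: "('a \<Rightarrow> 'a) \<Rightarrow> 'a list \<Rightarrow> 'a list" where
  "extend \<tau> [] = []"
| "extend \<tau> (u # p) =
     (if p = [] then u else if tl p = [] then \<tau> u else match p (extend \<tau> p) u) # extend \<tau> p"

lemma nb_walks_children:
  "p \<noteq> [] \<Longrightarrow> u # p \<in> nb_walks G x\<^sub>0 \<longleftrightarrow> p \<in> nb_walks G x\<^sub>0 \<and> u \<in> children p"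
  by (auto simp: nb_walks_Cons children_def nbrs_iff)

lemma card_children:
  assumes "p \<in> nb_walks G x\<^sub>0" "tl p \<noteq> []"
  shows "card (children p) = card (nbrs G (hd p)) - 1"
proof -
  obtain u v q where p: "p = u # v # q" using assms(2) by (metis list.exhaust list.sel(2,3))
  have "v \<in> nbrs G u" using assms(1) by (auto simp: p nb_walks_Cons_Cons nbrs_iff intro: arc_sym)
  moreover have "children p = nbrs G u - {v}" by (auto simp: children_def p)
  ultimately show ?thesis by (simp add: p)
qed

text \<open>The induction has to carry the degree of the endpoint: the branching numbers along an
  arc always multiply to \<open>Q\<close>, so equal degrees at two vertices force equal degrees at
  their neighbours, and the children can be matched again.\<close>

lemma extend_props:
  assumes \<tau>: "bij_betw \<tau> (nbrs G x\<^sub>0) (nbrs G x\<^sub>0)" and w: "w \<in> nb_walks G x\<^sub>0"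
  shows "extend \<tau> w \<in> nb_walks G x\<^sub>0 \<and> length (extend \<tau> w) = length w \<and>
     card (nbrs G (hd (extend \<tau> w))) = card (nbrs G (hd w)) \<and>
     bij_betw (if tl w = [] then \<tau> else match w (extend \<tau> w)) (children w) (children (extend \<tau> w))"
proof -
  have bij: "bij_betw (if tl w = [] then \<tau> else match w (extend \<tau> w)) (children w) (children (extend \<tau> w))"
    if w: "w \<in> nb_walks G x\<^sub>0" "extend \<tau> w \<in> nb_walks G x\<^sub>0" "length (extend \<tau> w) = length w"
      "card (nbrs G (hd (extend \<tau> w))) = card (nbrs G (hd w))" for w
  proof (cases "tl w = []")
    case True
    then have "w = [x\<^sub>0]" by (rule nb_walks_tl[OF w(1)])
    then show ?thesis using \<tau> by (simp add: children_def)
  next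
    case False
    then have "tl (extend \<tau> w) \<noteq> []" using w(3) by (metis length_tl length_0_conv)
    then have "card (children w) = card (children (extend \<tau> w))"
      using card_children[OF w(1) False] card_children[OF w(2)] w(4) by simp
    moreover have "finite (children p)" for p
      using finite_nbrs[of "hd p"] by (simp add: children_def nbrs_def)
    ultimately have "\<exists>h. bij_betw h (children w) (children (extend \<tau> w))"
      by (simp add: finite_same_card_bij)
    from someI_ex[OF this] show ?thesis using False unfolding match_def by simp
  qed
  have "extend \<tau> w \<in> nb_walks G x\<^sub>0 \<and> length (extend \<tau> w) = length w \<and>
     card (nbrs G (hd (extend \<tau> w))) = card (nbrs G (hd w))"
    using w
  proof (induction w rule: nb_walks.induct)
    case start
    then show ?case by (simp add: nb_walks.start)
  next
    case (extend v p u)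
    let ?w = "v # p" and ?e = "extend \<tau> (v # p)"
    let ?u = "hd (extend \<tau> (u # v # p))"
    have u: "u \<in> children ?w" using extend.hyps by (auto simp: children_def nbrs_iff)
    have IH: "?e \<in> nb_walks G x\<^sub>0" "length ?e = length ?w" "card (nbrs G (hd ?e)) = card (nbrs G (hd ?w))"
      using extend.IH by auto
    have ne: "?e \<noteq> []" by simp
    have b: "bij_betw (if tl ?w = [] then \<tau> else match ?w ?e) (children ?w) (children ?e)"
      by (rule bij[OF extend.hyps(1) IH])
    have eq: "extend \<tau> (u # ?w) = (if tl ?w = [] then \<tau> else match ?w ?e) u # ?e"
      by (simp only: extend.simps(2)[of \<tau> u ?w]) simp
    have u': "?u \<in> children ?e" using b u unfolding eq by (auto simp: bij_betw_def)
    have mem: "?u # ?e \<in> nb_walks G x\<^sub>0" 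
      using nb_walks_children[OF ne] u' IH(1) by blast
    have arc: "(v, u) \<in> parcs G" "(hd ?e, ?u) \<in> parcs G"
      using u u' by (auto simp only: children_def nbrs_iff mem_Collect_eq list.sel)
    have *: "(card (nbrs G v) - 1) * (card (nbrs G ?u) - 1) = (card (nbrs G v) - 1) * (card (nbrs G u) - 1)"
      using branch_mult[OF arc(1)] branch_mult[OF arc(2)] IH(3) by simp
    have "card (nbrs G ?u) - 1 = card (nbrs G u) - 1"
      using * branch_pos[OF arc_verts[OF arc(1)]] by auto
    then have "card (nbrs G ?u) = card (nbrs G u)"
      using branch_pos[OF arc_verts2[OF arc(1)]] branch_pos[OF arc_verts2[OF arc(2)]] by linarith
    moreover have "extend \<tau> (u # ?w) = ?u # ?e" unfolding eq by simp
    ultimately show ?case using mem IH(2) by (metis length_Cons list.sel(1))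
  qed
  then show ?thesis using bij[OF w] by blast
qed

lemma extend_Cons:
  "p \<noteq> [] \<Longrightarrow> extend \<tau> (u # p) = (if tl p = [] then \<tau> else match p (extend \<tau> p)) u # extend \<tau> p"
  by simp

lemma extend_inj:
  assumes \<tau>: "bij_betw \<tau> (nbrs G x\<^sub>0) (nbrs G x\<^sub>0)"
    and "w \<in> nb_walks G x\<^sub>0" "w' \<in> nb_walks G x\<^sub>0" "extend \<tau> w = extend \<tau> w'"
  shows "w = w'"
  using assms(2-4)
proof (induction w arbitrary: w' rule: list.induct)
  case Nil
  then show ?case using nb_walks_not_Nil by metis
next
  case (Cons u p)
  have len: "length w' = length (u # p)"
    using extend_props[OF \<tau> Cons.prems(1)] extend_props[OF \<tau> Cons.prems(2)] Cons.prems(3) by metis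
  then obtain u' p' where w': "w' = u' # p'" by (cases w') auto
  show ?case
  proof (cases "p = []")
    case True
    then show ?thesis using len Cons.prems(1,2) by (auto simp: w' nb_walks_single)
  next
    case False
    then have ne: "p' \<noteq> []" using len w' by auto
    have p: "p \<in> nb_walks G x\<^sub>0" "u \<in> children p" "p' \<in> nb_walks G x\<^sub>0" "u' \<in> children p'"
      using Cons.prems(1,2) nb_walks_children False ne by (auto simp: w')
    have eq: "extend \<tau> p = extend \<tau> p'"
      using Cons.prems(3) unfolding w' extend_Cons[OF False] extend_Cons[OF ne] by simp
    then have pp: "p = p'" using Cons.IH p by blast
    have "(if tl p = [] then \<tau> else match p (extend \<tau> p)) u = (if tl p = [] then \<tau> else match p (extend \<tau> p)) u'"
      using Cons.prems(3) unfolding w' extend_Cons[OF False] extend_Cons[OF ne] pp by simp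
    then have "u = u'"
      using extend_props[OF \<tau> p(1)] p(2,4) unfolding pp[symmetric] by (meson bij_betw_imp_inj_on inj_onD)
    then show ?thesis using pp w' by simp
  qed
qed

lemma extend_surj:
  assumes \<tau>: "bij_betw \<tau> (nbrs G x\<^sub>0) (nbrs G x\<^sub>0)" and "w \<in> nb_walks G x\<^sub>0"
  shows "w \<in> extend \<tau> ` nb_walks G x\<^sub>0"
  using assms(2)
proof (induction w rule: list.induct)
  case Nil
  then show ?case using nb_walks_not_Nil by metis
next
  case (Cons u p)
  show ?case
  proof (cases "p = []")
    case True
    then show ?thesis
      using Cons.prems by (intro image_eqI[of _ _ "u # p"]) (auto simp: nb_walks_single)
  next
    case False
    have p: "p \<in> nb_walks G x\<^sub>0" "u \<in> children p"
      using Cons.prems nb_walks_children False by auto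
    then obtain q where q: "q \<in> nb_walks G x\<^sub>0" "p = extend \<tau> q" using Cons.IH by blast
    have qn: "q \<noteq> []" using q(1) nb_walks_not_Nil by metis
    have "u \<in> (if tl q = [] then \<tau> else match q (extend \<tau> q)) ` children q"
      using extend_props[OF \<tau> q(1)] p(2) q(2) by (simp add: bij_betw_def)
    then obtain v where v: "v \<in> children q" "u = (if tl q = [] then \<tau> else match q (extend \<tau> q)) v" by blast
    have "u # p = extend \<tau> (v # q)" unfolding extend_Cons[OF qn] using v(2) q(2) by simp
    moreover have "v # q \<in> nb_walks G x\<^sub>0" using v(1) q(1) qn nb_walks_children by blast
    ultimately show ?thesis by blast
  qed
qed

text \<open>\<open>Bij\<close> consists of extensional functions, hence the restriction. Adjacency
  is reflected because lengths are preserved: if the image of \<open>q\<close> extends that of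
  \<open>p\<close>, then the parent of \<open>q\<close> has the same image as \<open>p\<close>, and
  injectivity identifies the two.\<close>

lemma extend_Aut:
  assumes \<tau>: "bij_betw \<tau> (nbrs G x\<^sub>0) (nbrs G x\<^sub>0)"
  shows "restrict (extend \<tau>) (nb_walks G x\<^sub>0) \<in> Aut (tree x\<^sub>0)"
proof -
  let ?W = "nb_walks G x\<^sub>0"
  note props = extend_props[OF \<tau>]
  have inj: "inj_on (extend \<tau>) ?W" using extend_inj[OF \<tau>] by (rule inj_onI)
  have im: "extend \<tau> ` ?W = ?W" using props extend_surj[OF \<tau>] by blast
  have ext: "(\<exists>u. extend \<tau> q = u # extend \<tau> p) \<longleftrightarrow> (\<exists>u. q = u # p)" if "p \<in> ?W" "q \<in> ?W" for p q
  proof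
    have pn: "p \<noteq> []" using that(1) nb_walks_not_Nil by metis
    show "\<exists>u. extend \<tau> q = u # extend \<tau> p" if "\<exists>u. q = u # p" using that pn by auto
    assume "\<exists>u. extend \<tau> q = u # extend \<tau> p"
    then obtain u where u: "extend \<tau> q = u # extend \<tau> p" ..
    have "length q = Suc (length p)" using props[OF that(1)] props[OF that(2)] u by (metis length_Cons)
    then obtain v q' where q: "q = v # q'" "length q' = length p" by (cases q) auto
    have qn: "q' \<noteq> []" using q(2) pn by auto
    have "q' \<in> ?W" using that(2) nb_walks_children[OF qn] q by blast
    moreover have "extend \<tau> q' = extend \<tau> p" using u unfolding q(1) extend_Cons[OF qn] by simp
    ultimately have "q' = p" using extend_inj[OF \<tau> _ that(1)] by blast
    then show "\<exists>u. q = u # p" using q by blast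
  qed
  show ?thesis
    unfolding Aut_def Bij_def
    using inj im props ext
    by (auto simp: bij_betw_def parcs_covering_tree inj_on_def)
qed

text \<open>At a vertex with at least three neighbours, the commutator of two transpositions of its
  neighbours is a 3-cycle, so \<open>[\<Gamma>, \<Gamma>]\<close> moves every neighbour to every other one.\<close>

lemma commutator_root_transitive:
  assumes x\<^sub>0: "x\<^sub>0 \<in> pverts G" and y: "y \<in> nbrs G x\<^sub>0" "y' \<in> nbrs G x\<^sub>0" "y \<noteq> y'" and c3: "3 \<le> card (nbrs G x\<^sub>0)"
  shows "\<exists>c\<in>commutator_Aut (tree x\<^sub>0). c [x\<^sub>0] = [x\<^sub>0] \<and> c [y, x\<^sub>0] = [y', x\<^sub>0] \<and>
    inj_on c (nb_walks G x\<^sub>0) \<and>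
    (\<forall>p q. (p, q) \<in> parcs (tree x\<^sub>0) \<longrightarrow> (c p, c q) \<in> parcs (tree x\<^sub>0))"
proof -
  let ?W = "nb_walks G x\<^sub>0" and ?E = "parcs (tree x\<^sub>0)"
  have "\<not> nbrs G x\<^sub>0 \<subseteq> {y, y'}"
  proof
    assume "nbrs G x\<^sub>0 \<subseteq> {y, y'}"
    then have "card (nbrs G x\<^sub>0) \<le> card {y, y'}" by (intro card_mono) auto
    then show False using c3 y(3) by simp
  qed
  then obtain z where z: "z \<in> nbrs G x\<^sub>0" "z \<noteq> y" "z \<noteq> y'" by blast
  have tr: "bij_betw (Transposition.transpose u v) (nbrs G x\<^sub>0) (nbrs G x\<^sub>0)"
    if "u \<in> nbrs G x\<^sub>0" "v \<in> nbrs G x\<^sub>0" for u v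
    using that by (simp add: bij_betw_transpose_iff)
  define a where "a = restrict (extend (Transposition.transpose y y')) ?W"
  define b where "b = restrict (extend (Transposition.transpose y z)) ?W"
  have aA: "a \<in> Aut (tree x\<^sub>0)" and bA: "b \<in> Aut (tree x\<^sub>0)"
    unfolding a_def b_def using extend_Aut[OF tr] y z by auto
  have aB: "a \<in> Bij ?W" and bB: "b \<in> Bij ?W" using aA bA by (auto simp: Aut_def)
  have W: "[x\<^sub>0] \<in> ?W" "\<And>u. u \<in> nbrs G x\<^sub>0 \<Longrightarrow> [u, x\<^sub>0] \<in> ?W"
    using x\<^sub>0 by (auto simp: nb_walks_single nb_walks_Cons_Cons nbrs_iff)
  have inv: "inv_into ?W g q = p" if "g \<in> Bij ?W" "p \<in> ?W" "g p = q" for g p q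
    using that by (auto simp: Bij_def bij_betw_def)
  define c where "c = a \<otimes>\<^bsub>BijGroup ?W\<^esub> b \<otimes>\<^bsub>BijGroup ?W\<^esub> inv\<^bsub>BijGroup ?W\<^esub> a \<otimes>\<^bsub>BijGroup ?W\<^esub> inv\<^bsub>BijGroup ?W\<^esub> b"
  have cA: "c \<in> commutator_Aut (tree x\<^sub>0)"
    unfolding commutator_Aut_def derived_def c_def pverts_covering_tree
    using aA bA by (intro generate.incl) blast
  have capp: "c p = a (b (inv_into ?W a (inv_into ?W b p)))" if "p \<in> ?W" for p
    unfolding c_def by (rule BijGroup_commutator_apply[OF aB bB that])
  have "inv_into ?W b [x\<^sub>0] = [x\<^sub>0]" "inv_into ?W a [x\<^sub>0] = [x\<^sub>0]" "b [x\<^sub>0] = [x\<^sub>0]" "a [x\<^sub>0] = [x\<^sub>0]"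
    using inv[OF bB W(1)] inv[OF aB W(1)] W by (simp_all add: a_def b_def)
  then have 1: "c [x\<^sub>0] = [x\<^sub>0]" using capp[OF W(1)] by simp
  \<comment> \<open>Here \<open>b\<close> exchanges y and z, and \<open>a\<close> exchanges y and
    y'. Reading the commutator from the right, y goes to z, stays there under the inverse of
    \<open>a\<close>, returns to y under \<open>b\<close> and ends at y'.\<close>
  have "inv_into ?W b [y, x\<^sub>0] = [z, x\<^sub>0]" "inv_into ?W a [z, x\<^sub>0] = [z, x\<^sub>0]"
    "b [z, x\<^sub>0] = [y, x\<^sub>0]" "a [y, x\<^sub>0] = [y', x\<^sub>0]"
    using inv[OF bB W(2)[OF z(1)]] inv[OF aB W(2)[OF z(1)]] W y z by (simp_all add: a_def b_def)
  then have 2: "c [y, x\<^sub>0] = [y', x\<^sub>0]" using capp[OF W(2)[OF y(1)]] by simp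
  have fwd: "(g p, g q) \<in> ?E" if "g \<in> Aut (tree x\<^sub>0)" "(p, q) \<in> ?E" for g p q
    using that by (auto simp: Aut_def parcs_covering_tree)
  have bwd: "(inv_into ?W g p, inv_into ?W g q) \<in> ?E" if g: "g \<in> Aut (tree x\<^sub>0)" and pq: "(p, q) \<in> ?E" for g p q
  proof -
    have "p \<in> ?W" "q \<in> ?W" using pq by (auto simp: parcs_covering_tree)
    moreover have "bij_betw g ?W ?W" using g by (simp add: Aut_def Bij_def)
    ultimately have "inv_into ?W g p \<in> ?W" "inv_into ?W g q \<in> ?W"
      "g (inv_into ?W g p) = p" "g (inv_into ?W g q) = q"
      by (auto simp: bij_betw_def f_inv_into_f inv_into_into)
    moreover have "(g u, g v) \<in> ?E \<longleftrightarrow> (u, v) \<in> ?E" if "u \<in> ?W" "v \<in> ?W" for u v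
      using g that by (simp add: Aut_def)
    ultimately show ?thesis using pq by metis
  qed
  have 3: "(c p, c q) \<in> ?E" if "(p, q) \<in> ?E" for p q
  proof -
    have "p \<in> ?W" "q \<in> ?W" using that by (auto simp: parcs_covering_tree)
    then show ?thesis using fwd[OF aA fwd[OF bA bwd[OF aA bwd[OF bA that]]]] capp by simp
  qed
  have 4: "inj_on c ?W"
  proof -
    have "c \<in> Bij ?W"
      unfolding c_def using aB bB group.inv_closed[OF group_BijGroup, of _ ?W]
        monoid.m_closed[OF group.is_monoid[OF group_BijGroup], of _ ?W]
      by (simp add: BijGroup_def)
    then show ?thesis by (simp add: Bij_def bij_betw_def)
  qed
  show ?thesis using cA 1 2 3 4 by blast
qed

text \<open>The last two claims serve the case k = 1, where a right vertex has two neighbours and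
  cannot be the centre of a 3-cycle. If y and y' have degree two, the commutator must also carry the
  vertex beyond y to the one beyond y', since it preserves adjacency, is injective and fixes the
  root.\<close>

lemma trivial_eigenfunction_step:
  assumes x\<^sub>0: "x\<^sub>0 \<in> pverts G" and c3: "3 \<le> card (nbrs G x\<^sub>0)"
    and triv: "trivial_eigenfunction G x\<^sub>0 (Arc ` parcs (tree x\<^sub>0)) g"
    and y: "y \<in> nbrs G x\<^sub>0" "y' \<in> nbrs G x\<^sub>0"
  shows "g (Arc (x\<^sub>0, y)) = g (Arc (x\<^sub>0, y'))" "g (Arc (y, x\<^sub>0)) = g (Arc (y', x\<^sub>0))"
    "nbrs G y = {x\<^sub>0, z} \<Longrightarrow> nbrs G y' = {x\<^sub>0, z'} \<Longrightarrow> z \<noteq> x\<^sub>0 \<Longrightarrow> z' \<noteq> x\<^sub>0 \<Longrightarrow>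
       g (Arc (y, z)) = g (Arc (y', z'))"
    "nbrs G y = {x\<^sub>0, z} \<Longrightarrow> nbrs G y' = {x\<^sub>0, z'} \<Longrightarrow> z \<noteq> x\<^sub>0 \<Longrightarrow> z' \<noteq> x\<^sub>0 \<Longrightarrow>
       g (Arc (z, y)) = g (Arc (z', y'))"
proof -
  let ?W = "nb_walks G x\<^sub>0" and ?E = "parcs (tree x\<^sub>0)"
  have "g (Arc (x\<^sub>0, y)) = g (Arc (x\<^sub>0, y')) \<and> g (Arc (y, x\<^sub>0)) = g (Arc (y', x\<^sub>0)) \<and>
    (nbrs G y = {x\<^sub>0, z} \<and> nbrs G y' = {x\<^sub>0, z'} \<and> z \<noteq> x\<^sub>0 \<and> z' \<noteq> x\<^sub>0 \<longrightarrow>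
       g (Arc (y, z)) = g (Arc (y', z')) \<and> g (Arc (z, y)) = g (Arc (z', y')))"
  proof (cases "y = y'")
    case True
    then show ?thesis by auto
  next
    case False
    obtain c where c: "c \<in> commutator_Aut (tree x\<^sub>0)" "c [x\<^sub>0] = [x\<^sub>0]" "c [y, x\<^sub>0] = [y', x\<^sub>0]"
      "inj_on c ?W" "\<And>p q. (p, q) \<in> ?E \<Longrightarrow> (c p, c q) \<in> ?E"
      using commutator_root_transitive[OF x\<^sub>0 y False c3] by blast
    have t: "g (Arc (hd (c p), hd (c q))) = g (Arc (hd p, hd q))" if "(p, q) \<in> ?E" for p q
    proof -
      have "g (cover_map (map_cell c (Arc (p, q)))) = g (cover_map (Arc (p, q)))"
        using triv c(1) that unfolding trivial_eigenfunction_def by blast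
      then show ?thesis by simp
    qed
    have W: "[x\<^sub>0] \<in> ?W" "[y, x\<^sub>0] \<in> ?W"
      using x\<^sub>0 y by (auto simp: nb_walks_single nb_walks_Cons_Cons nbrs_iff)
    have "([x\<^sub>0], [y, x\<^sub>0]) \<in> ?E" "([y, x\<^sub>0], [x\<^sub>0]) \<in> ?E" using W by (auto simp: parcs_covering_tree)
    note 1 = t[OF this(1)] t[OF this(2)]
    have "g (Arc (y, z)) = g (Arc (y', z')) \<and> g (Arc (z, y)) = g (Arc (z', y'))"
      if z: "nbrs G y = {x\<^sub>0, z}" "nbrs G y' = {x\<^sub>0, z'}" "z \<noteq> x\<^sub>0" "z' \<noteq> x\<^sub>0"
    proof -
      have zW: "[z, y, x\<^sub>0] \<in> ?W" using z W(2) nbrs_iff[of z G y] by (auto simp: nb_walks_Cons_Cons)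
      then have e: "([y, x\<^sub>0], [z, y, x\<^sub>0]) \<in> ?E" "([z, y, x\<^sub>0], [y, x\<^sub>0]) \<in> ?E"
        using W by (auto simp: parcs_covering_tree)
      have e': "([y', x\<^sub>0], c [z, y, x\<^sub>0]) \<in> ?E" using c(5)[OF e(1)] c(3) by simp
      have ne: "c [z, y, x\<^sub>0] \<noteq> [x\<^sub>0]" using c(2) inj_onD[OF c(4) _ zW W(1)] by auto
      have "c [z, y, x\<^sub>0] \<in> nbrs (tree x\<^sub>0) [y', x\<^sub>0]" using e' by (simp add: nbrs_iff)
      moreover have "[y', x\<^sub>0] \<in> ?W" using e' by (simp add: parcs_covering_tree)
      ultimately have "c [z, y, x\<^sub>0] = [z', y', x\<^sub>0]"
        using ne z nbrs_covering_tree[of "[y', x\<^sub>0]" G x\<^sub>0] by auto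
      then show ?thesis using t[OF e(1)] t[OF e(2)] c(3) by simp
    qed
    then show ?thesis using 1 c(2,3) by auto
  qed
  then show "g (Arc (x\<^sub>0, y)) = g (Arc (x\<^sub>0, y'))" "g (Arc (y, x\<^sub>0)) = g (Arc (y', x\<^sub>0))"
    "nbrs G y = {x\<^sub>0, z} \<Longrightarrow> nbrs G y' = {x\<^sub>0, z'} \<Longrightarrow> z \<noteq> x\<^sub>0 \<Longrightarrow> z' \<noteq> x\<^sub>0 \<Longrightarrow>
       g (Arc (y, z)) = g (Arc (y', z'))"
    "nbrs G y = {x\<^sub>0, z} \<Longrightarrow> nbrs G y' = {x\<^sub>0, z'} \<Longrightarrow> z \<noteq> x\<^sub>0 \<Longrightarrow> z' \<noteq> x\<^sub>0 \<Longrightarrow>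
       g (Arc (z, y)) = g (Arc (z', y'))" by blast+
qed

end

section \<open>Eigenvectors of symmetric operators on finite sets\<close>

text \<open>Functions live on the whole type with the product topology; pinning the coordinates
  outside \<open>E\<close> to 0 makes the box a product of compact sets.\<close>

lemma compact_finite_box:
  fixes E :: "'e set"
  shows "compact {f :: 'e \<Rightarrow> real. (\<forall>e\<in>E. \<bar>f e\<bar> \<le> 1) \<and> (\<forall>e. e \<notin> E \<longrightarrow> f e = 0)}"
proof -
  have eq: "{f :: 'e \<Rightarrow> real. (\<forall>e\<in>E. \<bar>f e\<bar> \<le> 1) \<and> (\<forall>e. e \<notin> E \<longrightarrow> f e = 0)}
      = PiE UNIV (\<lambda>e. if e \<in> E then {-1..1} else {0})"
    by (force simp: PiE_def Pi_def abs_le_iff split: if_splits)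
  have "compactin (product_topology (\<lambda>_. euclidean) UNIV)
      (PiE UNIV (\<lambda>e :: 'e. if e \<in> E then {-1..1 :: real} else {0}))"
    unfolding compactin_PiE by auto
  then show ?thesis unfolding eq euclidean_product_topology by simp
qed

text \<open>The maximum of \<open>\<parallel>T f\<parallel>\<close> on the unit sphere of \<open>V\<close> is attained at an eigenvector of \<open>T\<^sup>2\<close>.\<close>

lemma symmetric_operator_eigenvector:
  fixes T :: "('e \<Rightarrow> real) \<Rightarrow> 'e \<Rightarrow> real"
  assumes E: "finite E" and V: "closed V"
    and supp: "\<And>f e. f \<in> V \<Longrightarrow> e \<notin> E \<Longrightarrow> f e = 0"
    and sub: "\<And>a f g. f \<in> V \<Longrightarrow> g \<in> V \<Longrightarrow> (\<lambda>e. a * f e + g e) \<in> V"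
    and TV: "\<And>f. f \<in> V \<Longrightarrow> T f \<in> V"
    and lin: "\<And>a f g. T (\<lambda>e. a * f e + g e) = (\<lambda>e. a * T f e + T g e)"
    and cont: "\<And>e. continuous_on UNIV (\<lambda>f. T f e)"
    and sym: "\<And>f g. f \<in> V \<Longrightarrow> g \<in> V \<Longrightarrow> (\<Sum>e\<in>E. T f e * g e) = (\<Sum>e\<in>E. f e * T g e)"
    and f: "f \<in> V" and C: "0 \<le> C" "C\<^sup>2 * (\<Sum>e\<in>E. (f e)\<^sup>2) < (\<Sum>e\<in>E. (T f e)\<^sup>2)"
  shows "\<exists>g\<in>V. \<exists>\<mu>. (\<exists>e\<in>E. g e \<noteq> 0) \<and> T g = (\<lambda>e. \<mu> * g e) \<and> C < \<bar>\<mu>\<bar>"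
proof -
  define ip where "ip f g = (\<Sum>e\<in>E. f e * g e)" for f g :: "'e \<Rightarrow> real"
  have ip_lin: "ip (\<lambda>e. a * f e + g e) h = a * ip f h + ip g h" for a f g h
    by (simp add: ip_def sum.distrib distrib_right sum_distrib_left mult.assoc)
  have ip_com: "ip f g = ip g f" for f g by (simp add: ip_def mult.commute)
  have ip_nn: "0 \<le> ip f f" for f by (simp add: ip_def sum_nonneg)
  have ip_0: "ip f f = 0 \<longleftrightarrow> (\<forall>e\<in>E. f e = 0)" for f
    using E by (simp add: ip_def sum_nonneg_eq_0_iff)
  have zero: "h = (\<lambda>_. 0)" if "h \<in> V" "ip h h = 0" for h
  proof
    show "h e = 0" for e using that ip_0[of h] supp[of h e] by (cases "e \<in> E") auto
  qed
  have scale: "(\<lambda>e. a * f e) \<in> V" if "f \<in> V" for a f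
  proof -
    have "(\<lambda>e. - 1 * f e + f e) \<in> V" by (rule sub[OF that that])
    from sub[OF that this, of a] show ?thesis by simp
  qed
  have T0: "T (\<lambda>_. 0) = (\<lambda>_. 0)" using lin[of "- 1" f f] by simp
  have Tscale: "T (\<lambda>e. a * h e) = (\<lambda>e. a * T h e)" for a h
    using lin[of a h "\<lambda>_. 0"] T0 by simp
  let ?S = "V \<inter> {f. ip f f = 1}"
  have fp: "0 < ip f f"
  proof (rule ccontr)
    assume "\<not> 0 < ip f f"
    then have "ip f f = 0" using ip_nn[of f] by linarith
    then have "f = (\<lambda>_. 0)" by (rule zero[OF f])
    then show False using C(2) T0 by simp
  qed
  have Cf: "C\<^sup>2 * ip f f < ip (T f) (T f)" using C(2) by (simp add: ip_def power2_eq_square)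
  \<comment> \<open>Normalising \<open>f\<close> shows that the maximum over the unit sphere exceeds
    \<open>C\<^sup>2\<close>.\<close>
  define u where "u = (\<lambda>e. (1 / sqrt (ip f f)) * f e)"
  have uV: "u \<in> V" unfolding u_def by (rule scale[OF f])
  have uu: "ip u u = 1" "ip (T u) (T u) = ip (T f) (T f) / ip f f"
    using fp unfolding u_def Tscale by (simp_all add: ip_def sum_divide_distrib[symmetric])
  have "compact ?S"
  proof -
    let ?B = "{f :: 'e \<Rightarrow> real. (\<forall>e\<in>E. \<bar>f e\<bar> \<le> 1) \<and> (\<forall>e. e \<notin> E \<longrightarrow> f e = 0)}"
    let ?C = "{f. ip f f = 1}"
    have "closed ?C"
      unfolding ip_def by (intro closed_Collect_eq continuous_intros continuous_on_product_coordinates)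
    then have "closed ?S" using V by (rule_tac closed_Int) auto
    moreover have "?S \<subseteq> ?B"
    proof
      fix g assume g: "g \<in> ?S"
      have "\<bar>g e\<bar> \<le> 1" if "e \<in> E" for e
      proof -
        have "(g e)\<^sup>2 \<le> (\<Sum>e\<in>E. (g e)\<^sup>2)" using E that by (intro member_le_sum) auto
        then show ?thesis using g by (simp add: ip_def power2_eq_square abs_square_le_1[symmetric])
      qed
      then show "g \<in> ?B" using supp g by auto
    qed
    ultimately show ?thesis
      using compact_Int_closed[OF compact_finite_box[of E], of ?S] by (simp only: Int_absorb1)
  qed
  moreover have "?S \<noteq> {}" using uV uu by blast
  moreover have "continuous_on ?S (\<lambda>f. ip (T f) (T f))"
    unfolding ip_def by (intro continuous_intros continuous_on_subset[OF cont]) auto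
  ultimately obtain g where g: "g \<in> V" "ip g g = 1" and
    mx: "\<And>h. h \<in> ?S \<Longrightarrow> ip (T h) (T h) \<le> ip (T g) (T g)"
    using continuous_attains_sup[of ?S "\<lambda>f. ip (T f) (T f)"] by blast
  define l where "l = ip (T g) (T g)"
  have "C\<^sup>2 < ip (T f) (T f) / ip f f" using Cf fp by (simp add: field_simps)
  also have "\<dots> \<le> l" unfolding l_def using mx[of u] uV uu by simp
  finally have Cl: "C\<^sup>2 < l" .
  have mx': "ip (T h) (T h) \<le> l * ip h h" if h: "h \<in> V" for h
  proof (cases "ip h h = 0")
    case True
    then have "h = (\<lambda>_. 0)" by (rule zero[OF h])
    then show ?thesis using T0 by (simp add: ip_def)
  next
    case False
    then have hp: "0 < ip h h" using ip_nn[of h] by linarith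
    define v where "v = (\<lambda>e. (1 / sqrt (ip h h)) * h e)"
    have "v \<in> V" unfolding v_def by (rule scale[OF h])
    moreover have "ip v v = 1" "ip (T v) (T v) = ip (T h) (T h) / ip h h"
      using hp unfolding v_def Tscale by (simp_all add: ip_def sum_divide_distrib[symmetric])
    ultimately have "ip (T h) (T h) / ip h h \<le> l" unfolding l_def using mx[of v] by simp
    then show ?thesis using hp by (simp add: field_simps)
  qed
  \<comment> \<open>The residual l g - T (T g). It belongs to \<open>V\<close>, and pairing it with
    itself will give 0.\<close>
  define h where "h = (\<lambda>e. (- 1) * T (T g) e + l * g e)"
  have hV: "h \<in> V" unfolding h_def by (intro sub TV scale g)
  \<comment> \<open>First-order optimality at g: for the perturbation g + t w the defect is a
    quadratic in t that is nonnegative and vanishes at 0, so its linear coefficient is 0.\<close>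
  have orth: "l * ip g w = ip (T g) (T w)" if w: "w \<in> V" for w
  proof -
    define B where "B = l * ip g w - ip (T g) (T w)"
    define A where "A = l * ip w w - ip (T w) (T w)"
    have ge: "0 \<le> 2 * t * B + t\<^sup>2 * A" for t
    proof -
      let ?p = "\<lambda>e. t * w e + g e"
      have pp: "ip ?p ?p = t\<^sup>2 * ip w w + 2 * t * ip g w + ip g g"
        by (simp add: ip_def sum.distrib sum_distrib_left algebra_simps power2_eq_square)
      have TT: "ip (T ?p) (T ?p) = t\<^sup>2 * ip (T w) (T w) + 2 * t * ip (T g) (T w) + ip (T g) (T g)"
        unfolding lin by (simp add: ip_def sum.distrib sum_distrib_left algebra_simps power2_eq_square)
      have "ip (T ?p) (T ?p) \<le> l * ip ?p ?p" by (intro mx' sub w g)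
      then show ?thesis
        unfolding pp TT using g(2) by (simp add: A_def B_def l_def algebra_simps)
    qed
    have "B = 0"
    proof (rule ccontr)
      assume B: "B \<noteq> 0"
      \<comment> \<open>The test value t = - B / c, with c positive and above A, makes the quadratic
        at most - B^2 / c, which is negative.\<close>
      define c where "c = \<bar>A\<bar> + 1"
      have c: "0 < c" "A < c" by (simp_all add: c_def)
      have "0 \<le> 2 * (- B / c) * B + (- B / c)\<^sup>2 * A" by (rule ge)
      also have "\<dots> \<le> 2 * (- B / c) * B + (- B / c)\<^sup>2 * c"
        using c by (intro add_left_mono mult_left_mono) auto
      also have "\<dots> = - (B\<^sup>2 / c)" using c by (simp add: field_simps power2_eq_square)
      also have "\<dots> < 0" using B c by simp
      finally show False by simp
    qed
    then show ?thesis by (simp add: B_def)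
  qed
  have "ip h h = 0"
  proof -
    have "ip (T g) (T h) = ip (T (T g)) h" unfolding ip_def using sym[OF TV[OF g(1)] hV] by simp
    moreover have "ip h w = - 1 * ip (T (T g)) w + l * ip g w" for w
      unfolding h_def by (simp add: ip_def sum_distrib_left algebra_simps sum_subtractf sum_negf)
    ultimately show ?thesis using orth[OF hV] by (metis (no_types) add.commute diff_self mult_minus1 uminus_add_conv_diff)
  qed
  then have h0: "h = (\<lambda>_. 0)" by (rule zero[OF hV])
  then have TTg: "T (T g) = (\<lambda>e. l * g e)" by (simp add: h_def fun_eq_iff)
  define m where "m = sqrt l"
  have l0: "0 < l" using Cl by (smt (verit) zero_le_power2)
  then have m: "0 < m" "m * m = l" "C < m" using Cl C(1)
    by (simp_all add: m_def real_less_rsqrt)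
  have gne: "\<exists>e\<in>E. g e \<noteq> 0" using g(2) ip_0[of g] by auto
  show ?thesis
  proof (cases "T g = (\<lambda>e. (- m) * g e)")
    case True
    then show ?thesis using g(1) gne m by (intro bexI[of _ g] exI[of _ "- m"]) auto
  next
    case False
    \<comment> \<open>From (T - m) (T + m) g = 0: unless g is an eigenvector for - m, the vector (T
      + m) g is one for m.\<close>
    define v where "v = (\<lambda>e. m * g e + T g e)"
    have vV: "v \<in> V" unfolding v_def by (intro sub TV g)
    have "\<exists>e\<in>E. v e \<noteq> 0"
    proof (rule ccontr)
      assume "\<not> (\<exists>e\<in>E. v e \<noteq> 0)"
      then have "v e = 0" for e using supp[OF vV] by blast
      then have "T g e = - m * g e" for e unfolding v_def by (simp add: add_eq_0_iff2)
      then show False using False by auto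
    qed
    moreover have "T v = (\<lambda>e. m * v e)"
      unfolding v_def lin TTg m(2)[symmetric] by (simp add: algebra_simps)
    ultimately show ?thesis using vV m by (intro bexI[of _ v] exI[of _ m]) auto
  qed
qed

section \<open>Biregular bigraphs\<close>

lemma out_degree_card_nbrs: "out_degree (with_proj X) v = card (nbrs X v)"
proof -
  have "out_arcs (with_proj X) v = Pair v ` nbrs X v"
    by (auto simp: out_arcs_def nbrs_iff)
  then show ?thesis by (simp add: out_degree_def card_image inj_on_def)
qed

locale regular_bigraph =
  fixes K k :: nat and L R :: "'a set" and X :: "'a pair_pre_digraph"
  assumes bigraph: "bigraph K k L R X" and k_pos: "1 \<le> k" and k_less: "k < K"
begin

sublocale pair_graph X using bigraph by (simp add: bigraph_def)

lemma verts_eq: "pverts X = L \<union> R" and disjoint: "L \<inter> R = {}"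
  and arcs_sub: "parcs X \<subseteq> L \<times> R \<union> R \<times> L"
  using bigraph by (simp_all add: bigraph_def)

lemma card_nbrs_L: "v \<in> L \<Longrightarrow> card (nbrs X v) = K + 1"
  and card_nbrs_R: "v \<in> R \<Longrightarrow> card (nbrs X v) = k + 1"
  using bigraph by (simp_all add: bigraph_def out_degree_card_nbrs)

lemma X_sym: "(u, v) \<in> parcs X \<Longrightarrow> (v, u) \<in> parcs X"
  using pair_sym_arcs by (auto simp: symmetric_def elim: symE)

sublocale nb_regular X "K * k" K
proof
  show "(u, v) \<in> parcs X \<Longrightarrow> (v, u) \<in> parcs X" for u v by (rule X_sym)
  show "(u, v) \<in> parcs X \<Longrightarrow> u \<in> pverts X" for u v by (rule in_arcsD1)
  have "{w. (v, w) \<in> parcs X} \<subseteq> pverts X" for v using in_arcsD2 by blast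
  then show "finite {w. (v, w) \<in> parcs X}" for v using pair_finite_verts finite_subset by blast
  show "(card (nbrs X u) - 1) * (card (nbrs X v) - 1) = K * k" if "(u, v) \<in> parcs X" for u v
    using that arcs_sub card_nbrs_L card_nbrs_R by force
  show "1 \<le> card (nbrs X v) - 1" "card (nbrs X v) - 1 \<le> K" if "v \<in> pverts X" for v
    using that verts_eq card_nbrs_L card_nbrs_R k_pos k_less by force+
qed

section \<open>Arcs between the sides, connectedness and surjectivity of the cover\<close>

lemma finite_E: "finite (parcs X)" by (rule pair_finite_arcs)

lemma arc_cases:
  assumes "(u, v) \<in> parcs X"
  shows "u \<in> L \<and> v \<in> R \<and> u \<notin> R \<and> v \<notin> L \<or> u \<in> R \<and> v \<in> L \<and> u \<notin> L \<and> v \<notin> R"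
  using assms arcs_sub disjoint by blast

lemma nbrs_L: "v \<in> L \<Longrightarrow> nbrs X v \<subseteq> R" and nbrs_R: "v \<in> R \<Longrightarrow> nbrs X v \<subseteq> L"
  by (auto simp: nbrs_iff dest: arc_cases)

lemma nbrs_sym: "u \<in> nbrs X v \<longleftrightarrow> v \<in> nbrs X u"
  using X_sym by (auto simp: nbrs_iff)

lemma nbrs_nonempty: "v \<in> pverts X \<Longrightarrow> nbrs X v \<noteq> {}"
  using branch_pos by force

text \<open>Connectedness as a closure principle. \<open>connected\<close> is phrased through the
  symmetrised digraph, whose arcs are again those of X by symmetry.\<close>

lemma connected_induct:
  assumes S: "S \<noteq> {}" "S \<subseteq> pverts X" and step: "\<And>v. v \<in> S \<Longrightarrow> nbrs X v \<subseteq> S"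
  shows "S = pverts X"
proof
  obtain u where u: "u \<in> S" using S by blast
  show "pverts X \<subseteq> S"
  proof
    fix v assume v: "v \<in> pverts X"
    have "Digraph_Component.connected (with_proj X)" using bigraph by (simp add: bigraph_def)
    then have "u \<rightarrow>\<^sup>*\<^bsub>mk_symmetric (with_proj X)\<^esub> v"
      using u v S(2) unfolding connected_def strongly_connected_def by auto
    then have "(u, v) \<in> (parcs (mk_symmetric (with_proj X)))\<^sup>*"
      using reachable_rtranclI by fastforce
    then show "v \<in> S"
    proof (induction rule: rtrancl_induct)
      case (step y z)
      then have "(y, z) \<in> parcs X \<or> (z, y) \<in> parcs X"
        by (auto simp: mk_symmetric_def)
      then have "z \<in> nbrs X y" using X_sym by (auto simp: nbrs_iff)
      then show ?case using step.IH assms(3) by blast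
    qed (rule u)
  qed
qed (rule S)

text \<open>The vertices satisfying P, together with their right neighbours, form a set closed under
  neighbours. In the step z may coincide with l.\<close>

lemma left_induct:
  assumes "l\<^sub>0 \<in> L" "P l\<^sub>0" "l \<in> L"
    and step: "\<And>l r z. l \<in> L \<Longrightarrow> P l \<Longrightarrow> r \<in> nbrs X l \<Longrightarrow> z \<in> nbrs X r \<Longrightarrow> P z"
  shows "P l"
proof -
  let ?S = "{l \<in> L. P l} \<union> {r. \<exists>l\<in>L. P l \<and> r \<in> nbrs X l}"
  have "?S = pverts X"
  proof (rule connected_induct)
    show "?S \<noteq> {}" using assms by blast
    show "?S \<subseteq> pverts X" using verts_eq nbrs_L by blast
    fix v assume v: "v \<in> ?S"
    show "nbrs X v \<subseteq> ?S"
    proof (cases "v \<in> L")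
      case True
      then have "P v" using v nbrs_L disjoint by blast
      then show ?thesis using True by blast
    next
      case False
      then obtain l where l: "l \<in> L" "P l" "v \<in> nbrs X l" using v by blast
      then have "nbrs X v \<subseteq> L" using nbrs_L nbrs_R by blast
      then show ?thesis using step l by blast
    qed
  qed
  then have "l \<in> ?S" using assms(3) verts_eq by blast
  then show ?thesis using assms(3) nbrs_L disjoint by blast
qed

text \<open>The projected vertices are closed under neighbours because the projection is a local
  isomorphism, so connectedness gives surjectivity. The eigenfunction condition quantifies over this
  image.\<close>

lemma cover_image: "x\<^sub>0 \<in> pverts X \<Longrightarrow> cover_map ` Arc ` parcs (tree x\<^sub>0) = Arc ` parcs X"
proof -
  assume x\<^sub>0: "x\<^sub>0 \<in> pverts X"
  have ar: "\<exists>e\<in>parcs (tree x\<^sub>0). map_prod hd hd e = (hd w, u)"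
    if w: "w \<in> nb_walks X x\<^sub>0" "u \<in> nbrs X (hd w)" for w u
  proof -
    have "bij_betw hd (nbrs (tree x\<^sub>0) w) (nbrs X (hd w))"
      using cover_local_iso[of x\<^sub>0] w(1) by (simp add: local_iso_def)
    then obtain q where "q \<in> nbrs (tree x\<^sub>0) w" "hd q = u"
      using w(2) unfolding bij_betw_def by (metis imageE)
    then show ?thesis by (intro bexI[of _ "(w, q)"]) (auto simp: nbrs_iff)
  qed
  have "hd ` nb_walks X x\<^sub>0 = pverts X"
  proof (rule connected_induct)
    show "hd ` nb_walks X x\<^sub>0 \<noteq> {}" using nb_walks.start[OF x\<^sub>0] by blast
    show "hd ` nb_walks X x\<^sub>0 \<subseteq> pverts X" using nb_walks_hd by blast
    fix v assume "v \<in> hd ` nb_walks X x\<^sub>0"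
    then obtain w where w: "w \<in> nb_walks X x\<^sub>0" "v = hd w" by blast
    show "nbrs X v \<subseteq> hd ` nb_walks X x\<^sub>0"
    proof
      fix u assume "u \<in> nbrs X v"
      then obtain p q where "(p, q) \<in> parcs (tree x\<^sub>0)" "hd q = u" using ar[OF w(1)] w(2) by force
      then show "u \<in> hd ` nb_walks X x\<^sub>0" using tree_arc_verts by force
    qed
  qed
  then have "(u, v) \<in> map_prod hd hd ` parcs (tree x\<^sub>0)" if "(u, v) \<in> parcs X" for u v
  proof -
    have "u \<in> hd ` nb_walks X x\<^sub>0" using that in_arcsD1 \<open>hd ` nb_walks X x\<^sub>0 = pverts X\<close> by blast
    then obtain w where "w \<in> nb_walks X x\<^sub>0" "u = hd w" by blast
    with ar[of w v] that show ?thesis by (force simp: nbrs_iff image_iff)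
  qed
  moreover have "map_prod hd hd ` parcs (tree x\<^sub>0) \<subseteq> parcs X"
    by (rule image_subsetI) (rule local_iso_arc[OF covering_tree_sym_graph cover_local_iso])
  ultimately have "map_prod hd hd ` parcs (tree x\<^sub>0) = parcs X" by auto
  then show ?thesis by (force simp: image_iff)
qed

text \<open>Blocks are the level sets of the trivial eigenfunctions on arcs. In general \<open>A = L\<close> and \<open>s\<close> is false.
  If \<open>k = 1\<close> and \<open>A\<close> is a left transversal, then \<open>s\<close> is true: crossing a right vertex switches
  between \<open>A\<close> and \<open>L - A\<close>.\<close>

definition left_end :: "'a \<times> 'a \<Rightarrow> 'a" where
  "left_end e = (if fst e \<in> L then fst e else snd e)"

definition block :: "'a set \<Rightarrow> 'a \<times> 'a \<Rightarrow> bool \<times> bool" where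
  "block A e = (fst e \<in> L, left_end e \<in> A)"

definition switching :: "'a set \<Rightarrow> bool \<Rightarrow> bool" where
  "switching A s \<longleftrightarrow> (\<forall>r\<in>R. \<forall>v\<in>nbrs X r. \<forall>v'\<in>nbrs X r. v \<noteq> v' \<longrightarrow> (v \<in> A) = ((v' \<in> A) \<noteq> s))"

text \<open>The left end changes only when a right vertex is crossed; an arc entering a left vertex
  shares its left end with its successors.\<close>

definition next_block :: "bool \<Rightarrow> bool \<times> bool \<Rightarrow> bool \<times> bool" where
  "next_block s \<beta> = (\<not> fst \<beta>, if fst \<beta> then snd \<beta> \<noteq> s else snd \<beta>)"

definition flip :: "bool \<times> bool \<Rightarrow> bool \<times> bool" where
  "flip \<beta> = (\<not> fst \<beta>, snd \<beta>)"

definition arc_block :: "'a set \<Rightarrow> bool \<times> bool \<Rightarrow> ('a \<times> 'a) set" where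
  "arc_block A \<beta> = {e \<in> parcs X. block A e = \<beta>}"

lemma block_swap: "e \<in> parcs X \<Longrightarrow> block A (prod.swap e) = flip (block A e)"
  using arc_cases[of "fst e" "snd e"] by (auto simp: block_def left_end_def flip_def)

lemma block_successor:
  assumes A: "switching A s" and e: "e \<in> parcs X" "e' \<in> nb_successors X e"
  shows "block A e' = next_block s (block A e)"
proof -
  obtain u v w where e': "e = (u, v)" "e' = (v, w)" "(u, v) \<in> parcs X" "(v, w) \<in> parcs X" "w \<noteq> u"
    using e by (cases e) (auto simp: nb_successors_def)
  show ?thesis
  proof (cases "u \<in> L")
    case True
    then have "v \<in> R" "v \<notin> L" "w \<in> L" using arc_cases[OF e'(3)] arc_cases[OF e'(4)] by auto
    moreover have "u \<in> nbrs X v" "w \<in> nbrs X v" using e' X_sym by (auto simp: nbrs_iff)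
    ultimately have "(w \<in> A) = ((u \<in> A) \<noteq> s)" using A e'(5) unfolding switching_def by blast
    then show ?thesis using True \<open>v \<notin> L\<close> e' by (auto simp: block_def next_block_def left_end_def)
  next
    case False
    then have "v \<in> L" using arc_cases[OF e'(3)] by auto
    then show ?thesis using False e' by (auto simp: block_def next_block_def left_end_def)
  qed
qed

section \<open>The adjoint of the walk and the symmetry of the walk with reversal\<close>

lemma card_succ: "e \<in> parcs X \<Longrightarrow> card (nb_successors X e) = (if fst e \<in> L then k else K)"
  using arc_cases[of "fst e" "snd e"] card_nbrs_L card_nbrs_R by (auto simp: card_nb_successors)

text \<open>A non-backtracking walk read backwards is one along the reversed arcs.\<close>

lemma pred_eq:
  assumes "e' \<in> parcs X"
  shows "{e \<in> parcs X. e' \<in> nb_successors X e} = prod.swap ` nb_successors X (prod.swap e')"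
proof (rule Set.set_eqI)
  fix e :: "'a \<times> 'a"
  obtain a b where e': "e' = (a, b)" by force
  obtain u v where e: "e = (u, v)" by force
  show "e \<in> {e \<in> parcs X. e' \<in> nb_successors X e} \<longleftrightarrow> e \<in> prod.swap ` nb_successors X (prod.swap e')"
    using assms X_sym[of u v] X_sym[of v u]
    by (auto simp: e e' nb_successors_def prod.swap_def image_iff)
qed

text \<open>The adjoint of the walk operator is its conjugate by the reversal of arcs.\<close>

lemma sum_nb_sum:
  "(\<Sum>e\<in>parcs X. g e * nb_sum X f e) = (\<Sum>e\<in>parcs X. nb_sum X (g \<circ> prod.swap) (prod.swap e) * (f e :: real))"
proof -
  have "(\<Sum>e\<in>parcs X. g e * nb_sum X f e)
      = (\<Sum>e\<in>parcs X. \<Sum>e'\<in>{e' \<in> parcs X. e' \<in> nb_successors X e}. g e * f e')"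
    unfolding nb_sum_def sum_distrib_left
    using nb_successors_subset[of X] by (intro sum.cong) auto
  also have "\<dots> = (\<Sum>e'\<in>parcs X. \<Sum>e\<in>{e \<in> parcs X. e' \<in> nb_successors X e}. g e * f e')"
    by (rule sum.swap_restrict) (rule finite_E)+
  also have "\<dots> = (\<Sum>e'\<in>parcs X. nb_sum X (g \<circ> prod.swap) (prod.swap e') * f e')"
  proof (rule sum.cong[OF refl])
    fix e' assume "e' \<in> parcs X"
    then show "(\<Sum>e\<in>{e \<in> parcs X. e' \<in> nb_successors X e}. g e * f e')
        = nb_sum X (g \<circ> prod.swap) (prod.swap e') * f e'"
      unfolding pred_eq[OF \<open>e' \<in> parcs X\<close>] nb_sum_def
      by (subst sum.reindex) (auto simp: sum_distrib_right inj_on_def)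
  qed
  finally show ?thesis .
qed

lemma swap_arcs: "prod.swap ` parcs X = parcs X"
  using X_sym by force

lemma sum_swap: "(\<Sum>e\<in>parcs X. f (prod.swap e)) = (\<Sum>e\<in>parcs X. f e)"
  by (subst (2) swap_arcs[symmetric]) (simp add: sum.reindex)

text \<open>The operator \<open>B\<^sup>n J\<close> over the reals, cut off outside the arcs so that
  its values stay in the space of functions supported there.\<close>

definition sym_walk :: "nat \<Rightarrow> ('a \<times> 'a \<Rightarrow> real) \<Rightarrow> 'a \<times> 'a \<Rightarrow> real" where
  "sym_walk n f = (\<lambda>e. if e \<in> parcs X then nb_rev X n f e else 0)"

lemma sum_nb_pow:
  "(\<Sum>e\<in>parcs X. (nb_sum X ^^ n) f e * g e)
    = (\<Sum>e\<in>parcs X. f e * ((nb_sum X ^^ n) (g \<circ> prod.swap) \<circ> prod.swap) e)" for f g :: "'a \<times> 'a \<Rightarrow> real"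
proof (induction n arbitrary: f g)
  case (Suc n)
  have "(\<Sum>e\<in>parcs X. (nb_sum X ^^ Suc n) f e * g e)
      = (\<Sum>e\<in>parcs X. g e * nb_sum X ((nb_sum X ^^ n) f) e)"
    by (simp add: mult.commute)
  also have "\<dots> = (\<Sum>e\<in>parcs X. (nb_sum X ^^ n) f e * (nb_sum X (g \<circ> prod.swap) \<circ> prod.swap) e)"
    unfolding sum_nb_sum by (simp add: mult.commute)
  also have "\<dots> = (\<Sum>e\<in>parcs X. f e * ((nb_sum X ^^ n) (nb_sum X (g \<circ> prod.swap)) \<circ> prod.swap) e)"
    unfolding Suc.IH by (simp add: comp_def)
  also have "\<dots> = (\<Sum>e\<in>parcs X. f e * ((nb_sum X ^^ Suc n) (g \<circ> prod.swap) \<circ> prod.swap) e)"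
    by (simp add: funpow_swap1)
  finally show ?case .
qed (simp add: comp_def)

text \<open>The adjoint of \<open>B\<^sup>n\<close> is \<open>J B\<^sup>n J\<close>, and
  \<open>J\<close> is a symmetric involution, so the adjoint of \<open>B\<^sup>n J\<close> is
  \<open>J J B\<^sup>n J = B\<^sup>n J\<close>.\<close>

lemma sym_walk_sym: "(\<Sum>e\<in>parcs X. sym_walk n f e * g e) = (\<Sum>e\<in>parcs X. f e * sym_walk n g e)"
proof -
  have "(\<Sum>e\<in>parcs X. sym_walk n f e * g e) = (\<Sum>e\<in>parcs X. (nb_sum X ^^ n) (f \<circ> prod.swap) e * g e)"
    by (intro sum.cong) (auto simp: sym_walk_def nb_rev_def)
  also have "\<dots> = (\<Sum>e\<in>parcs X. f (prod.swap e) * (nb_sum X ^^ n) (g \<circ> prod.swap) (prod.swap e))"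
    unfolding sum_nb_pow by simp
  also have "\<dots> = (\<Sum>e\<in>parcs X. f e * (nb_sum X ^^ n) (g \<circ> prod.swap) e)"
    by (rule sum_swap)
  also have "\<dots> = (\<Sum>e\<in>parcs X. f e * sym_walk n g e)"
    by (intro sum.cong) (auto simp: sym_walk_def nb_rev_def)
  finally show ?thesis .
qed

text \<open>The orthogonal complement of the block indicators within the functions supported on
  arcs.\<close>

definition zero_sum :: "'a set \<Rightarrow> ('a \<times> 'a \<Rightarrow> real) set" where
  "zero_sum A = {f. (\<forall>e. e \<notin> parcs X \<longrightarrow> f e = 0) \<and> (\<forall>\<beta>. (\<Sum>e\<in>arc_block A \<beta>. f e) = 0)}"

lemma finite_arc_block: "finite (arc_block A \<beta>)"
  using finite_E by (simp add: arc_block_def)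

lemma zero_sum_iff:
  assumes "\<And>e. e \<notin> parcs X \<Longrightarrow> f e = 0"
  shows "f \<in> zero_sum A \<longleftrightarrow> (\<forall>\<beta>. (\<Sum>e\<in>parcs X. (if block A e = \<beta> then 1 else 0) * f e) = 0)"
proof -
  have "(\<Sum>e\<in>parcs X. (if block A e = \<beta> then 1 else 0) * f e) = (\<Sum>e\<in>arc_block A \<beta>. f e)" for \<beta>
    unfolding arc_block_def by (rule sum.mono_neutral_cong_right) (auto simp: finite_E)
  then show ?thesis using assms by (simp add: zero_sum_def)
qed

lemma nb_sum_block:
  assumes "switching A s" "e \<in> parcs X"
  shows "nb_sum X (\<lambda>e. \<phi> (block A e)) e = (if fst e \<in> L then real k else real K) * \<phi> (next_block s (block A e))"
proof -
  have "nb_sum X (\<lambda>e. \<phi> (block A e)) e = (\<Sum>e'\<in>nb_successors X e. \<phi> (next_block s (block A e)))"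
    unfolding nb_sum_def by (intro sum.cong) (use block_successor[OF assms] in auto)
  then show ?thesis using card_succ[OF assms(2)] by simp
qed

text \<open>By the adjoint formula, pairing with a block indicator after a step amounts to pairing
  with a function of the block before it. Such a function is a combination of the four block
  indicators, each orthogonal to f.\<close>

lemma zero_sum_nb_sum:
  fixes f :: "'a \<times> 'a \<Rightarrow> real"
  assumes A: "switching A s" and f: "\<And>\<beta>. (\<Sum>e\<in>parcs X. (if block A e = \<beta> then 1 else 0) * f e) = 0"
  shows "(\<Sum>e\<in>parcs X. (if block A e = \<beta> then 1 else 0) * nb_sum X f e) = 0"
proof -
  let ?\<phi> = "\<lambda>\<beta>'. if \<beta>' = flip \<beta> then 1 else 0 :: real"
  have fl: "(flip a = b) = (a = flip b)" for a b by (cases a; cases b) (auto simp: flip_def)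
  have "(\<Sum>e\<in>parcs X. (if block A e = \<beta> then 1 else 0) * nb_sum X f e)
    = (\<Sum>e\<in>parcs X. nb_sum X ((\<lambda>e. if block A e = \<beta> then 1 else 0) \<circ> prod.swap) (prod.swap e) * f e)"
    by (rule sum_nb_sum[of "\<lambda>e. if block A e = \<beta> then 1 else 0"])
  also have "\<dots> = (\<Sum>e\<in>parcs X. (if fst (flip (block A e)) then real k else real K) *
      ?\<phi> (next_block s (flip (block A e))) * f e)"
  proof (rule sum.cong[OF refl])
    fix e assume e: "e \<in> parcs X"
    then have se: "prod.swap e \<in> parcs X" using swap_arcs by blast
    have "nb_sum X ((\<lambda>e. if block A e = \<beta> then 1 else 0) \<circ> prod.swap) (prod.swap e)
        = nb_sum X (\<lambda>e. ?\<phi> (block A e)) (prod.swap e)"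
      by (rule nb_sum_cong) (simp add: block_swap fl)
    also have "\<dots> = (if fst (prod.swap e) \<in> L then real k else real K) * ?\<phi> (next_block s (block A (prod.swap e)))"
      by (rule nb_sum_block[OF A se])
    also have "(fst (prod.swap e) \<in> L) = fst (flip (block A e))"
      using block_swap[OF e, of A] by (metis block_def fst_conv)
    also have "block A (prod.swap e) = flip (block A e)" by (rule block_swap[OF e])
    finally show "nb_sum X ((\<lambda>e. if block A e = \<beta> then 1 else 0) \<circ> prod.swap) (prod.swap e) * f e =
      (if fst (flip (block A e)) then real k else real K) * ?\<phi> (next_block s (flip (block A e))) * f e"
      by (simp only:)
  qed
  also have "\<dots> = (\<Sum>e\<in>parcs X. \<Sum>\<gamma>\<in>UNIV. (if fst (flip \<gamma>) then real k else real K) *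
      ?\<phi> (next_block s (flip \<gamma>)) * ((if block A e = \<gamma> then 1 else 0) * f e))"
  proof (rule sum.cong[OF refl])
    fix e
    have "(\<Sum>\<gamma>\<in>UNIV. (if fst (flip \<gamma>) then real k else real K) *
        ?\<phi> (next_block s (flip \<gamma>)) * ((if block A e = \<gamma> then 1 else 0) * f e))
      = (\<Sum>\<gamma>\<in>UNIV. if block A e = \<gamma> then (if fst (flip \<gamma>) then real k else real K) *
        ?\<phi> (next_block s (flip \<gamma>)) * f e else 0)"
      by (intro sum.cong) auto
    then show "(if fst (flip (block A e)) then real k else real K) * ?\<phi> (next_block s (flip (block A e))) * f e
      = (\<Sum>\<gamma>\<in>UNIV. (if fst (flip \<gamma>) then real k else real K) *
        ?\<phi> (next_block s (flip \<gamma>)) * ((if block A e = \<gamma> then 1 else 0) * f e))"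
      by (simp add: sum.delta)
  qed
  also have "\<dots> = (\<Sum>\<gamma>\<in>UNIV. (if fst (flip \<gamma>) then real k else real K) *
      ?\<phi> (next_block s (flip \<gamma>)) * (\<Sum>e\<in>parcs X. (if block A e = \<gamma> then 1 else 0) * f e))"
    by (subst sum.swap) (simp only: sum_distrib_left)
  also have "\<dots> = 0" unfolding f by simp
  finally show ?thesis .
qed

lemma sym_walk_zero_sum:
  assumes A: "switching A s" and f: "f \<in> zero_sum A"
  shows "sym_walk n f \<in> zero_sum A"
proof -
  have fl: "(flip a = b) = (a = flip b)" for a b by (cases a; cases b) (auto simp: flip_def)
  have f0: "(\<Sum>e\<in>parcs X. (if block A e = \<beta> then 1 else 0) * f e) = 0" for \<beta>
  proof -
    have "f e = 0" if "e \<notin> parcs X" for e using f that unfolding zero_sum_def by blast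
    then show ?thesis using f zero_sum_iff[of f A] by blast
  qed
  have "(\<Sum>e\<in>parcs X. (if block A e = \<beta> then 1 else 0) * (f \<circ> prod.swap) e) = 0" for \<beta>
  proof -
    have "(\<Sum>e\<in>parcs X. (if block A e = \<beta> then 1 else 0) * (f \<circ> prod.swap) e)
      = (\<Sum>e\<in>parcs X. (if block A (prod.swap e) = flip \<beta> then 1 else 0) * f (prod.swap e))"
      by (intro sum.cong refl) (simp add: block_swap fl, simp add: flip_def)
    also have "\<dots> = (\<Sum>e\<in>parcs X. (if block A e = flip \<beta> then 1 else 0) * f e)" by (rule sum_swap)
    finally show ?thesis using f0 by simp
  qed
  then have "(\<Sum>e\<in>parcs X. (if block A e = \<beta> then 1 else 0) * (nb_sum X ^^ n) (f \<circ> prod.swap) e) = 0" for \<beta>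
    by (induction n arbitrary: \<beta>) (auto intro!: zero_sum_nb_sum[OF A])
  then show ?thesis
    by (subst zero_sum_iff) (auto simp: sym_walk_def nb_rev_def cong: sum.cong if_cong)
qed

text \<open>The pair \<open>h l\<close> records g on arcs leaving and entering l; basing the tree at
  l shows that it depends on l alone. For k \<ge> 2, basing it at a right vertex equates
  \<open>h\<close> on all its neighbours, and connectedness finishes. For k = 1, \<open>H x\<close>
  is the value of \<open>h\<close> at the other left vertices two steps from x, and each such step
  exchanges \<open>h\<close> and \<open>H\<close>. So \<open>h\<close> has at most two values: a
  switching set tells them apart; otherwise they agree, since a level set of \<open>h\<close> would
  be a left transversal.\<close>

lemma trivial_blocks:
  assumes triv: "\<And>x\<^sub>0. x\<^sub>0 \<in> pverts X \<Longrightarrow> trivial_eigenfunction X x\<^sub>0 (Arc ` parcs (tree x\<^sub>0)) g"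
    and A: "A = L \<and> (2 \<le> k \<or> \<not> has_left_transversal L R X) \<or> k = 1 \<and> switching A True"
    and e: "e \<in> parcs X" "e' \<in> parcs X" "block A e = block A e'"
  shows "g (Arc e) = g (Arc e')"
proof -
  define pick where "pick v = (SOME r. r \<in> nbrs X v)" for v
  define h where "h l = (g (Arc (l, pick l)), g (Arc (pick l, l)))" for l
  have L3: "3 \<le> card (nbrs X l)" "l \<in> pverts X" if "l \<in> L" for l
    using card_nbrs_L[OF that] that k_pos k_less verts_eq by auto
  have h_eq: "h l = (g (Arc (l, r)), g (Arc (r, l)))" if "l \<in> L" "r \<in> nbrs X l" for l r
  proof -
    have "pick l \<in> nbrs X l" unfolding pick_def using that(2) by (rule someI)
    from trivial_eigenfunction_step(1,2)[OF L3(2)[OF that(1)] L3(1)[OF that(1)] triv[OF L3(2)[OF that(1)]] this that(2)]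
    show ?thesis by (simp add: h_def)
  qed
  have "h l = h l'" if ll: "l \<in> L" "l' \<in> L" "(l \<in> A) = (l' \<in> A)" for l l'
  proof (cases "2 \<le> k")
    case True
    have "h z = h l" if "z \<in> L" for z
    proof (rule left_induct[OF ll(1) refl that])
      fix x r z
      assume x: "x \<in> L" "h x = h l" "r \<in> nbrs X x" "z \<in> nbrs X r"
      have r: "r \<in> R" "r \<in> pverts X" "x \<in> nbrs X r" "z \<in> L"
        using x nbrs_L nbrs_R verts_eq nbrs_sym by blast+
      have c: "3 \<le> card (nbrs X r)" using card_nbrs_R[OF r(1)] True by simp
      have "h z = (g (Arc (z, r)), g (Arc (r, z)))"
        by (rule h_eq[OF r(4)]) (use x(4) nbrs_sym in blast)
      also have "\<dots> = (g (Arc (x, r)), g (Arc (r, x)))"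
        using trivial_eigenfunction_step(1,2)[OF r(2) c triv[OF r(2)] x(4) r(3)] by simp
      also have "\<dots> = h x" by (rule h_eq[OF x(1,3), symmetric])
      finally show "h z = h l" using x(2) by simp
    qed
    then show ?thesis using ll by metis
  next
    case False
    then have k1: "k = 1" using k_pos by simp
    have two: "\<exists>z. z \<noteq> x \<and> nbrs X r = {x, z}" if "x \<in> nbrs X r" "r \<in> R" for x r
    proof -
      have "card (nbrs X r) = 2" using card_nbrs_R[OF that(2)] k1 by simp
      then show ?thesis using that(1) unfolding card_2_iff by auto
    qed
    have h2: "h z = h z'"
      if x: "x \<in> L" "r \<in> nbrs X x" "r' \<in> nbrs X x" "nbrs X r = {x, z}" "nbrs X r' = {x, z'}" "z \<noteq> x" "z' \<noteq> x"
      for x r r' z z'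
    proof -
      have z: "z \<in> L" "z' \<in> L" using x nbrs_L nbrs_R by blast+
      have "h z = (g (Arc (z, r)), g (Arc (r, z)))" "h z' = (g (Arc (z', r')), g (Arc (r', z')))"
        by (rule h_eq[OF z(1)], use x nbrs_sym in blast, rule h_eq[OF z(2)], use x nbrs_sym in blast)
      then show ?thesis
        using trivial_eigenfunction_step(3,4)[OF L3(2)[OF x(1)] L3(1)[OF x(1)] triv[OF L3(2)[OF x(1)]] x(2,3) x(4,5,6,7)]
        by simp
    qed
    \<comment> \<open>The choice of the vertex is immaterial by \<open>h2\<close>, which rests on
      the degree-two part of \<open>trivial_eigenfunction_step\<close>.\<close>
    define H where "H x = h (SOME z. \<exists>r\<in>nbrs X x. nbrs X r = {x, z} \<and> z \<noteq> x)" for x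
    have H: "H x = h z" if x: "x \<in> L" "r \<in> nbrs X x" "nbrs X r = {x, z}" "z \<noteq> x" for x r z
    proof -
      have "\<exists>r\<in>nbrs X x. nbrs X r = {x, SOME z. \<exists>r\<in>nbrs X x. nbrs X r = {x, z} \<and> z \<noteq> x} \<and>
          (SOME z. \<exists>r\<in>nbrs X x. nbrs X r = {x, z} \<and> z \<noteq> x) \<noteq> x"
        by (rule someI_ex[of "\<lambda>z. \<exists>r\<in>nbrs X x. nbrs X r = {x, z} \<and> z \<noteq> x"]) (use x in blast)
      then obtain r' where "r' \<in> nbrs X x" "nbrs X r' = {x, SOME z. \<exists>r\<in>nbrs X x. nbrs X r = {x, z} \<and> z \<noteq> x}"
          "(SOME z. \<exists>r\<in>nbrs X x. nbrs X r = {x, z} \<and> z \<noteq> x) \<noteq> x" by blast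
      from h2[OF x(1) this(1) x(2) this(2) x(3) this(3) x(4)] show ?thesis by (simp add: H_def)
    qed
    have step: "z \<in> L \<and> nbrs X r = {x, z} \<and> h z = H x \<and> H z = h x"
      if x: "x \<in> L" "r \<in> nbrs X x" "z \<in> nbrs X r" "z \<noteq> x" for x r z
    proof -
      have r: "r \<in> R" "x \<in> nbrs X r" "z \<in> L" "r \<in> nbrs X z" using x nbrs_L nbrs_R nbrs_sym by blast+
      obtain z' where "nbrs X r = {x, z'}" using two[OF r(2,1)] by blast
      then have eq: "nbrs X r = {x, z}" using x by auto
      then have eq': "nbrs X r = {z, x}" by auto
      show ?thesis using H[OF x(1,2) eq x(4)] H[OF r(3,4) eq'] x(4) r(3) eq by auto
    qed
    show ?thesis
    proof (cases "switching A True")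
      case True
      have "if (z \<in> A) = (l \<in> A) then h z = h l \<and> H z = H l else h z = H l \<and> H z = h l" if "z \<in> L" for z
      proof (rule left_induct[OF ll(1) _ that])
        fix x r z
        assume x: "x \<in> L" "if (x \<in> A) = (l \<in> A) then h x = h l \<and> H x = H l else h x = H l \<and> H x = h l"
          "r \<in> nbrs X x" "z \<in> nbrs X r"
        show "if (z \<in> A) = (l \<in> A) then h z = h l \<and> H z = H l else h z = H l \<and> H z = h l"
        proof (cases "z = x")
          case False
          have "r \<in> R" "x \<in> nbrs X r" using x nbrs_L nbrs_sym by blast+
          then have "(z \<in> A) = (x \<notin> A)" using True x(4) False unfolding switching_def by blast
          then show ?thesis using step[OF x(1,3,4) False] x(2) by (auto split: if_splits)
        qed (use x in simp)
      qed simp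
      from this[OF ll(2)] show ?thesis using ll(3) by auto
    next
      case notA: False
      then have no: "\<not> has_left_transversal L R X" using A k1 by auto
      have two_vals: "h z = h l \<and> H z = H l \<or> h z = H l \<and> H z = h l" if "z \<in> L" for z
      proof (rule left_induct[OF ll(1) _ that])
        fix x r z
        assume x: "x \<in> L" "h x = h l \<and> H x = H l \<or> h x = H l \<and> H x = h l" "r \<in> nbrs X x" "z \<in> nbrs X r"
        show "h z = h l \<and> H z = H l \<or> h z = H l \<and> H z = h l"
          using step[OF x(1,3,4)] x(2) by (cases "z = x") auto
      qed simp
      have "h l = H l"
      proof (rule ccontr)
        assume ne: "h l \<noteq> H l"
        \<comment> \<open>The two neighbours of \<open>w\<close> carry the two distinct values
          \<open>h l\<close> and \<open>H l\<close>, one each.\<close>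
        have "\<exists>!v. v \<in> {x \<in> L. h x = h l} \<and> (w, v) \<in> parcs X" if w: "w \<in> R" for w
        proof -
          obtain x where x: "x \<in> nbrs X w" using nbrs_nonempty[of w] w verts_eq by blast
          then obtain z where z: "z \<noteq> x" "nbrs X w = {x, z}" using two w by blast
          have xL: "x \<in> L" "w \<in> nbrs X x" using x w nbrs_R nbrs_sym by blast+
          have st: "z \<in> L" "h z = H x" using step[OF xL, of z] z by auto
          have arc: "(w, v) \<in> parcs X \<longleftrightarrow> v = x \<or> v = z" for v using z(2) nbrs_iff[of v X w] by auto
          show ?thesis
          proof (cases "h x = h l")
            case True
            then have "h z \<noteq> h l" using two_vals[OF xL(1)] st ne by auto
            then show ?thesis using True xL(1) arc by (intro ex1I[of _ x]) auto
          next
            case False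
            then have "h z = h l" using two_vals[OF xL(1)] st by auto
            then show ?thesis using False st arc by (intro ex1I[of _ z]) auto
          qed
        qed
        then have "has_left_transversal L R X"
          unfolding has_left_transversal_def by (intro exI[of _ "{x \<in> L. h x = h l}"]) auto
        then show False using no by simp
      qed
      then show ?thesis using two_vals[OF ll(2)] by auto
    qed
  qed
  note hA = this
  obtain u v where uv: "e = (u, v)" "(u, v) \<in> parcs X" using e(1) by (cases e) auto
  obtain u' v' where uv': "e' = (u', v')" "(u', v') \<in> parcs X" using e(2) by (cases e') auto
  show ?thesis
  proof (cases "u \<in> L")
    case True
    then have "u' \<in> L" "(u \<in> A) = (u' \<in> A)"
      using e(3) uv uv' by (auto simp: block_def left_end_def split: if_splits)
    from hA[OF True this] show ?thesis
      using h_eq[OF True, of v] h_eq[OF \<open>u' \<in> L\<close>, of v'] uv uv' by (auto simp: nbrs_iff)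
  next
    case False
    then have "u' \<notin> L" "(v \<in> A) = (v' \<in> A)" using e(3) uv uv' by (auto simp: block_def left_end_def split: if_splits)
    moreover have "v \<in> L" "v' \<in> L" using False \<open>u' \<notin> L\<close> arc_cases[OF uv(2)] arc_cases[OF uv'(2)] by auto
    ultimately show ?thesis
      using hA[of v v'] h_eq[of v u] h_eq[of v' u'] uv uv' X_sym by (auto simp: nbrs_iff)
  qed
qed

section \<open>The norm bound on functions with zero block sums\<close>

lemma closed_zero_sum: "closed (zero_sum A)"
proof -
  have "zero_sum A = (\<Inter>e\<in>- parcs X. {f. f e = 0}) \<inter> (\<Inter>\<beta>. {f. (\<Sum>e\<in>arc_block A \<beta>. f e) = 0})"
    unfolding zero_sum_def by blast
  also have "closed \<dots>"
    by (intro closed_Int closed_INT ballI closed_Collect_eq continuous_intros continuous_on_product_coordinates)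
  finally show ?thesis .
qed

lemma sym_walk_linear: "sym_walk n (\<lambda>e. a * f e + g e) = (\<lambda>e. a * sym_walk n f e + sym_walk n g e)"
  using nb_pow_linear[of n X a "f \<circ> prod.swap" "g \<circ> prod.swap"]
  by (auto simp: sym_walk_def nb_rev_def comp_def fun_eq_iff)

lemma continuous_sym_walk: "continuous_on UNIV (\<lambda>f. sym_walk n f e)"
proof -
  have "continuous_on UNIV (\<lambda>f :: _ \<Rightarrow> real. (nb_sum X ^^ n) (f \<circ> prod.swap) e)" for e
    by (induction n arbitrary: e) (auto simp: nb_sum_def intro!: continuous_intros)
  then show ?thesis by (cases "e \<in> parcs X") (simp_all add: sym_walk_def nb_rev_def)
qed

text \<open>If the bound failed, some eigenvalue on \<open>zero_sum A\<close> would exceed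
  \<open>tree_bound n\<close> in modulus and so lie outside the spectrum on the tree. By the
  Ramanujan property its eigenfunction is then trivial for every base point, hence constant on
  blocks; having zero block sums, it vanishes.\<close>

lemma sym_walk_bound:
  assumes ram: "ramanujan X" and sw: "switching A s"
    and A: "A = L \<and> (2 \<le> k \<or> \<not> has_left_transversal L R X) \<or> k = 1 \<and> switching A True"
    and f: "f \<in> zero_sum A"
  shows "(\<Sum>e\<in>parcs X. (sym_walk n f e)\<^sup>2) \<le> (tree_bound n)\<^sup>2 * (\<Sum>e\<in>parcs X. (f e)\<^sup>2)"
proof (rule ccontr)
  assume "\<not> ?thesis"
  then have less: "(tree_bound n)\<^sup>2 * (\<Sum>e\<in>parcs X. (f e)\<^sup>2) < (\<Sum>e\<in>parcs X. (sym_walk n f e)\<^sup>2)" by simp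
  have "\<exists>g\<in>zero_sum A. \<exists>\<mu>. (\<exists>e\<in>parcs X. g e \<noteq> 0) \<and> sym_walk n g = (\<lambda>e. \<mu> * g e) \<and> tree_bound n < \<bar>\<mu>\<bar>"
  proof (rule symmetric_operator_eigenvector[OF finite_E closed_zero_sum _ _ sym_walk_zero_sum[OF sw] sym_walk_linear
        continuous_sym_walk sym_walk_sym f tree_bound_nonneg less])
    show "(\<lambda>e. a * f e + g e) \<in> zero_sum A" if "f \<in> zero_sum A" "g \<in> zero_sum A" for a f g
      using that by (simp add: zero_sum_def sum.distrib flip: sum_distrib_left)
    show "f e = 0" if "f \<in> zero_sum A" "e \<notin> parcs X" for f e using that unfolding zero_sum_def by blast
  qed
  then obtain g \<mu> where g: "g \<in> zero_sum A" "\<exists>e\<in>parcs X. g e \<noteq> 0" "sym_walk n g = (\<lambda>e. \<mu> * g e)"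
    "tree_bound n < \<bar>\<mu>\<bar>" by blast
  define gc :: "'a cell \<Rightarrow> complex" where
    "gc x = (case x of Arc e \<Rightarrow> of_real (g e) | Vertex _ \<Rightarrow> 0)" for x
  have triv: "trivial_eigenfunction X x\<^sub>0 (Arc ` parcs (tree x\<^sub>0)) gc" if x\<^sub>0: "x\<^sub>0 \<in> pverts X" for x\<^sub>0
  proof (rule ccontr)
    assume nt: "\<not> trivial_eigenfunction X x\<^sub>0 (Arc ` parcs (tree x\<^sub>0)) gc"
    let ?C = "Arc ` parcs (tree x\<^sub>0)" and ?T = "nb_rev_op (tree x\<^sub>0) n"
    have "descent ?C ?T gc y = of_real \<mu> * gc y" if y: "y \<in> cover_map ` ?C" for y
    proof -
      obtain e where e: "y = Arc e" "e \<in> parcs X" using y unfolding cover_image[OF x\<^sub>0] by blast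
      have inv: "inv_into ?C cover_map y \<in> ?C" "cover_map (inv_into ?C cover_map y) = y"
        using y by (auto intro: inv_into_into f_inv_into_f)
      \<comment> \<open>Every lift of the arc gives the same value, computed on X through the local
        isomorphism.\<close>
      have "descent ?C ?T gc y = nb_rev_op X n gc y"
        unfolding descent_def
        using nb_rev_op_local_iso[OF covering_tree_sym_graph cover_local_iso inv(1), of n gc] inv(2) by simp
      also have "\<dots> = of_real (sym_walk n g e)"
        using e by (simp add: nb_rev_op_def sym_walk_def gc_def of_real_nb_rev)
      also have "\<dots> = of_real \<mu> * gc y" unfolding g(3) using e by (simp add: gc_def)
      finally show ?thesis .
    qed
    moreover have "\<exists>y\<in>cover_map ` ?C. gc y \<noteq> 0"
      unfolding cover_image[OF x\<^sub>0] using g(2) by (auto simp: gc_def)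
    ultimately have "eigenfunction ?C ?T (of_real \<mu>) gc" unfolding eigenfunction_def by blast
    then have "of_real \<mu> \<in> l2_spectrum ?C ?T"
      using ram x\<^sub>0 nt nb_rev_op_geometric[OF covering_tree_sym_graph, of x\<^sub>0 n]
      unfolding ramanujan_def by blast
    then show False using not_in_tree_spectrum[of n "of_real \<mu>" x\<^sub>0] g(4) by simp
  qed
  obtain e where e: "e \<in> parcs X" "g e \<noteq> 0" using g(2) by blast
  have "g e' = g e" if "e' \<in> arc_block A (block A e)" for e'
    using trivial_blocks[OF triv A, of e' e] that e by (simp add: arc_block_def gc_def)
  then have "(\<Sum>e'\<in>arc_block A (block A e). g e') = real (card (arc_block A (block A e))) * g e"
    by (simp add: sum.cong)
  moreover have "(\<Sum>e'\<in>arc_block A (block A e). g e') = 0" using g(1) unfolding zero_sum_def by blast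
  moreover have "card (arc_block A (block A e)) \<noteq> 0"
  proof -
    have "e \<in> arc_block A (block A e)" using e by (simp add: arc_block_def)
    then show ?thesis using finite_arc_block[of A "block A e"] by auto
  qed
  ultimately show False using e(2) by simp
qed

end

section \<open>Mixing of the non-backtracking walk\<close>

lemma tv_dist_finite:
  assumes "finite S" "set_pmf p \<subseteq> S" "set_pmf q \<subseteq> S"
  shows "tv_dist p q = (1/2) * (\<Sum>x\<in>S. \<bar>pmf p x - pmf q x\<bar>)"
proof -
  have "(\<Sum>\<^sub>\<infinity>x. \<bar>pmf p x - pmf q x\<bar>) = (\<Sum>\<^sub>\<infinity>x\<in>S. \<bar>pmf p x - pmf q x\<bar>)"
  proof (rule infsum_cong_neutral)
    fix x assume "x \<in> UNIV - S"
    then have "x \<notin> set_pmf p" "x \<notin> set_pmf q" using assms by auto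
    then show "\<bar>pmf p x - pmf q x\<bar> = 0" by (simp add: set_pmf_iff)
  qed auto
  then show ?thesis using assms(1) by (simp add: tv_dist_def)
qed

context regular_bigraph
begin

text \<open>The number of non-backtracking continuations of length n, where \<open>b\<close> tells
  whether the walk starts on the left. After n steps the current arc starts on the left iff
  \<open>even n = b\<close>, and then its right head offers k continuations.\<close>

primrec branch_prod :: "bool \<Rightarrow> nat \<Rightarrow> nat" where
  "branch_prod b 0 = 1"
| "branch_prod b (Suc n) = branch_prod b n * (if even n = b then k else K)"

lemma branch_prod_even: "branch_prod b (2 * t) = (K * k) ^ t"
  by (induction t) (auto simp: mult.commute mult.left_commute)

section \<open>Support and law of the walk\<close>

lemma succ_nonempty: "e \<in> parcs X \<Longrightarrow> nb_successors X e \<noteq> {}"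
  using card_succ[of e] k_pos k_less by (auto split: if_splits)

lemma walk_support:
  assumes "e\<^sub>0 \<in> parcs X" "e \<in> set_pmf (nb_walk_pmf X e\<^sub>0 n)"
  shows "e \<in> parcs X \<and> (fst e \<in> L) = (even n = (fst e\<^sub>0 \<in> L))"
  using assms(2)
proof (induction n arbitrary: e)
  case 0
  then show ?case using assms(1) by simp
next
  case (Suc n)
  then obtain e' where e': "e' \<in> set_pmf (nb_walk_pmf X e\<^sub>0 n)" "e \<in> set_pmf (pmf_of_set (nb_successors X e'))"
    by auto
  note IH = Suc.IH[OF e'(1)]
  then have s: "e \<in> nb_successors X e'"
    using e'(2) set_pmf_of_set[OF succ_nonempty finite_nb_successors] by blast
  then have "e \<in> parcs X" "fst e = snd e'" using nb_successors_subset by (blast, auto simp: nb_successors_def)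
  then show ?case using IH arc_cases[of "fst e'" "snd e'"] by auto
qed

text \<open>At a given time all arcs of the support point the same way and have equally many
  successors, so a step multiplies the cardinality by at most that number.\<close>

lemma walk_support_card:
  assumes e\<^sub>0: "e\<^sub>0 \<in> parcs X"
  shows "card (set_pmf (nb_walk_pmf X e\<^sub>0 n)) \<le> branch_prod (fst e\<^sub>0 \<in> L) n"
proof (induction n)
  case (Suc n)
  let ?S = "set_pmf (nb_walk_pmf X e\<^sub>0 n)"
  have fin: "finite ?S" using finite_subset[OF _ finite_E] walk_support[OF e\<^sub>0] by blast
  have "set_pmf (nb_walk_pmf X e\<^sub>0 (Suc n)) = (\<Union>e\<in>?S. nb_successors X e)"
    using walk_support[OF e\<^sub>0] set_pmf_of_set[OF succ_nonempty finite_nb_successors] by auto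
  then have "card (set_pmf (nb_walk_pmf X e\<^sub>0 (Suc n))) \<le> (\<Sum>e\<in>?S. card (nb_successors X e))"
    using card_UN_le[OF fin] by simp
  also have "\<dots> = (\<Sum>e\<in>?S. if even n = (fst e\<^sub>0 \<in> L) then k else K)"
    by (intro sum.cong refl) (use walk_support[OF e\<^sub>0] card_succ in auto)
  also have "\<dots> \<le> branch_prod (fst e\<^sub>0 \<in> L) n * (if even n = (fst e\<^sub>0 \<in> L) then k else K)"
    using Suc.IH by simp
  finally show ?case by simp
qed simp

text \<open>As all arcs of the support have equally many successors, the probability is a number of
  walks divided by \<open>branch_prod\<close>. Distributions evolve by the adjoint of the walk,
  which is why the reversed arc appears.\<close>

lemma walk_eq_sym_walk:
  assumes e\<^sub>0: "e\<^sub>0 \<in> parcs X" and e: "e \<in> parcs X"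
  shows "real (branch_prod (fst e\<^sub>0 \<in> L) n) * pmf (nb_walk_pmf X e\<^sub>0 n) e
    = sym_walk n (\<lambda>e. if e = e\<^sub>0 then 1 else 0) (prod.swap e)"
proof -
  define \<delta> where "\<delta> = (\<lambda>e. if e = e\<^sub>0 then 1 else 0 :: real) \<circ> prod.swap"
  let ?b = "branch_prod (fst e\<^sub>0 \<in> L)" and ?p = "\<lambda>n. nb_walk_pmf X e\<^sub>0 n"
  have "real (?b n) * pmf (?p n) e = (nb_sum X ^^ n) \<delta> (prod.swap e)"
    using e
  proof (induction n arbitrary: e)
    case 0
    then show ?case by (auto simp: indicator_def \<delta>_def)
  next
    case (Suc n)
    let ?c = "if even n = (fst e\<^sub>0 \<in> L) then k else K"
    have c0: "0 < real ?c" using k_pos k_less by auto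
    have se: "prod.swap e \<in> parcs X" using Suc.prems swap_arcs by blast
    have "pmf (?p (Suc n)) e = (\<Sum>x\<in>parcs X. pmf (?p n) x *\<^sub>R pmf (pmf_of_set (nb_successors X x)) e)"
      unfolding nb_walk_pmf.simps pmf_bind
      by (rule integral_measure_pmf[OF finite_E]) (use walk_support[OF e\<^sub>0] in blast)
    also have "\<dots> = (\<Sum>x\<in>parcs X. if e \<in> nb_successors X x then pmf (?p n) x / ?c else 0)"
    proof (rule sum.cong[OF refl])
      fix x assume x: "x \<in> parcs X"
      show "pmf (?p n) x *\<^sub>R pmf (pmf_of_set (nb_successors X x)) e
          = (if e \<in> nb_successors X x then pmf (?p n) x / ?c else 0)"
      proof (cases "x \<in> set_pmf (?p n)")
        case True
        then have "card (nb_successors X x) = ?c" using walk_support[OF e\<^sub>0 True] card_succ[OF x] by auto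
        then show ?thesis by (simp add: pmf_of_set[OF succ_nonempty[OF x] finite_nb_successors] indicator_def)
      qed (simp add: set_pmf_iff)
    qed
    also have "\<dots> = (\<Sum>x\<in>{x \<in> parcs X. e \<in> nb_successors X x}. pmf (?p n) x / ?c)"
      using finite_E by (simp add: sum.inter_filter)
    finally have "real (?b (Suc n)) * pmf (?p (Suc n)) e
        = (\<Sum>x\<in>{x \<in> parcs X. e \<in> nb_successors X x}. real (?b n) * pmf (?p n) x)"
      using c0 by (simp add: sum_distrib_left)
    also have "\<dots> = (\<Sum>x\<in>nb_successors X (prod.swap e). real (?b n) * pmf (?p n) (prod.swap x))"
      unfolding pred_eq[OF Suc.prems] by (subst sum.reindex) (auto simp: inj_on_def)
    also have "\<dots> = (\<Sum>x\<in>nb_successors X (prod.swap e). (nb_sum X ^^ n) \<delta> x)"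
    proof (rule sum.cong[OF refl])
      fix x assume "x \<in> nb_successors X (prod.swap e)"
      then have "prod.swap x \<in> parcs X" using nb_successors_subset swap_arcs by blast
      then show "real (?b n) * pmf (?p n) (prod.swap x) = (nb_sum X ^^ n) \<delta> x"
        by (rule Suc.IH[of "prod.swap x", unfolded swap_swap])
    qed
    finally show ?case
      by (simp only: funpow.simps comp_apply nb_sum_def[of X "(nb_sum X ^^ n) \<delta>" "prod.swap e"])
  qed
  moreover have "prod.swap e \<in> parcs X" using e swap_arcs by blast
  ultimately show ?thesis by (simp add: sym_walk_def nb_rev_def \<delta>_def)
qed

text \<open>In 2 t steps the walk crosses t right vertices, and each crossing switches the block
  when \<open>s\<close> holds.\<close>

definition shift_block :: "bool \<Rightarrow> nat \<Rightarrow> bool \<times> bool \<Rightarrow> bool \<times> bool" where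
  "shift_block s t \<beta> = (fst \<beta>, snd \<beta> \<noteq> (s \<and> odd t))"

lemma nb_pow_block:
  assumes A: "switching A s" and e: "e \<in> parcs X"
  shows "(nb_sum X ^^ (2 * t)) (\<lambda>e. \<phi> (block A e)) e = real (K * k) ^ t * \<phi> (shift_block s t (block A e))"
  using e
proof (induction t arbitrary: e)
  case 0
  then show ?case by (simp add: shift_block_def)
next
  case (Suc t)
  let ?\<psi> = "\<lambda>\<beta>. real (K * k) ^ t * \<phi> (shift_block s t \<beta>)"
  let ?\<chi> = "\<lambda>\<beta>. (if fst \<beta> then real k else real K) * ?\<psi> (next_block s \<beta>)"
  have "(nb_sum X ^^ (2 * Suc t)) (\<lambda>e. \<phi> (block A e)) e
      = nb_sum X (nb_sum X ((nb_sum X ^^ (2 * t)) (\<lambda>e. \<phi> (block A e)))) e"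
    by simp
  also have "\<dots> = nb_sum X (nb_sum X (\<lambda>e. ?\<psi> (block A e))) e"
    by (intro nb_sum_cong Suc.IH)
  also have "\<dots> = nb_sum X (\<lambda>e. ?\<chi> (block A e)) e"
    by (rule nb_sum_cong) (subst nb_sum_block[OF A], simp_all add: block_def)
  also have "\<dots> = (if fst e \<in> L then real k else real K) * ?\<chi> (next_block s (block A e))"
    by (rule nb_sum_block[OF A Suc.prems])
  also have "\<dots> = real (K * k) ^ Suc t * \<phi> (shift_block s (Suc t) (block A e))"
  proof -
    have "shift_block s t (next_block s (next_block s \<beta>)) = shift_block s (Suc t) \<beta>"
      "fst (next_block s \<beta>) = (\<not> fst \<beta>)" for \<beta>
      by (auto simp: shift_block_def next_block_def)
    moreover have "fst (block A e) = (fst e \<in> L)" by (simp add: block_def)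
    ultimately show ?thesis by (cases "fst e \<in> L") simp_all
  qed
  finally show ?case .
qed

text \<open>At time \<open>2 t\<close> the walk is confined to a single block, over which it equidistributes.\<close>

definition limit_mass :: "'a set \<Rightarrow> bool \<Rightarrow> 'a \<times> 'a \<Rightarrow> nat \<Rightarrow> 'a \<times> 'a \<Rightarrow> real" where
  "limit_mass A s e\<^sub>0 t e =
     (if shift_block s t (block A e) = block A e\<^sub>0 then 1 / real (card (arc_block A (block A e\<^sub>0))) else 0)"

text \<open>The point mass minus the uniform mass on its block lies in \<open>zero_sum A\<close> and
  has norm at most 1. The uniform part is carried exactly to \<open>(K * k) ^ t\<close> times
  \<open>limit_mass\<close>, up to reversal, so the bound for the difference is
  \<open>sym_walk_bound\<close>.\<close>

lemma walk_l2_bound: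
  assumes ram: "ramanujan X" and sw: "switching A s"
    and A: "A = L \<and> (2 \<le> k \<or> \<not> has_left_transversal L R X) \<or> k = 1 \<and> switching A True"
    and e\<^sub>0: "e\<^sub>0 \<in> parcs X"
  shows "(\<Sum>e\<in>parcs X. (pmf (nb_walk_pmf X e\<^sub>0 (2 * t)) e - limit_mass A s e\<^sub>0 t e)\<^sup>2)
    \<le> (tree_bound (2 * t) / real (K * k) ^ t)\<^sup>2"
proof -
  let ?\<beta> = "block A e\<^sub>0" and ?Q = "real (K * k) ^ t"
  let ?B = "arc_block A ?\<beta>"
  let ?\<delta> = "\<lambda>e. if e = e\<^sub>0 then 1 else 0 :: real"
  let ?c = "real (card ?B)"
  define u where "u e = (if e \<in> ?B then 1 / ?c else 0)" for e
  define f where "f e = - 1 * u e + ?\<delta> e" for e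
  have eB: "e\<^sub>0 \<in> ?B" using e\<^sub>0 by (simp add: arc_block_def)
  then have c: "1 \<le> ?c" using finite_arc_block[of A ?\<beta>] by (simp add: Suc_le_eq card_gt_0_iff) blast
  have Bsub: "?B \<subseteq> parcs X" by (auto simp: arc_block_def)
  have fV: "f \<in> zero_sum A"
    unfolding zero_sum_def
  proof (intro CollectI conjI allI impI)
    show "f e = 0" if "e \<notin> parcs X" for e using that e\<^sub>0 Bsub by (auto simp: f_def u_def)
    fix \<beta>
    show "(\<Sum>e\<in>arc_block A \<beta>. f e) = 0"
    proof (cases "\<beta> = ?\<beta>")
      case True
      have "(\<Sum>e\<in>?B. u e) = 1" using c by (simp add: u_def)
      moreover have "(\<Sum>e\<in>?B. ?\<delta> e) = 1" using eB finite_arc_block by simp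
      ultimately show ?thesis unfolding True f_def sum.distrib by (simp add: sum_negf)
    next
      case False
      then show ?thesis by (intro sum.neutral) (auto simp: f_def u_def arc_block_def)
    qed
  qed
  have f1: "(\<Sum>e\<in>parcs X. (f e)\<^sup>2) \<le> 1"
  proof -
    \<comment> \<open>The cross term lives only at \<open>e\<^sub>0\<close>, where \<open>u\<close>
      equals \<open>1 / ?c\<close>; altogether the squared norm is 1 - 1 /
      \<open>?c\<close>.\<close>
    have "(\<Sum>e\<in>parcs X. (f e)\<^sup>2) = (\<Sum>e\<in>parcs X. (u e)\<^sup>2 + (1 - 2 / ?c) * ?\<delta> e)"
      using eB by (intro sum.cong) (auto simp: f_def u_def power2_eq_square algebra_simps)
    also have "\<dots> = (\<Sum>e\<in>parcs X. (u e)\<^sup>2) + (1 - 2 / ?c)"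
      using e\<^sub>0 finite_E by (simp add: sum.distrib flip: sum_distrib_left)
    also have "(\<Sum>e\<in>parcs X. (u e)\<^sup>2) = (\<Sum>e\<in>?B. (1 / ?c)\<^sup>2)"
      by (rule sum.mono_neutral_cong_right) (use Bsub finite_E in \<open>auto simp: u_def\<close>)
    also have "\<dots> = 1 / ?c" using c by (simp add: power2_eq_square)
    finally have "(\<Sum>e\<in>parcs X. (f e)\<^sup>2) = 1 / ?c + (1 - 2 / ?c)" .
    moreover have "2 / ?c = 2 * (1 / ?c)" "0 \<le> 1 / ?c" by simp_all
    ultimately show ?thesis by linarith
  qed
  have Tu: "sym_walk (2 * t) u (prod.swap e) = ?Q * limit_mass A s e\<^sub>0 t e" if e: "e \<in> parcs X" for e
  proof -
    have se: "prod.swap e \<in> parcs X" using e swap_arcs by blast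
    have ff: "flip (flip \<beta>) = \<beta>" "shift_block s t (flip \<beta>) = flip (shift_block s t \<beta>)" for \<beta>
      by (cases \<beta>; simp add: flip_def shift_block_def)+
    let ?\<phi> = "\<lambda>\<beta>. if flip \<beta> = ?\<beta> then 1 / ?c else 0"
    have "sym_walk (2 * t) u (prod.swap e) = (nb_sum X ^^ (2 * t)) (u \<circ> prod.swap) (prod.swap e)"
      using se by (simp add: sym_walk_def nb_rev_def)
    also have "\<dots> = (nb_sum X ^^ (2 * t)) (\<lambda>e. ?\<phi> (block A e)) (prod.swap e)"
    proof (rule nb_pow_cong[OF _ se])
      fix x assume x: "x \<in> parcs X"
      then have "prod.swap x \<in> parcs X" using swap_arcs by blast
      then show "(u \<circ> prod.swap) x = ?\<phi> (block A x)" using block_swap[OF x, of A] by (simp add: u_def arc_block_def)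
    qed
    also have "\<dots> = ?Q * ?\<phi> (shift_block s t (block A (prod.swap e)))" by (rule nb_pow_block[OF sw se])
    also have "\<dots> = ?Q * limit_mass A s e\<^sub>0 t e"
      unfolding block_swap[OF e] ff limit_mass_def by simp
    finally show ?thesis .
  qed
  have Q: "0 < ?Q" using k_pos k_less by simp
  have key: "sym_walk (2 * t) f (prod.swap e) = ?Q * (pmf (nb_walk_pmf X e\<^sub>0 (2 * t)) e - limit_mass A s e\<^sub>0 t e)"
    if e: "e \<in> parcs X" for e
  proof -
    have "sym_walk (2 * t) f (prod.swap e) = - 1 * sym_walk (2 * t) u (prod.swap e) + sym_walk (2 * t) ?\<delta> (prod.swap e)"
      unfolding f_def by (subst sym_walk_linear) simp
    then show ?thesis
      using walk_eq_sym_walk[OF e\<^sub>0 e, of "2 * t"] Tu[OF e] unfolding branch_prod_even by (simp add: algebra_simps)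
  qed
  have "?Q\<^sup>2 * (\<Sum>e\<in>parcs X. (pmf (nb_walk_pmf X e\<^sub>0 (2 * t)) e - limit_mass A s e\<^sub>0 t e)\<^sup>2)
      = (\<Sum>e\<in>parcs X. (sym_walk (2 * t) f (prod.swap e))\<^sup>2)"
    using key by (simp add: sum_distrib_left power_mult_distrib)
  also have "\<dots> = (\<Sum>e\<in>parcs X. (sym_walk (2 * t) f e)\<^sup>2)" by (rule sum_swap)
  also have "\<dots> \<le> (tree_bound (2 * t))\<^sup>2 * (\<Sum>e\<in>parcs X. (f e)\<^sup>2)" by (rule sym_walk_bound[OF ram sw A fV])
  also have "\<dots> \<le> (tree_bound (2 * t))\<^sup>2 * 1" by (intro mult_left_mono f1) simp
  finally have "(\<Sum>e\<in>parcs X. (pmf (nb_walk_pmf X e\<^sub>0 (2 * t)) e - limit_mass A s e\<^sub>0 t e)\<^sup>2) * ?Q\<^sup>2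
      \<le> (tree_bound (2 * t))\<^sup>2" by (simp only: mult_1_right mult.commute)
  moreover have "0 < ?Q\<^sup>2" using Q by (rule zero_less_power)
  ultimately show ?thesis by (simp only: power_divide pos_le_divide_eq)
qed

section \<open>Distance to the uniform distribution\<close>

lemma arcs_LR: "arcs_between L R X = {e \<in> parcs X. fst e \<in> L}"
  and arcs_RL: "arcs_between R L X = {e \<in> parcs X. fst e \<notin> L}"
  unfolding arcs_between_def by (auto dest: arc_cases)

lemma card_RL: "card (arcs_between R L X) = card (arcs_between L R X)"
proof -
  have "arcs_between R L X = prod.swap ` arcs_between L R X"
    unfolding arcs_between_def using X_sym by force
  then show ?thesis by (simp add: card_image)
qed

lemma card_E: "card (parcs X) = 2 * card (arcs_between L R X)"
proof -
  have "parcs X = arcs_between L R X \<union> arcs_between R L X" unfolding arcs_LR arcs_RL by blast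
  moreover have "arcs_between L R X \<inter> arcs_between R L X = {}" unfolding arcs_LR arcs_RL by blast
  moreover have "finite (arcs_between L R X)" "finite (arcs_between R L X)"
    using finite_E by (auto simp: arcs_between_def)
  ultimately have "card (parcs X) = card (arcs_between L R X) + card (arcs_between R L X)"
    by (metis card_Un_disjoint)
  then show ?thesis using card_RL by simp
qed

lemma pmf_uniform:
  assumes e\<^sub>0: "e\<^sub>0 \<in> parcs X"
  shows "pmf (uniform_pmf L R X e\<^sub>0) e =
    (if e \<in> parcs X \<and> (fst e \<in> L) = (fst e\<^sub>0 \<in> L) then 1 / real (card (arcs_between L R X)) else 0)"
    and "set_pmf (uniform_pmf L R X e\<^sub>0) \<subseteq> parcs X"
proof -
  let ?S = "if e\<^sub>0 \<in> arcs_between L R X then arcs_between L R X else arcs_between R L X"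
  have "e\<^sub>0 \<in> ?S" using e\<^sub>0 unfolding arcs_LR arcs_RL by simp
  then have S: "?S \<noteq> {}" "finite ?S"
    using finite_E unfolding arcs_LR arcs_RL by (blast, simp)
  have c: "card ?S = card (arcs_between L R X)" using card_RL by simp
  have "pmf (uniform_pmf L R X e\<^sub>0) e = indicator ?S e / card ?S"
    unfolding uniform_pmf_def by (rule pmf_of_set[OF S])
  then show "pmf (uniform_pmf L R X e\<^sub>0) e =
    (if e \<in> parcs X \<and> (fst e \<in> L) = (fst e\<^sub>0 \<in> L) then 1 / real (card (arcs_between L R X)) else 0)"
    unfolding c using e\<^sub>0 by (auto simp: arcs_LR arcs_RL)
  show "set_pmf (uniform_pmf L R X e\<^sub>0) \<subseteq> parcs X"
    unfolding uniform_pmf_def set_pmf_of_set[OF S] by (auto simp: arcs_LR arcs_RL)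
qed

lemma tv_walk:
  assumes e\<^sub>0: "e\<^sub>0 \<in> parcs X"
  shows "tv_dist (nb_walk_pmf X e\<^sub>0 n) (uniform_pmf L R X e\<^sub>0) =
    (1/2) * (\<Sum>e\<in>parcs X. \<bar>pmf (nb_walk_pmf X e\<^sub>0 n) e - pmf (uniform_pmf L R X e\<^sub>0) e\<bar>)"
  by (rule tv_dist_finite[OF finite_E _ pmf_uniform(2)[OF e\<^sub>0]]) (use walk_support[OF e\<^sub>0] in blast)

text \<open>The walk sits on at most \<open>(K * k) ^ t\<close> arcs. If m is their uniform mass,
  the support and its complement each contribute at least 1 - m to the l1 distance.\<close>

lemma tv_lower_bound:
  assumes e\<^sub>0: "e\<^sub>0 \<in> parcs X"
  shows "1 - real (K * k) ^ t / real (card (arcs_between L R X))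
    \<le> tv_dist (nb_walk_pmf X e\<^sub>0 (2 * t)) (uniform_pmf L R X e\<^sub>0)"
proof -
  let ?p = "nb_walk_pmf X e\<^sub>0 (2 * t)" and ?u = "uniform_pmf L R X e\<^sub>0" and ?N = "card (arcs_between L R X)"
  let ?S = "set_pmf ?p"
  have sub: "?S \<subseteq> parcs X" using walk_support[OF e\<^sub>0] by blast
  have fin: "finite ?S" using finite_subset[OF sub finite_E] .
  have pS: "(\<Sum>e\<in>?S. pmf ?p e) = 1" by (rule sum_pmf_eq_1[OF fin]) simp
  have uE: "(\<Sum>e\<in>parcs X. pmf ?u e) = 1" by (rule sum_pmf_eq_1[OF finite_E pmf_uniform(2)[OF e\<^sub>0]])
  have "(\<Sum>e\<in>?S. pmf ?u e) \<le> (\<Sum>e\<in>?S. 1 / real ?N)"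
    by (intro sum_mono) (simp add: pmf_uniform(1)[OF e\<^sub>0])
  also have "\<dots> = real (card ?S) / real ?N" by simp
  also have "\<dots> \<le> real ((K * k) ^ t) / real ?N"
    using walk_support_card[OF e\<^sub>0, of "2 * t"] unfolding branch_prod_even
    by (intro divide_right_mono) (simp_all only: of_nat_le_iff of_nat_0_le_iff)
  finally have uS: "(\<Sum>e\<in>?S. pmf ?u e) \<le> real (K * k) ^ t / real ?N" by simp
  have "(\<Sum>e\<in>parcs X. \<bar>pmf ?p e - pmf ?u e\<bar>)
      = (\<Sum>e\<in>?S. \<bar>pmf ?p e - pmf ?u e\<bar>) + (\<Sum>e\<in>parcs X - ?S. \<bar>pmf ?p e - pmf ?u e\<bar>)"
    using sum.subset_diff[OF sub finite_E] by (simp add: add.commute)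
  moreover have "(\<Sum>e\<in>?S. pmf ?p e - pmf ?u e) \<le> (\<Sum>e\<in>?S. \<bar>pmf ?p e - pmf ?u e\<bar>)"
    by (intro sum_mono) simp
  moreover have "(\<Sum>e\<in>parcs X - ?S. \<bar>pmf ?p e - pmf ?u e\<bar>) = (\<Sum>e\<in>parcs X - ?S. pmf ?u e)"
    by (intro sum.cong) (auto simp: set_pmf_iff)
  moreover have "(\<Sum>e\<in>parcs X - ?S. pmf ?u e) = 1 - (\<Sum>e\<in>?S. pmf ?u e)"
    using sum.subset_diff[OF sub finite_E, of "pmf ?u"] uE by simp
  ultimately have "2 - 2 * (\<Sum>e\<in>?S. pmf ?u e) \<le> (\<Sum>e\<in>parcs X. \<bar>pmf ?p e - pmf ?u e\<bar>)"
    using pS by (simp add: sum_subtractf)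
  then show ?thesis unfolding tv_walk[OF e\<^sub>0] using uS by linarith
qed

text \<open>Cauchy--Schwarz over all arcs, twice as many as those from \<open>L\<close> to
  \<open>R\<close>, turns the l2 bound into an l1 bound. The factor 1/2 of total variation is kept
  for \<eta>, the l1 distance from the limit to uniform, and dropped for the other term.\<close>

lemma tv_upper_bound_aux:
  assumes ram: "ramanujan X" and sw: "switching A s"
    and A: "A = L \<and> (2 \<le> k \<or> \<not> has_left_transversal L R X) \<or> k = 1 \<and> switching A True"
    and e\<^sub>0: "e\<^sub>0 \<in> parcs X"
    and \<nu>: "(\<Sum>e\<in>parcs X. \<bar>limit_mass A s e\<^sub>0 t e - pmf (uniform_pmf L R X e\<^sub>0) e\<bar>) \<le> \<eta>"
  shows "tv_dist (nb_walk_pmf X e\<^sub>0 (2 * t)) (uniform_pmf L R X e\<^sub>0)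
    \<le> \<eta> / 2 + sqrt (2 * real (card (arcs_between L R X))) * tree_bound (2 * t) / real (K * k) ^ t"
proof -
  let ?p = "pmf (nb_walk_pmf X e\<^sub>0 (2 * t))" and ?u = "pmf (uniform_pmf L R X e\<^sub>0)"
  let ?\<nu> = "limit_mass A s e\<^sub>0 t" and ?B = "tree_bound (2 * t) / real (K * k) ^ t"
  have B: "0 \<le> ?B" using tree_bound_nonneg by simp
  have "(\<Sum>e\<in>parcs X. \<bar>?p e - ?\<nu> e\<bar>)\<^sup>2 \<le> (\<Sum>e\<in>parcs X. 1\<^sup>2) * (\<Sum>e\<in>parcs X. \<bar>?p e - ?\<nu> e\<bar>\<^sup>2)"
    using Cauchy_Schwarz_ineq_sum[of "\<lambda>_. 1" "\<lambda>e. \<bar>?p e - ?\<nu> e\<bar>" "parcs X"] by simp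
  also have "\<dots> \<le> real (card (parcs X)) * ?B\<^sup>2"
    using walk_l2_bound[OF ram sw A e\<^sub>0, of t] by (simp add: mult_left_mono)
  finally have "(\<Sum>e\<in>parcs X. \<bar>?p e - ?\<nu> e\<bar>) \<le> sqrt (real (card (parcs X)) * ?B\<^sup>2)"
    by (rule real_le_rsqrt)
  also have "\<dots> = sqrt (2 * real (card (arcs_between L R X))) * ?B"
    using B unfolding card_E of_nat_mult by (simp only: real_sqrt_mult real_sqrt_abs abs_of_nonneg) simp
  finally have 1: "(\<Sum>e\<in>parcs X. \<bar>?p e - ?\<nu> e\<bar>) \<le> sqrt (2 * real (card (arcs_between L R X))) * ?B" .
  have "(\<Sum>e\<in>parcs X. \<bar>?p e - ?u e\<bar>) \<le> (\<Sum>e\<in>parcs X. \<bar>?p e - ?\<nu> e\<bar> + \<bar>?\<nu> e - ?u e\<bar>)"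
    by (intro sum_mono) linarith
  also have "\<dots> \<le> sqrt (2 * real (card (arcs_between L R X))) * ?B + \<eta>"
    using 1 \<nu> by (simp add: sum.distrib)
  moreover have "0 \<le> sqrt (2 * real (card (arcs_between L R X))) * ?B"
    by (intro mult_nonneg_nonneg B) simp
  ultimately show ?thesis unfolding tv_walk[OF e\<^sub>0] by (simp add: field_simps)
qed

text \<open>Exactly one of the two neighbours of a right vertex lies in \<open>A\<close>, so
  \<open>snd\<close> maps each block of arcs starting in \<open>L\<close> bijectively onto
  \<open>R\<close>; reversal handles the other two blocks.\<close>

lemma card_arc_block_switching:
  assumes k1: "k = 1" and sw: "switching A True"
  shows "2 * card (arc_block A \<beta>) = card (arcs_between L R X)"
proof -
  have cR: "card (arc_block A (True, x)) = card R" for x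
  proof -
    have "bij_betw snd (arc_block A (True, x)) R"
      unfolding bij_betw_def
    proof
      show "inj_on snd (arc_block A (True, x))"
      proof (rule inj_onI)
        fix e e' assume e: "e \<in> arc_block A (True, x)" "e' \<in> arc_block A (True, x)" "snd e = snd e'"
        then have m: "(fst e, snd e) \<in> parcs X" "(fst e', snd e) \<in> parcs X" "(fst e \<in> A) = (fst e' \<in> A)" "fst e \<in> L"
          by (cases e; cases e'; auto simp: arc_block_def block_def left_end_def)+
        then have "snd e \<in> R" "fst e \<in> nbrs X (snd e)" "fst e' \<in> nbrs X (snd e)"
          using arc_cases[OF m(1)] X_sym by (auto simp: nbrs_iff)
        then have "fst e = fst e'" using sw m(3) unfolding switching_def by blast
        then show "e = e'" using e(3) by (simp add: prod_eq_iff)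
      qed
      show "snd ` arc_block A (True, x) = R"
      proof (rule Set.equalityI; rule subsetI)
        fix r assume "r \<in> snd ` arc_block A (True, x)"
        then show "r \<in> R" by (auto simp: arc_block_def block_def dest: arc_cases)
      next
        fix r assume r: "r \<in> R"
        have "card (nbrs X r) = 2" using card_nbrs_R[OF r] k1 by simp
        then obtain v w where vw: "nbrs X r = {v, w}" "v \<noteq> w" by (auto simp: card_2_iff)
        then have "(v \<in> A) = (w \<notin> A)" using sw r unfolding switching_def by blast
        then obtain z where z: "z \<in> nbrs X r" "(z \<in> A) = x" using vw by (cases "(v \<in> A) = x") auto
        have "(z, r) \<in> parcs X" "z \<in> L" using z(1) X_sym nbrs_R[OF r] by (auto simp: nbrs_iff)
        then have "(z, r) \<in> arc_block A (True, x)"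
          using z(2) by (simp add: arc_block_def block_def left_end_def)
        then show "r \<in> snd ` arc_block A (True, x)" by force
      qed
    qed
    then show ?thesis by (rule bij_betw_same_card)
  qed
  have "arcs_between L R X = arc_block A (True, True) \<union> arc_block A (True, False)"
    unfolding arcs_LR by (auto simp: arc_block_def block_def)
  moreover have "arc_block A (True, True) \<inter> arc_block A (True, False) = {}" by (auto simp: arc_block_def)
  ultimately have N: "card (arcs_between L R X) = 2 * card R"
    using card_Un_disjoint[OF finite_arc_block finite_arc_block] cR by simp
  have fl: "flip (flip \<beta>) = \<beta>" for \<beta> by (simp add: flip_def)
  have "arc_block A (flip \<beta>) = prod.swap ` arc_block A \<beta>" for \<beta>
  proof (rule Set.equalityI; rule subsetI)
    fix e assume "e \<in> arc_block A (flip \<beta>)"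
    then have e: "e \<in> parcs X" "block A e = flip \<beta>" by (simp_all add: arc_block_def)
    have "prod.swap e \<in> parcs X" using e(1) swap_arcs by blast
    then have "prod.swap e \<in> arc_block A \<beta>"
      using block_swap[OF e(1), of A] e(2) fl by (simp add: arc_block_def)
    then show "e \<in> prod.swap ` arc_block A \<beta>" by (rule image_eqI[rotated]) simp
  next
    fix e assume "e \<in> prod.swap ` arc_block A \<beta>"
    then obtain e' where e': "e = prod.swap e'" "e' \<in> parcs X" "block A e' = \<beta>"
      by (auto simp: arc_block_def)
    have "prod.swap e' \<in> parcs X" using e'(2) swap_arcs by blast
    then show "e \<in> arc_block A (flip \<beta>)"
      using block_swap[OF e'(2), of A] e'(1,3) by (simp add: arc_block_def)
  qed
  then have "card (arc_block A (flip \<beta>)) = card (arc_block A \<beta>)" for \<beta> by (simp add: card_image)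
  from this[of "(True, snd \<beta>)"] have "card (arc_block A \<beta>) = card R"
    using cR by (cases \<beta>; cases "fst \<beta>") (auto simp: flip_def)
  then show ?thesis using N by simp
qed

text \<open>Outside the exceptional case the limit is the uniform distribution itself; in it, the
  limit is uniform on half of the arcs of the right direction, at distance 1/2.\<close>

lemma tv_upper_bound:
  assumes ram: "ramanujan X" and e\<^sub>0: "e\<^sub>0 \<in> parcs X"
  shows "tv_dist (nb_walk_pmf X e\<^sub>0 (2 * t)) (uniform_pmf L R X e\<^sub>0)
    \<le> (if k = 1 \<and> has_left_transversal L R X then 1/2 else 0)
      + sqrt (2 * real (card (arcs_between L R X))) * tree_bound (2 * t) / real (K * k) ^ t"
proof (cases "k = 1 \<and> has_left_transversal L R X")
  case False
  then have A: "L = L \<and> (2 \<le> k \<or> \<not> has_left_transversal L R X) \<or> k = 1 \<and> switching L True"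
    using k_pos by (cases "k = 1") auto
  have sw: "switching L False" using nbrs_R unfolding switching_def by blast
  have bl: "block L e = (fst e \<in> L, True)" if "e \<in> parcs X" for e
    using that arc_cases[of "fst e" "snd e"] by (auto simp: block_def left_end_def)
  have "arc_block L (block L e\<^sub>0) = {e \<in> parcs X. (fst e \<in> L) = (fst e\<^sub>0 \<in> L)}"
    using bl e\<^sub>0 by (auto simp: arc_block_def)
  then have "card (arc_block L (block L e\<^sub>0)) = card (arcs_between L R X)"
    using card_RL unfolding arcs_RL by (cases "fst e\<^sub>0 \<in> L") (simp_all add: arcs_LR)
  then have "limit_mass L False e\<^sub>0 t e = pmf (uniform_pmf L R X e\<^sub>0) e" if "e \<in> parcs X" for e
    using that bl e\<^sub>0 by (simp add: limit_mass_def pmf_uniform(1)[OF e\<^sub>0] shift_block_def)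
  then have "(\<Sum>e\<in>parcs X. \<bar>limit_mass L False e\<^sub>0 t e - pmf (uniform_pmf L R X e\<^sub>0) e\<bar>) \<le> 0" by simp
  from tv_upper_bound_aux[OF ram sw A e\<^sub>0 this] show ?thesis using False by (simp only: if_False)
next
  case True
  then obtain A where A: "A \<subseteq> L" "\<forall>w\<in>R. \<exists>!v. v \<in> A \<and> (w, v) \<in> parcs X"
    unfolding has_left_transversal_def by blast
  let ?N = "real (card (arcs_between L R X))"
  have sw: "switching A True"
    unfolding switching_def
  proof (intro ballI impI)
    fix r v v' assume r: "r \<in> R" "v \<in> nbrs X r" "v' \<in> nbrs X r" "v \<noteq> v'"
    have "card (nbrs X r) = 2" using card_nbrs_R[OF r(1)] True by simp
    then have two: "nbrs X r = {v, v'}" using r(2-4) unfolding card_2_iff by auto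
    have "\<exists>!a. a \<in> A \<and> a \<in> nbrs X r" using A(2) r(1) by (simp add: nbrs_iff)
    then show "(v \<in> A) = ((v' \<in> A) \<noteq> True)" unfolding two using r(4) by blast
  qed
  have c: "real (card (arc_block A (block A e\<^sub>0))) = ?N / 2"
    using card_arc_block_switching[OF conjunct1[OF True] sw, of "block A e\<^sub>0"] by linarith
  \<comment> \<open>On its half the limit has twice the uniform mass and elsewhere it is 0, so the
    difference is pointwise at most the uniform mass.\<close>
  have "(\<Sum>e\<in>parcs X. \<bar>limit_mass A True e\<^sub>0 t e - pmf (uniform_pmf L R X e\<^sub>0) e\<bar>)
      \<le> (\<Sum>e\<in>parcs X. pmf (uniform_pmf L R X e\<^sub>0) e)"
  proof (rule sum_mono)
    fix e assume e: "e \<in> parcs X"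
    have "fst e \<in> L \<longleftrightarrow> fst e\<^sub>0 \<in> L" if "shift_block True t (block A e) = block A e\<^sub>0"
      using that by (simp add: shift_block_def block_def)
    then show "\<bar>limit_mass A True e\<^sub>0 t e - pmf (uniform_pmf L R X e\<^sub>0) e\<bar> \<le> pmf (uniform_pmf L R X e\<^sub>0) e"
      using e unfolding limit_mass_def c pmf_uniform(1)[OF e\<^sub>0] by auto
  qed
  also have "\<dots> = 1" by (rule sum_pmf_eq_1[OF finite_E pmf_uniform(2)[OF e\<^sub>0]])
  finally have \<nu>: "(\<Sum>e\<in>parcs X. \<bar>limit_mass A True e\<^sub>0 t e - pmf (uniform_pmf L R X e\<^sub>0) e\<bar>) \<le> 1" .
  have "A = L \<and> (2 \<le> k \<or> \<not> has_left_transversal L R X) \<or> k = 1 \<and> switching A True" using True sw by blast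
  from tv_upper_bound_aux[OF ram sw this e\<^sub>0 \<nu>] show ?thesis using True by simp
qed

end

section \<open>Cutoff\<close>

lemma ereal_abs_diff_le:
  assumes "ereal (a - w) \<le> x" "x \<le> ereal (a + w)"
  shows "\<bar>x - ereal a\<bar> \<le> ereal w"
  using assms by (cases x) auto

text \<open>The numerator is of order log N through the linear factor of \<open>tree_bound\<close>;
  the exponent 3/2 is half of the 3 in the window.\<close>

lemma window_tendsto_0:
  fixes c d C D :: real
  assumes "0 < c" "0 < d"
  shows "(\<lambda>N::nat. C * (2 + (ln (real N) / c + 3 * (ln (ln (real N) / d) / c)) * D) / (ln (real N) / d) powr (3/2))
    \<longlonglongrightarrow> 0"
  using assms by real_asymp

theorem theorem4p11:
  fixes K k :: nat and b \<epsilon> :: real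
  assumes "1 \<le> k" and "k < K"
    and "1 < b"
    and "0 < \<epsilon>" and "\<epsilon> < 1"
  shows "\<exists>N\<^sub>0. \<forall>L R (X :: 'a pair_pre_digraph) N.
           bigraph K k L R X \<and> ramanujan X \<and>
           (k = 1 \<and> \<epsilon> \<le> 1/2 \<longrightarrow> \<not> has_left_transversal L R X) \<and>
           N = card (arcs_between L R X) \<and> N\<^sub>0 \<le> N \<longrightarrow>
           \<bar>t_mix \<epsilon> L R X - ereal (log (sqrt (real (K * k))) (real N))\<bar>
             \<le> ereal (3 * log (sqrt (real (K * k))) (log b (real N)))"
proof -
  define s where "s = sqrt (real (K * k))"
  define l where "l N = log s (real N)" for N
  define w where "w N = 3 * log s (log b (real N))" for N
  \<comment> \<open>The room left below \<epsilon> after the possible 1/2 in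
    \<open>tv_upper_bound\<close>; for \<epsilon> \<le> 1/2 the hypothesis excludes that
    term.\<close>
  define \<eta> where "\<eta> = (if \<epsilon> \<le> 1/2 then \<epsilon> else \<epsilon> - 1/2)"
  \<comment> \<open>A bound for the error term of \<open>tv_upper_bound\<close> at the chosen time;
    the factor \<open>s\<close> comes from rounding that time down to an even integer.\<close>
  define F where "F N = (sqrt 2 * real K * s) * (2 + (l N + w N) * real (K + 1)) / (log b (real N)) powr (3/2)" for N
  have "2 * 1 \<le> K * k" using assms(1,2) by (intro mult_le_mono) auto
  then have Kk: "2 \<le> real (K * k)" by linarith
  then have s: "1 < s" "s\<^sup>2 = real (K * k)" by (simp_all add: s_def)
  have \<eta>: "0 < \<eta>" using assms by (simp add: \<eta>_def)
  have "F \<longlonglongrightarrow> 0"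
    using window_tendsto_0[of "ln s" "ln b" "sqrt 2 * real K * s" "real (K + 1)"] s(1) assms(3)
    unfolding F_def l_def w_def log_def by (simp add: mult.assoc)
  then have F: "eventually (\<lambda>N. F N < \<eta>) sequentially" by (rule order_tendstoD(2)) (rule \<eta>)
  have W: "filterlim w at_top sequentially"
    unfolding w_def log_def using s(1) assms(3) by real_asymp
  \<comment> \<open>The condition on \<open>log s (1 - \<epsilon>)\<close> serves the lower bound on
    the mixing time, the one on \<open>F\<close> the upper bound.\<close>
  have ev: "eventually (\<lambda>N. 1 < log b (real N) \<and> 2 \<le> w N \<and> - log s (1 - \<epsilon>) \<le> w N \<and> 0 \<le> l N \<and> 1 \<le> N \<and> F N < \<eta>) sequentially"
  proof (intro eventually_conj F)
    show "eventually (\<lambda>N. 1 < log b (real N)) sequentially"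
      unfolding log_def using assms(3) by real_asymp
    show "eventually (\<lambda>N. 2 \<le> w N) sequentially" "eventually (\<lambda>N. - log s (1 - \<epsilon>) \<le> w N) sequentially"
      using W by (auto simp: filterlim_at_top)
    show "eventually (\<lambda>N. 0 \<le> l N) sequentially"
      unfolding l_def log_def using s(1) by real_asymp
    show "eventually (\<lambda>N. 1 \<le> N) sequentially" by (rule eventually_ge_at_top)
  qed
  then obtain N\<^sub>0 where N\<^sub>0: "\<And>N. N\<^sub>0 \<le> N \<Longrightarrow> 1 < log b (real N) \<and> 2 \<le> w N \<and> - log s (1 - \<epsilon>) \<le> w N \<and> 0 \<le> l N \<and> 1 \<le> N \<and> F N < \<eta>"
    unfolding eventually_sequentially by blast
  show ?thesis
  proof (intro exI[of _ N\<^sub>0] allI impI, elim conjE)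
    fix L R N and X :: "'a pair_pre_digraph"
    assume X: "bigraph K k L R X" "ramanujan X"
      and tr: "k = 1 \<and> \<epsilon> \<le> 1/2 \<longrightarrow> \<not> has_left_transversal L R X"
      and N: "N = card (arcs_between L R X)" "N\<^sub>0 \<le> N"
    interpret regular_bigraph K k L R X using X(1) assms(1,2) by unfold_locales
    have y: "1 < log b (real N)" and w: "2 \<le> w N" "- log s (1 - \<epsilon>) \<le> w N" and l: "0 \<le> l N"
      and N1: "1 \<le> N" and FN: "F N < \<eta>" using N\<^sub>0[OF N(2)] by auto
    have Npos: "0 < real N" using N1 by simp
    \<comment> \<open>The largest t with 2 t at most \<open>l N + w N\<close>; at most 2 is
      lost.\<close>
    define t where "t = nat \<lfloor>(l N + w N) / 2\<rfloor>"
    have t: "2 * real t \<le> l N + w N" "l N + w N - 2 \<le> 2 * real t"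
    proof -
      have "real t = of_int \<lfloor>(l N + w N) / 2\<rfloor>" using l w(1) by (simp add: t_def)
      moreover have "real_of_int \<lfloor>(l N + w N) / 2\<rfloor> \<le> (l N + w N) / 2"
        "(l N + w N) / 2 < real_of_int \<lfloor>(l N + w N) / 2\<rfloor> + 1"
        by (rule of_int_floor_le, rule real_of_int_floor_add_one_gt)
      ultimately show "2 * real t \<le> l N + w N" "l N + w N - 2 \<le> 2 * real t" by argo+
    qed
    have Qt: "real (K * k) ^ m = s ^ m * s ^ m" for m
      unfolding s(2)[symmetric] by (simp add: power2_eq_square power_mult_distrib)
    have "sqrt (2 * real N) * tree_bound (2 * t) / real (K * k) ^ t \<le> F N"
    proof -
      have "sqrt (sqrt (real (K * k))) ^ (2 * t) = s ^ t" using s(1) by (simp add: power_mult s_def)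
      then have tb: "tree_bound (2 * t) = real K * (s ^ t * (2 + 2 * real t * real (K + 1)))"
        by (simp add: tree_bound_def)
      \<comment> \<open>The share \<open>l N\<close> of the time yields
        \<open>sqrt (real N)\<close>, the share \<open>w N\<close> the power 3/2 of the logarithm;
        the loss of 2 costs the factor \<open>s\<close>.\<close>
      have pw: "sqrt (real N) * (log b (real N)) powr (3/2) / s \<le> s ^ t"
      proof -
        have "s powr (l N / 2) = (s powr log s (real N)) powr (1/2)"
          unfolding powr_powr by (simp add: l_def)
        then have "s powr (l N / 2) = sqrt (real N)" using s(1) Npos by (simp add: powr_half_sqrt)
        moreover have "s powr (w N / 2) = (s powr log s (log b (real N))) powr (3/2)"
          unfolding powr_powr by (simp add: w_def mult.commute)
        then have "s powr (w N / 2) = (log b (real N)) powr (3/2)" using s(1) y by simp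
        moreover have "s powr ((l N + w N - 2) / 2) = s powr (l N / 2) * s powr (w N / 2) / s"
          using s(1) by (simp add: diff_divide_distrib add_divide_distrib powr_diff powr_add)
        moreover have "s powr ((l N + w N - 2) / 2) \<le> s powr (real t)"
          using t(2) s(1) by (intro powr_mono) auto
        ultimately show ?thesis using s(1) by (simp add: powr_realpow)
      qed
      have st: "0 < s ^ t" using s(1) by simp
      have yp: "0 < (log b (real N)) powr (3/2)" using y by simp
      have cancel: "a * (c * (x * z)) / (x * x) = a * c * z / x" if "0 < x" for a c x z :: real
        using that by simp
      have "sqrt (2 * real N) * tree_bound (2 * t) / real (K * k) ^ t
          = sqrt 2 * sqrt (real N) * real K * (2 + 2 * real t * real (K + 1)) / s ^ t"
        unfolding tb Qt real_sqrt_mult by (rule cancel[OF st])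
      also have "\<dots> \<le> sqrt 2 * sqrt (real N) * real K * (2 + (l N + w N) * real (K + 1)) / s ^ t"
        using t(1) st by (intro divide_right_mono mult_left_mono add_left_mono mult_right_mono) auto
      also have "\<dots> \<le> sqrt 2 * sqrt (real N) * real K * (2 + (l N + w N) * real (K + 1)) /
          (sqrt (real N) * (log b (real N)) powr (3/2) / s)"
        using pw s(1) Npos yp l w(1) by (intro divide_left_mono mult_nonneg_nonneg mult_pos_pos divide_pos_pos) auto
      also have "\<dots> = F N" using s(1) Npos yp by (simp add: F_def field_simps)
      finally show ?thesis .
    qed
    then have small: "sqrt (2 * real N) * tree_bound (2 * t) / real (K * k) ^ t < \<eta>" using FN by linarith
    have up: "tv_dist (nb_walk_pmf X e\<^sub>0 (2 * t)) (uniform_pmf L R X e\<^sub>0) < \<epsilon>" if "e\<^sub>0 \<in> parcs X" for e\<^sub>0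
    proof -
      have "(if k = 1 \<and> has_left_transversal L R X then 1/2 else 0) + \<eta> \<le> \<epsilon>"
        using tr unfolding \<eta>_def by auto
      then show ?thesis using tv_upper_bound[OF X(2) that, of t] small unfolding N(1) by linarith
    qed
    have "t_mix \<epsilon> L R X \<le> ereal (real (2 * t))"
      unfolding t_mix_def using up by (intro INF_lower) auto
    also have "\<dots> \<le> ereal (l N + w N)" using t(1) by simp
    finally have upper: "t_mix \<epsilon> L R X \<le> ereal (l N + w N)" .
    have lower: "ereal (l N - w N) \<le> t_mix \<epsilon> L R X"
      unfolding t_mix_def
    proof (rule INF_greatest)
      fix n assume n: "n \<in> {n. even n \<and>
        (\<forall>e\<^sub>0\<in>parcs X. tv_dist (nb_walk_pmf X e\<^sub>0 n) (uniform_pmf L R X e\<^sub>0) < \<epsilon>)}"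
      then obtain m where m: "n = 2 * m" by (auto elim: evenE)
      have "arcs_between L R X \<noteq> {}" using N1 unfolding N(1) by auto
      then obtain e\<^sub>0 where e\<^sub>0: "e\<^sub>0 \<in> parcs X" unfolding arcs_between_def by blast
      \<comment> \<open>At a time with distance below \<epsilon> the number of reachable arcs has to
        exceed (1 - \<epsilon>) N; after taking logarithms, the window absorbs
        \<open>log s (1 - \<epsilon>)\<close>.\<close>
      have "1 - real (K * k) ^ m / real N < \<epsilon>"
        using tv_lower_bound[OF e\<^sub>0, of m] n e\<^sub>0 unfolding m N(1) by force
      then have "(1 - \<epsilon>) * real N < real (K * k) ^ m" using Npos by (simp add: field_simps)
      also have "\<dots> = s powr (2 * real m)"
      proof -
        have "s powr (real m + real m) = s ^ m * s ^ m"
          using s(1) unfolding powr_add by (simp add: powr_realpow)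
        then show ?thesis unfolding Qt by simp
      qed
      finally have "log s ((1 - \<epsilon>) * real N) < 2 * real m"
        using s(1) Npos assms(5) by (subst log_less_iff) auto
      then have "log s (1 - \<epsilon>) + l N < 2 * real m"
        using s(1) Npos assms(5) by (simp add: log_mult l_def)
      then show "ereal (l N - w N) \<le> ereal (real n)" using w(2) by (simp add: m)
    qed
    show "\<bar>t_mix \<epsilon> L R X - ereal (log (sqrt (real (K * k))) (real N))\<bar>
             \<le> ereal (3 * log (sqrt (real (K * k))) (log b (real N)))"
      using ereal_abs_diff_le[OF lower upper] by (simp add: l_def w_def s_def)
  qed
qed

end
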